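(* Let $\tau\in(0,1)$ with $\tau<2/3$, let $(H_N)_N$ be an ensemble of Curie-Weiss type, $s(z)=\frac1N\operatorname{tr}(H_N-z)^{-1}$ for $\operatorname{Im}z>0$, and set $\eta_N=1/N^{1-\tau}$ for $N\in\mathbb{N}$. Let $f_\sigma(x)=\frac{1}{2\pi}\sqrt{(4-x^2)_+}$ be the density of the semicircle distribution. Then $$\sup_{E\in[-\tau^{-1},\tau^{-1}]}\left|\frac1\pi\operatorname{Im}\big(s(E+i\eta_N)\big)-f_\sigma(E)\right|\prec\frac{1}{N^{\tau/4}}.$$
   Context: De-Finetti type: for a finite index set $I$, a family $Y_I=(Y_i)_{i\in I}$ of real random variables on a probability space $(\Omega,\mathcal{A},\mathbb{P})$ is of de-Finetti type with respect to the mixing space $(T,\mathcal{T},\mu,P)$ if $(T,\mathcal{T},\mu)$ is a probability space, $P:T\to\mathcal{M}_1(\mathbb{R})$, $t\mapsto P_t$, is measurable ($\mathcal{M}_1(\mathbb{R})$ = Borel probability measures on $\mathbb{R}$ with the Borel $\sigma$-algebra of the weak topology), and $\mathbb{P}(Y_I\in B)=\int_T P_t^{\otimes I}(B)\,d\mu(t)$ for all measurable $B\subseteq\mathbb{R}^I$. Curie-Weiss type: a sequence $(H_N)_N$ of real symmetric random $N\times N$ matrices is of Curie-Weiss type if (a) for all $N$, $(H_N(i,j))_{1\le i\le j\le N}=(\frac{1}{\sqrt N}X_N(i,j))_{1\le i\le j\le N}$, where $(X_N(i,j))_{1\le i\le j\le N}$ is of de-Finetti type with respect to some mixing space $(T_N,\mathcal{T}_N,\mu_N,P^{(N)})$;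 and (b) with $m_N^{(\ell)}(t)=\int_{\mathbb{R}}x^\ell\,dP^{(N)}_t(x)$, for every even $p\in\mathbb{N}$ there is $K_p\ge 0$ such that for all $N\in\mathbb{N}$: $\int_{T_N}|m_N^{(1)}(t)|^p\,d\mu_N(t)\le K_pN^{-p/2}$; $\int_{T_N}|1-m_N^{(2)}(t)|^p\,d\mu_N(t)\le K_pN^{-p/2}$; $\sup_{t\in T_N}\int_{\mathbb{R}}|y-m_N^{(1)}(t)|^p\,dP_t^{(N)}(y)\le K_p$; $\sup_{t\in T_N}\int_{\mathbb{R}}|y^2-m_N^{(2)}(t)|^p\,dP_t^{(N)}(y)\le K_p$. Stochastic domination: for complex random variables $X^{(N)}$ and non-negative random variables $Y^{(N)}$, $X^{(N)}\prec Y^{(N)}$ means: for all $\epsilon,D>0$ there is $C_{\epsilon,D}\ge0$ with $\mathbb{P}(|X^{(N)}|>N^\epsilon Y^{(N)})\le C_{\epsilon,D}N^{-D}$ for all $N\in\mathbb{N}$. *)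

theory Defs
  imports
    "HOL-Probability.Probability"
    "Jordan_Normal_Form.Gauss_Jordan_Elimination"
begin

section \<open>Borel probability measures on the line, with the weak topology\<close>

abbreviation prob_measures :: "real measure set" where
  "prob_measures \<equiv> {Q. sets Q = sets borel \<and> prob_space Q}"

text \<open>The coarsest topology for which integration against every bounded continuous function
  is continuous.\<close>

definition weak_topology :: "real measure topology" where
  "weak_topology = topology_generated_by
     {{Q \<in> prob_measures. (\<integral>x. f x \<partial>Q) \<in> U} | (f :: real \<Rightarrow> real) U.
        continuous_on UNIV f \<and> bounded (range f) \<and> open U}"

definition weak_borel :: "real measure measure" where
  "weak_borel = sigma prob_measures {V. openin weak_topology V}"

lemma topspace_weak_topology: "topspace weak_topology = prob_measures"
proof -
  have "prob_measures \<in> {{Q \<in> prob_measures. (\<integral>x. f x \<partial>Q) \<in> U} | (f :: real \<Rightarrow> real) U.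
        continuous_on UNIV f \<and> bounded (range f) \<and> open U}"
    by (rule CollectI, rule exI[of _ "\<lambda>_. 0"], rule exI[of _ UNIV]) auto
  then show ?thesis
    unfolding weak_topology_def topology_generated_by_topspace by blast
qed

lemma openin_weak_topology_subset: "{V. openin weak_topology V} \<subseteq> Pow prob_measures"
  using openin_subset topspace_weak_topology by blast

lemma space_weak_borel: "space weak_borel = prob_measures"
  unfolding weak_borel_def by (rule space_measure_of[OF openin_weak_topology_subset])

lemma sets_weak_borel: "sets weak_borel = sigma_sets prob_measures {V. openin weak_topology V}"
  unfolding weak_borel_def by (rule sets_measure_of[OF openin_weak_topology_subset])


section \<open>Random matrices of Curie-Weiss type\<close>

definition mixing_space :: "'t measure \<Rightarrow> ('t \<Rightarrow> real measure) \<Rightarrow> bool" where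
  "mixing_space T P \<longleftrightarrow> prob_space T \<and> P \<in> T \<rightarrow>\<^sub>M weak_borel"

definition de_finetti_type ::
  "'a measure \<Rightarrow> 'i set \<Rightarrow> ('i \<Rightarrow> 'a \<Rightarrow> real) \<Rightarrow> 't measure \<Rightarrow> ('t \<Rightarrow> real measure) \<Rightarrow> bool" where
  "de_finetti_type M I Y T P \<longleftrightarrow>
     prob_space M \<and> finite I \<and> (\<forall>i\<in>I. Y i \<in> borel_measurable M) \<and> mixing_space T P \<and>
     (\<forall>B \<in> sets (Pi\<^sub>M I (\<lambda>_. borel)).
        emeasure M {\<omega> \<in> space M. (\<lambda>i\<in>I. Y i \<omega>) \<in> B} =
        (\<integral>\<^sup>+t. emeasure (Pi\<^sub>M I (\<lambda>_. P t)) B \<partial>T))"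

definition moment :: "nat \<Rightarrow> real measure \<Rightarrow> real" where
  "moment l Q = (\<integral>x. x ^ l \<partial>Q)"

text \<open>The index set \<open>{1..N}\<close> is shifted to \<open>{0..<N}\<close>, and natural numbers start at 1, so that
  nothing is required for \<open>N = 0\<close>.

  The moment bounds are stated with the nonnegative integral, so that they assert finiteness.
  In particular they force \<open>x\<close> and \<open>x\<^sup>2\<close> to be integrable with respect to every \<open>P N t\<close>: if \<open>x ^ l\<close>
  were not integrable, then \<open>moment l (P N t) = 0\<close> and the corresponding central bound would fail.
  Hence \<open>moment\<close> is only ever used where it is a genuine moment.\<close>

definition curie_weiss_type ::
  "'a measure \<Rightarrow> (nat \<Rightarrow> 'a \<Rightarrow> real mat) \<Rightarrow> (nat \<Rightarrow> 't measure) \<Rightarrow> (nat \<Rightarrow> 't \<Rightarrow> real measure) \<Rightarrow> bool"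
where
  "curie_weiss_type M H T P \<longleftrightarrow>
     (\<forall>N\<ge>1. \<forall>\<omega>\<in>space M. H N \<omega> \<in> carrier_mat N N \<and> transpose_mat (H N \<omega>) = H N \<omega>) \<and>
     (\<forall>N\<ge>1. \<exists>X. de_finetti_type M {(i, j). i \<le> j \<and> j < N} X (T N) (P N) \<and>
        (\<forall>\<omega>\<in>space M. \<forall>i j. i \<le> j \<and> j < N \<longrightarrow>
           H N \<omega> $$ (i, j) = 1 / sqrt (real N) * X (i, j) \<omega>)) \<and>
     (\<forall>p>0. even p \<longrightarrow> (\<exists>K\<ge>0. \<forall>N\<ge>1.
        (\<integral>\<^sup>+t. ennreal (\<bar>moment 1 (P N t)\<bar> ^ p) \<partial>T N) \<le> ennreal (K * real N powr (- real p / 2)) \<and>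
        (\<integral>\<^sup>+t. ennreal (\<bar>1 - moment 2 (P N t)\<bar> ^ p) \<partial>T N) \<le> ennreal (K * real N powr (- real p / 2)) \<and>
        (\<forall>t\<in>space (T N). (\<integral>\<^sup>+y. ennreal (\<bar>y - moment 1 (P N t)\<bar> ^ p) \<partial>P N t) \<le> ennreal K) \<and>
        (\<forall>t\<in>space (T N). (\<integral>\<^sup>+y. ennreal (\<bar>y\<^sup>2 - moment 2 (P N t)\<bar> ^ p) \<partial>P N t) \<le> ennreal K)))"


section \<open>Stieltjes transform and semicircle density\<close>

text \<open>For \<open>Im z > 0\<close> and \<open>A\<close> real symmetric, \<open>A - z\<close> is invertible and \<open>mat_inverse\<close> does not
  return \<open>None\<close>.\<close>

definition resolvent :: "real mat \<Rightarrow> complex \<Rightarrow> complex mat" where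
  "resolvent A z = the (mat_inverse (map_mat complex_of_real A - z \<cdot>\<^sub>m 1\<^sub>m (dim_row A)))"

definition mat_trace :: "'b::comm_monoid_add mat \<Rightarrow> 'b" where
  "mat_trace A = (\<Sum>i<dim_row A. A $$ (i, i))"

definition stieltjes :: "real mat \<Rightarrow> complex \<Rightarrow> complex" where
  "stieltjes A z = 1 / of_nat (dim_row A) * mat_trace (resolvent A z)"

definition semicircle_density :: "real \<Rightarrow> real" where
  "semicircle_density x = 1 / (2 * pi) * sqrt (max 0 (4 - x\<^sup>2))"


section \<open>Stochastic domination\<close>

text \<open>Measurability is part of the relation, since \<open>measure\<close> vanishes on non-measurable sets.\<close>

definition stochastically_dominated ::
  "'a measure \<Rightarrow> (nat \<Rightarrow> 'a \<Rightarrow> complex) \<Rightarrow> (nat \<Rightarrow> 'a \<Rightarrow> real) \<Rightarrow> bool" where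
  "stochastically_dominated M X Y \<longleftrightarrow>
     (\<forall>N\<ge>1. X N \<in> borel_measurable M \<and> Y N \<in> borel_measurable M \<and> (\<forall>\<omega>\<in>space M. 0 \<le> Y N \<omega>)) \<and>
     (\<forall>\<epsilon>>0. \<forall>D>0. \<exists>C\<ge>0. \<forall>N\<ge>1.
        measure M {\<omega> \<in> space M. cmod (X N \<omega>) > real N powr \<epsilon> * Y N \<omega>} \<le> C * real N powr (- D))"

end

theory Submission
  imports Defs "Jordan_Normal_Form.Determinant"
begin

text \<open>
  Write \<eta> for the imaginary part of z and s(z) for the normalised trace of the resolvent. Conditionally
  on the mixing parameter t, the entries on and above the diagonal are independent with common law P t.
  It therefore suffices to treat independent entries, with exceptional probabilities that decay faster
  than any power of N uniformly in t, and to integrate over t at the end (law_for_iid_entries,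
  mixture_bound). Subtracting the conditional mean from all entries is a rank-one perturbation; it
  changes s by at most 1 / (N \<eta>), whatever the mean is (avg_green_rank_one). The conditional variance
  is 1 up to N^(\<epsilon> - 1/2), except for few t. So let the entries be centred with variance close to 1.

  By Schur's formula, the diagonal entries of the resolvent are - 1 / (z + s + \<Omega>_k). The main part of
  \<Omega>_k is the fluctuation of a quadratic form in the k-th row, whose coefficients are the resolvent
  entries of the minor without row and column k. Row and minor are independent, so that moment bounds
  for quadratic forms (quadratic_form_moment, quadratic_form_concentration) show that the fluctuation
  is at most N^\<epsilon> / N times the Hilbert-Schmidt norm of the resolvent of the minor. The Ward identity
  (green_ward) turns this into N^\<epsilon> (N \<eta>)^(-1/2) as long as s is bounded (schur_error_bound). Averaging
  over k gives s^2 + z s + 1 = O(N^\<epsilon> (N \<eta>)^(-1/2)).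

  The Stieltjes transform m of the semicircle law is one of the two roots of the unperturbed quadratic
  equation. Hence s is close to one of the roots, with an error of the order of the square root of the
  perturbation, which is N^(\<epsilon>/2) (N \<eta>)^(-1/4) and equals N^(\<epsilon>/2 - \<tau>/4) at the scale \<eta> = N^(\<tau> - 1).
  That s is bounded and close to the right root follows by a bootstrap (bootstrap_down), which
  starts at height 8 and descends to this scale in polynomially many small steps. The union bound over
  the steps and over a fine grid of energies costs only powers of N. Finally, Im m / pi differs from the
  semicircle density by O(sqrt \<eta>) (Im_msc_near_semicircle), and this is O(N^(-\<tau>/4)) because \<tau> is at
  most 2/3.
\<close>

section \<open>The Green function of a real symmetric matrix\<close>

definition sym_kernel :: "('k \<Rightarrow> 'k \<Rightarrow> 'b) \<Rightarrow> bool" where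
  "sym_kernel W \<longleftrightarrow> (\<forall>i j. W i j = W j i)"

lemma sym_kernelD: "sym_kernel W \<Longrightarrow> W i j = W j i"
  by (simp add: sym_kernel_def)

text \<open>
  The index set S is an arbitrary finite set, so that a minor of the matrix is again an instance of
  the same notion: deleting row and column k is passing from insert k S to S. The entries outside S
  are required to vanish, which makes the inverse unique as a function on the whole index type.
\<close>

definition is_green :: "'k set \<Rightarrow> ('k \<Rightarrow> 'k \<Rightarrow> real) \<Rightarrow> complex \<Rightarrow> ('k \<Rightarrow> 'k \<Rightarrow> complex) \<Rightarrow> bool" where
  "is_green S W z G \<longleftrightarrow> (\<forall>i j. i \<notin> S \<or> j \<notin> S \<longrightarrow> G i j = 0) \<and>
     (\<forall>i\<in>S. \<forall>j\<in>S. (\<Sum>k\<in>S. of_real (W i k) * G k j) - z * G i j = (if i = j then 1 else 0))"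

definition green :: "'k set \<Rightarrow> ('k \<Rightarrow> 'k \<Rightarrow> real) \<Rightarrow> complex \<Rightarrow> 'k \<Rightarrow> 'k \<Rightarrow> complex" where
  "green S W z = (THE G. is_green S W z G)"

text \<open>
  Since W is real and symmetric, the quadratic form of W at u is real, so that the imaginary part
  of the pairing of u with (W - z) u comes from - z alone. Applied to a column of the Green function
  this is the Ward identity; applied to other vectors it controls the denominators in the Schur
  complement formula and in the Sherman-Morrison formula.
\<close>

lemma ward_vector:
  fixes W :: "'k \<Rightarrow> 'k \<Rightarrow> real" and u v :: "'k \<Rightarrow> complex"
  assumes sym: "sym_kernel W"
    and eq: "\<And>i. i \<in> S \<Longrightarrow> (\<Sum>j\<in>S. of_real (W i j) * u j) - z * u i = v i"
  shows "Im (\<Sum>i\<in>S. cnj (u i) * v i) = - Im z * (\<Sum>i\<in>S. (cmod (u i))\<^sup>2)"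
proof -
  define q where "q = (\<Sum>i\<in>S. \<Sum>j\<in>S. cnj (u i) * of_real (W i j) * u j)"
  have "cnj q = (\<Sum>i\<in>S. \<Sum>j\<in>S. u i * of_real (W i j) * cnj (u j))"
    by (simp add: q_def)
  also have "... = (\<Sum>j\<in>S. \<Sum>i\<in>S. u i * of_real (W i j) * cnj (u j))"
    by (rule sum.swap)
  also have "... = q"
    unfolding q_def by (intro sum.cong refl) (subst sym_kernelD[OF sym], simp add: mult_ac)
  finally have "Im q = 0"
    by (simp add: complex_eq_iff)
  have "(\<Sum>i\<in>S. cnj (u i) * v i) = (\<Sum>i\<in>S. (\<Sum>j\<in>S. cnj (u i) * of_real (W i j) * u j) - z * (of_real ((cmod (u i))\<^sup>2)))"
  proof (intro sum.cong refl)
    fix i assume "i \<in> S"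
    have "cnj (u i) * v i = cnj (u i) * (\<Sum>j\<in>S. of_real (W i j) * u j) - z * (u i * cnj (u i))"
      by (simp add: eq[OF \<open>i \<in> S\<close>, symmetric] algebra_simps)
    then show "cnj (u i) * v i = (\<Sum>j\<in>S. cnj (u i) * of_real (W i j) * u j) - z * (of_real ((cmod (u i))\<^sup>2))"
      by (simp only: complex_norm_square sum_distrib_left mult.assoc)
  qed
  also have "... = q - z * of_real (\<Sum>i\<in>S. (cmod (u i))\<^sup>2)"
    by (simp add: q_def sum_subtractf sum_distrib_left)
  finally show ?thesis using \<open>Im q = 0\<close> by simp
qed

text \<open>
  The resolvent has operator norm at most 1 / Im z. The pairing in the previous identity is bounded
  by the arithmetic-geometric mean inequality, with weights chosen so that half of the left-hand side
  is absorbed.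
\<close>

lemma resolvent_contraction:
  fixes W :: "'k \<Rightarrow> 'k \<Rightarrow> real" and u v :: "'k \<Rightarrow> complex"
  assumes sym: "sym_kernel W" and z: "Im z > 0"
    and eq: "\<And>i. i \<in> S \<Longrightarrow> (\<Sum>j\<in>S. of_real (W i j) * u j) - z * u i = v i"
  shows "(Im z)\<^sup>2 * (\<Sum>i\<in>S. (cmod (u i))\<^sup>2) \<le> (\<Sum>i\<in>S. (cmod (v i))\<^sup>2)"
proof -
  let ?U = "\<Sum>i\<in>S. (cmod (u i))\<^sup>2" and ?V = "\<Sum>i\<in>S. (cmod (v i))\<^sup>2"
  have "Im z * ?U = - Im (\<Sum>i\<in>S. cnj (u i) * v i)"
    using ward_vector[OF sym eq] by simp
  also have "... \<le> cmod (\<Sum>i\<in>S. cnj (u i) * v i)"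
    using abs_Im_le_cmod[of "\<Sum>i\<in>S. cnj (u i) * v i"] by linarith
  also have "... \<le> (\<Sum>i\<in>S. cmod (u i) * cmod (v i))"
    by (rule order_trans[OF norm_sum]) (simp add: norm_mult)
  also have "... \<le> (\<Sum>i\<in>S. Im z / 2 * (cmod (u i))\<^sup>2 + (cmod (v i))\<^sup>2 / (2 * Im z))"
  proof (intro sum_mono)
    fix i
    have "0 \<le> (Im z * cmod (u i) - cmod (v i))\<^sup>2" by simp
    then show "cmod (u i) * cmod (v i) \<le> Im z / 2 * (cmod (u i))\<^sup>2 + (cmod (v i))\<^sup>2 / (2 * Im z)"
      using z by (simp add: field_simps power2_eq_square)
  qed
  also have "... = Im z / 2 * ?U + ?V / (2 * Im z)"
    by (simp add: sum.distrib sum_distrib_left sum_divide_distrib)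
  finally show ?thesis using z by (simp add: field_simps power2_eq_square)
qed

lemma resolvent_vector_unique:
  fixes W :: "'k \<Rightarrow> 'k \<Rightarrow> real" and u u' v :: "'k \<Rightarrow> complex"
  assumes S: "finite S" and sym: "sym_kernel W" and z: "Im z > 0"
    and eq: "\<And>i. i \<in> S \<Longrightarrow> (\<Sum>j\<in>S. of_real (W i j) * u j) - z * u i = v i"
    and eq': "\<And>i. i \<in> S \<Longrightarrow> (\<Sum>j\<in>S. of_real (W i j) * u' j) - z * u' i = v i"
    and i: "i \<in> S"
  shows "u i = u' i"
proof -
  have "(\<Sum>j\<in>S. of_real (W i j) * (u j - u' j)) - z * (u i - u' i) = 0" if "i \<in> S" for i
    using eq[OF that] eq'[OF that] by (simp add: algebra_simps sum_subtractf)
  from resolvent_contraction[OF sym z this]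
  have "(Im z)\<^sup>2 * (\<Sum>i\<in>S. (cmod (u i - u' i))\<^sup>2) \<le> 0" by simp
  then have "(\<Sum>i\<in>S. (cmod (u i - u' i))\<^sup>2) \<le> 0"
    using z by (simp add: mult_le_0_iff)
  then have "(\<Sum>i\<in>S. (cmod (u i - u' i))\<^sup>2) = 0"
    by (intro antisym sum_nonneg) auto
  then show ?thesis using S i by (simp add: sum_nonneg_eq_0_iff)
qed

lemma is_green_unique:
  assumes "finite S" "sym_kernel W" "Im z > 0" "is_green S W z G" "is_green S W z G'"
  shows "G = G'"
proof (intro ext)
  fix i j
  show "G i j = G' i j"
  proof (cases "i \<in> S \<and> j \<in> S")
    case True
    then have ij: "i \<in> S" "j \<in> S" by auto
    show ?thesis
    proof (rule resolvent_vector_unique[where u = "\<lambda>i. G i j" and u' = "\<lambda>i. G' i j"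
          and v = "\<lambda>i. if i = j then 1 else 0", OF assms(1-3) _ _ ij(1)])
      show "(\<Sum>l\<in>S. of_real (W i l) * G l j) - z * G i j = (if i = j then 1 else 0)" if "i \<in> S" for i
        using assms(4) that ij(2) unfolding is_green_def by blast
      show "(\<Sum>l\<in>S. of_real (W i l) * G' l j) - z * G' i j = (if i = j then 1 else 0)" if "i \<in> S" for i
        using assms(5) that ij(2) unfolding is_green_def by blast
    qed
  next
    case False
    then show ?thesis using assms(4,5) by (auto simp: is_green_def)
  qed
qed

text \<open>
  Write G^T (W - z) G in two ways. As W is symmetric, exchanging the two outer indices changes
  nothing, while evaluating (W - z) G first produces the transposed entries of G.
\<close>

lemma is_green_sym:
  assumes S: "finite S" and sym: "sym_kernel W" and G: "is_green S W z G"
  shows "G i j = G j i"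
proof (cases "i \<in> S \<and> j \<in> S")
  case False
  then show ?thesis using G by (auto simp: is_green_def)
next
  case True
  then have ij: "i \<in> S" "j \<in> S" by auto
  have eq: "(\<Sum>l\<in>S. of_real (W k l) * G l j) - z * G k j = (if k = j then 1 else 0)"
    if "k \<in> S" "j \<in> S" for k j
    using G that by (auto simp: is_green_def)
  have *: "(\<Sum>k\<in>S. \<Sum>l\<in>S. G k i * of_real (W k l) * G l j) - z * (\<Sum>k\<in>S. G k i * G k j) = G j i"
    if ij: "i \<in> S" "j \<in> S" for i j
  proof -
    have "(\<Sum>k\<in>S. \<Sum>l\<in>S. G k i * of_real (W k l) * G l j) - z * (\<Sum>k\<in>S. G k i * G k j)
        = (\<Sum>k\<in>S. G k i * ((\<Sum>l\<in>S. of_real (W k l) * G l j) - z * G k j))"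
      by (simp add: sum_distrib_left sum_subtractf algebra_simps)
    also have "... = (\<Sum>k\<in>S. G k i * (if k = j then 1 else 0))"
      using ij by (intro sum.cong) (auto simp: eq)
    also have "... = G j i" using ij S by (simp add: if_distrib cong: if_cong)
    finally show ?thesis .
  qed
  have "(\<Sum>k\<in>S. \<Sum>l\<in>S. G k i * of_real (W k l) * G l j) = (\<Sum>l\<in>S. \<Sum>k\<in>S. G k i * of_real (W k l) * G l j)"
    by (rule sum.swap)
  also have "... = (\<Sum>k\<in>S. \<Sum>l\<in>S. G k j * of_real (W k l) * G l i)"
    by (intro sum.cong refl) (subst sym_kernelD[OF sym], simp add: mult_ac)
  finally show ?thesis
    using *[OF ij] *[OF ij(2,1)] by (simp add: mult.commute)
qed

text \<open>
  The column G W e_k, where G is the Green function of the minor.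
\<close>

definition schur_vec :: "'k set \<Rightarrow> ('k \<Rightarrow> 'k \<Rightarrow> real) \<Rightarrow> ('k \<Rightarrow> 'k \<Rightarrow> complex) \<Rightarrow> 'k \<Rightarrow> 'k \<Rightarrow> complex" where
  "schur_vec S W G k i = (\<Sum>j\<in>S. G i j * of_real (W j k))"

text \<open>
  The Schur complement of the minor in W - z, that is, the reciprocal of the diagonal entry at k of
  the Green function of the bordered matrix.
\<close>

definition schur_den :: "'k set \<Rightarrow> ('k \<Rightarrow> 'k \<Rightarrow> real) \<Rightarrow> complex \<Rightarrow> ('k \<Rightarrow> 'k \<Rightarrow> complex) \<Rightarrow> 'k \<Rightarrow> complex" where
  "schur_den S W z G k = of_real (W k k) - z - (\<Sum>i\<in>S. of_real (W k i) * schur_vec S W G k i)"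

text \<open>
  The formula for the inverse of a bordered matrix.
\<close>

definition schur_ext where
  "schur_ext S W z G k i j =
     (let d = schur_den S W z G k; b = schur_vec S W G k in
      if i = k \<and> j = k then 1 / d
      else if i = k then - b j / d
      else if j = k then - b i / d
      else G i j + b i * b j / d)"

lemma schur_vec_eq:
  assumes "finite S" and G: "is_green S W z G" and i: "i \<in> S"
  shows "(\<Sum>j\<in>S. of_real (W i j) * schur_vec S W G k j) - z * schur_vec S W G k i = of_real (W i k)"
proof -
  have "(\<Sum>j\<in>S. of_real (W i j) * schur_vec S W G k j) = (\<Sum>j\<in>S. \<Sum>l\<in>S. of_real (W i j) * G j l * of_real (W l k))"
    by (simp add: schur_vec_def sum_distrib_left mult.assoc)
  also have "... = (\<Sum>l\<in>S. (\<Sum>j\<in>S. of_real (W i j) * G j l) * of_real (W l k))"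
    by (subst sum.swap) (simp add: sum_distrib_right)
  finally have "(\<Sum>j\<in>S. of_real (W i j) * schur_vec S W G k j) - z * schur_vec S W G k i
     = (\<Sum>l\<in>S. ((\<Sum>j\<in>S. of_real (W i j) * G j l) - z * G i l) * of_real (W l k))"
    by (simp add: schur_vec_def sum_distrib_left sum_subtractf algebra_simps)
  also have "... = (\<Sum>l\<in>S. (if i = l then 1 else 0) * of_real (W l k))"
    using G i by (intro sum.cong) (auto simp: is_green_def)
  also have "... = of_real (W i k)" using i assms(1) by (simp add: if_distrib if_distribR cong: if_cong)
  finally show ?thesis .
qed

text \<open>
  The imaginary part is explicit by the identity above for the vector G W e_k. It never vanishes,
  so that the bordered inverse always exists, and it dominates the numerator of the change of the trace.
\<close>

lemma Im_schur_den:
  assumes S: "finite S" and sym: "sym_kernel W" and G: "is_green S W z G"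
  shows "Im (schur_den S W z G k) = - Im z * (1 + (\<Sum>i\<in>S. (cmod (schur_vec S W G k i))\<^sup>2))"
proof -
  have 1: "Im (\<Sum>i\<in>S. cnj (schur_vec S W G k i) * of_real (W i k))
       = - Im z * (\<Sum>i\<in>S. (cmod (schur_vec S W G k i))\<^sup>2)"
    by (rule ward_vector[OF sym schur_vec_eq[OF S G]])
  have "cnj (\<Sum>i\<in>S. cnj (schur_vec S W G k i) * of_real (W i k)) = (\<Sum>i\<in>S. of_real (W k i) * schur_vec S W G k i)"
    by (simp, subst sym_kernelD[OF sym], simp add: mult.commute)
  from arg_cong[OF this, of Im]
  have "Im (\<Sum>i\<in>S. of_real (W k i) * schur_vec S W G k i) = Im z * (\<Sum>i\<in>S. (cmod (schur_vec S W G k i))\<^sup>2)"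
    unfolding cnj.sel 1 by simp
  then show ?thesis by (simp add: schur_den_def algebra_simps)
qed

lemma schur_den_bound:
  assumes S: "finite S" and sym: "sym_kernel W" and z: "Im z > 0" and G: "is_green S W z G"
  shows "Im z * (1 + (\<Sum>i\<in>S. (cmod (schur_vec S W G k i))\<^sup>2)) \<le> cmod (schur_den S W z G k)"
    and "schur_den S W z G k \<noteq> 0"
proof -
  have pos: "0 < Im z * (1 + (\<Sum>i\<in>S. (cmod (schur_vec S W G k i))\<^sup>2))"
    using z by (intro mult_pos_pos add_pos_nonneg sum_nonneg) auto
  show *: "Im z * (1 + (\<Sum>i\<in>S. (cmod (schur_vec S W G k i))\<^sup>2)) \<le> cmod (schur_den S W z G k)"
    using abs_Im_le_cmod[of "schur_den S W z G k"] Im_schur_den[OF S sym G, of k] by linarith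
  show "schur_den S W z G k \<noteq> 0" using * pos by auto
qed

lemma is_green_schur_ext:
  assumes S: "finite S" and k: "k \<notin> S" and sym: "sym_kernel W" and z: "Im z > 0"
    and G: "is_green S W z G"
  shows "is_green (insert k S) W z (schur_ext S W z G k)"
proof -
  define d where "d = schur_den S W z G k"
  define b where "b = schur_vec S W G k"
  have d0: "d \<noteq> 0" using schur_den_bound[OF S sym z G] by (simp add: d_def)
  have E1: "schur_ext S W z G k k k = 1 / d"
    and E2: "\<And>j. j \<noteq> k \<Longrightarrow> schur_ext S W z G k k j = - b j / d"
    and E3: "\<And>i. i \<noteq> k \<Longrightarrow> schur_ext S W z G k i k = - b i / d"
    and E4: "\<And>i j. i \<noteq> k \<Longrightarrow> j \<noteq> k \<Longrightarrow> schur_ext S W z G k i j = G i j + b i * b j / d"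
    by (auto simp: schur_ext_def d_def b_def Let_def)
  have bout: "b i = 0" if "i \<notin> S" for i
    using G that by (auto simp: b_def schur_vec_def is_green_def)
  have bS: "(\<Sum>j\<in>S. of_real (W i j) * b j) = of_real (W i k) + z * b i" if "i \<in> S" for i
    using schur_vec_eq[OF S G that, of k] by (simp add: b_def algebra_simps)
  have dS: "(\<Sum>j\<in>S. of_real (W k j) * b j) = of_real (W k k) - z - d"
    by (simp add: d_def schur_den_def b_def)
  have GS: "(\<Sum>k\<in>S. of_real (W i k) * G k j) = (if i = j then 1 else 0) + z * G i j" if "i \<in> S" "j \<in> S" for i j
    using G that by (auto simp: is_green_def algebra_simps)
  have GbS: "(\<Sum>i\<in>S. of_real (W k i) * G i j) = b j" if "j \<in> S" for j
    unfolding b_def schur_vec_def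
    by (intro sum.cong refl) (simp add: sym_kernelD[OF sym, of k] is_green_sym[OF S sym G, of _ j])
  have nk: "i \<in> S \<Longrightarrow> i \<noteq> k" for i using k by auto
  have expand: "(\<Sum>l\<in>insert k S. of_real (W i l) * f l) = of_real (W i k) * f k + (\<Sum>l\<in>S. of_real (W i l) * f l)"
    for i and f :: "'a \<Rightarrow> complex" using S k by simp
  show ?thesis unfolding is_green_def
  proof (intro conjI allI impI ballI)
    fix i j assume "i \<notin> insert k S \<or> j \<notin> insert k S"
    then show "schur_ext S W z G k i j = 0"
      using G by (cases "i = k"; cases "j = k") (auto simp: E1 E2 E3 E4 bout is_green_def)
  next
    fix i j assume i: "i \<in> insert k S" and j: "j \<in> insert k S"
    let ?E = "schur_ext S W z G k"
    consider "i = k" "j = k" | "i = k" "j \<in> S" | "i \<in> S" "j = k" | "i \<in> S" "j \<in> S"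
      using i j by auto
    then show "(\<Sum>l\<in>insert k S. of_real (W i l) * ?E l j) - z * ?E i j = (if i = j then 1 else 0)"
    proof cases
      case 1
      have "(\<Sum>l\<in>S. of_real (W k l) * ?E l k) = - (\<Sum>l\<in>S. of_real (W k l) * b l) / d"
        by (simp add: sum_divide_distrib sum_negf[symmetric] nk E3 cong: sum.cong)
      then show ?thesis unfolding 1 expand E1 dS using d0 by (simp add: field_simps)
    next
      case 2
      have "(\<Sum>l\<in>S. of_real (W k l) * ?E l j) = (\<Sum>l\<in>S. of_real (W k l) * G l j) + (\<Sum>l\<in>S. of_real (W k l) * b l) * b j / d"
        using nk[OF 2(2)] by (simp add: sum_divide_distrib sum_distrib_right sum.distrib[symmetric] nk E4 ring_distribs mult.assoc cong: sum.cong)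
      then show ?thesis using d0 nk[OF 2(2)]
        unfolding 2 expand E2[OF nk[OF 2(2)]] dS GbS[OF 2(2)] by (simp add: 2 field_simps)
    next
      case 3
      have "(\<Sum>l\<in>S. of_real (W i l) * ?E l k) = - (\<Sum>l\<in>S. of_real (W i l) * b l) / d"
        by (simp add: sum_divide_distrib sum_negf[symmetric] nk E3 cong: sum.cong)
      then show ?thesis using d0 nk[OF 3(1)]
        unfolding 3 expand E1 E3[OF nk[OF 3(1)]] bS[OF 3(1)] by (simp add: field_simps)
    next
      case 4
      have "(\<Sum>l\<in>S. of_real (W i l) * ?E l j) = (\<Sum>l\<in>S. of_real (W i l) * G l j) + (\<Sum>l\<in>S. of_real (W i l) * b l) * b j / d"
        using nk[OF 4(2)] by (simp add: sum_divide_distrib sum_distrib_right sum.distrib[symmetric] nk E4 ring_distribs mult.assoc cong: sum.cong)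
      then show ?thesis using d0
        unfolding 4 expand E2[OF nk[OF 4(2)]] E4[OF nk[OF 4(1)] nk[OF 4(2)]] bS[OF 4(1)] GS[OF 4]
        by (simp add: field_simps)
    qed
  qed
qed

text \<open>
  Existence is proved by adding one index at a time with the bordered inverse. This route gives the
  Schur complement formula and measurability in the entries at no further cost.
\<close>

lemma green_is_green:
  assumes "finite S" and sym: "sym_kernel W" and z: "Im z > 0"
  shows "is_green S W z (green S W z)"
proof -
  have "\<exists>G. is_green S W z G"
    using assms(1)
  proof induction
    case empty
    show ?case by (rule exI[of _ "\<lambda>_ _. 0"]) (simp add: is_green_def)
  next
    case (insert k S)
    then obtain G where "is_green S W z G" by auto
    from is_green_schur_ext[OF insert.hyps sym z this] show ?case by (intro exI[of _ "schur_ext S W z G k"])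
  qed
  then obtain G where G: "is_green S W z G" ..
  show ?thesis unfolding green_def
  proof (rule theI[where P = "is_green S W z", OF G])
    fix G' assume G': "is_green S W z G'"
    show "G' = G" by (rule is_green_unique[OF assms G' G])
  qed
qed

lemma green_eqI:
  assumes "finite S" "sym_kernel W" "Im z > 0" "is_green S W z G"
  shows "green S W z = G"
  by (rule is_green_unique[OF assms(1-3) green_is_green[OF assms(1-3)] assms(4)])

lemma green_insert:
  assumes "finite S" "k \<notin> S" "sym_kernel W" "Im z > 0"
  shows "green (insert k S) W z = schur_ext S W z (green S W z) k"
  by (rule green_eqI[OF _ assms(3,4) is_green_schur_ext[OF assms green_is_green[OF assms(1,3,4)]]])
     (simp add: assms(1))

lemma green_diag_schur:
  assumes "finite S" "k \<notin> S" "sym_kernel W" "Im z > 0"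
  shows "green (insert k S) W z k k = 1 / schur_den S W z (green S W z) k"
  by (simp add: green_insert[OF assms] schur_ext_def Let_def)

lemma green_ward:
  assumes S: "finite S" and sym: "sym_kernel W" and z: "Im z > 0" and j: "j \<in> S"
  shows "(\<Sum>i\<in>S. (cmod (green S W z i j))\<^sup>2) = Im (green S W z j j) / Im z"
proof -
  have "Im (\<Sum>i\<in>S. cnj (green S W z i j) * (if i = j then 1 else 0)) = - Im z * (\<Sum>i\<in>S. (cmod (green S W z i j))\<^sup>2)"
    using green_is_green[OF S sym z] j by (intro ward_vector[OF sym]) (auto simp: is_green_def)
  then show ?thesis using j S z by (simp add: if_distrib field_simps cong: if_cong)
qed

text \<open>
  The change of the trace is (1 + sum b_i^2) / d for the vector b = G W e_k and the Schur complement
  d, and the imaginary part of d has modulus Im z (1 + sum |b_i|^2).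
\<close>

lemma green_trace_minor:
  assumes S: "finite S" and k: "k \<notin> S" and sym: "sym_kernel W" and z: "Im z > 0"
  shows "cmod ((\<Sum>i\<in>insert k S. green (insert k S) W z i i) - (\<Sum>i\<in>S. green S W z i i)) \<le> 1 / Im z"
proof -
  define G where "G = green S W z"
  define d where "d = schur_den S W z G k"
  define b where "b = schur_vec S W G k"
  have G: "is_green S W z G" unfolding G_def by (rule green_is_green[OF S sym z])
  have pos: "0 < 1 + (\<Sum>i\<in>S. (cmod (b i))\<^sup>2)" by (intro add_pos_nonneg sum_nonneg) auto
  have nk: "i \<in> S \<Longrightarrow> i \<noteq> k" for i using k by auto
  have "(\<Sum>i\<in>insert k S. green (insert k S) W z i i) - (\<Sum>i\<in>S. green S W z i i) = (1 + (\<Sum>i\<in>S. b i * b i)) / d"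
    using S k
    by (simp add: green_insert[OF S k sym z] schur_ext_def Let_def G_def[symmetric] d_def[symmetric] b_def[symmetric]
        sum.distrib sum_divide_distrib add_divide_distrib nk cong: sum.cong)
  also have "cmod ... \<le> (1 + (\<Sum>i\<in>S. (cmod (b i))\<^sup>2)) / cmod d"
    unfolding norm_divide
    by (intro divide_right_mono order_trans[OF norm_triangle_ineq] add_mono order_trans[OF norm_sum])
       (auto simp: norm_mult power2_eq_square)
  also have "... \<le> (1 + (\<Sum>i\<in>S. (cmod (b i))\<^sup>2)) / (Im z * (1 + (\<Sum>i\<in>S. (cmod (b i))\<^sup>2)))"
    using schur_den_bound[OF S sym z G, of k] pos z
    by (intro divide_left_mono) (auto simp: d_def b_def intro!: mult_pos_pos)
  also have "... = 1 / Im z" using pos by simp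
  finally show ?thesis .
qed

lemma green_column:
  assumes S: "finite S" and sym: "sym_kernel W" and z: "Im z > 0" and "i \<in> S" "j \<in> S"
  shows "(\<Sum>k\<in>S. of_real (W i k) * green S W z k j) - z * green S W z i j = (if i = j then 1 else 0)"
  using green_is_green[OF S sym z] assms(4,5) by (auto simp: is_green_def)

lemma green_diag_norm:
  assumes S: "finite S" and sym: "sym_kernel W" and z: "Im z > 0" and j: "j \<in> S"
  shows "(\<Sum>i\<in>S. (cmod (green S W z i j))\<^sup>2) \<le> 1 / (Im z)\<^sup>2" and "cmod (green S W z j j) \<le> 1 / Im z"
proof -
  have "(Im z)\<^sup>2 * (\<Sum>i\<in>S. (cmod (green S W z i j))\<^sup>2) \<le> (\<Sum>i\<in>S. (cmod (if i = j then 1 else 0))\<^sup>2)"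
    by (rule resolvent_contraction[OF sym z green_column[OF S sym z _ j]])
  also have "... = 1" using S j by (simp add: if_distrib if_distribR cong: if_cong)
  finally show *: "(\<Sum>i\<in>S. (cmod (green S W z i j))\<^sup>2) \<le> 1 / (Im z)\<^sup>2"
    using z by (simp add: field_simps)
  have "(cmod (green S W z j j))\<^sup>2 \<le> (\<Sum>i\<in>S. (cmod (green S W z i j))\<^sup>2)"
    using S j by (intro member_le_sum) auto
  with * have "(cmod (green S W z j j))\<^sup>2 \<le> (1 / Im z)\<^sup>2" by (simp add: power_divide)
  then show "cmod (green S W z j j) \<le> 1 / Im z" using z by (subst (asm) power2_le_iff_abs_le) auto
qed

text \<open>
  The difference of two columns solves the system at z with right-hand side (z - z') times the
  column at z', so that two applications of the contraction bound suffice.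
\<close>

lemma green_lipschitz:
  assumes S: "finite S" and sym: "sym_kernel W" and z: "Im z > 0" and z': "Im z' > 0" and j: "j \<in> S"
  shows "cmod (green S W z j j - green S W z' j j) \<le> cmod (z - z') / (Im z * Im z')"
proof -
  define u where "u i = green S W z i j" for i
  define u' where "u' i = green S W z' i j" for i
  have "(\<Sum>l\<in>S. of_real (W i l) * (u l - u' l)) - z * (u i - u' i) = (z - z') * u' i" if "i \<in> S" for i
  proof -
    have "(\<Sum>l\<in>S. of_real (W i l) * u l) - z * u i = (\<Sum>l\<in>S. of_real (W i l) * u' l) - z' * u' i"
      using green_column[OF S sym z that j] green_column[OF S sym z' that j] by (simp add: u_def u'_def)
    then show ?thesis by (simp add: algebra_simps sum_subtractf)
  qed
  from resolvent_contraction[OF sym z this]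
  have "(Im z)\<^sup>2 * (\<Sum>i\<in>S. (cmod (u i - u' i))\<^sup>2) \<le> (\<Sum>i\<in>S. (cmod ((z - z') * u' i))\<^sup>2)" .
  also have "... = (cmod (z - z'))\<^sup>2 * (\<Sum>i\<in>S. (cmod (u' i))\<^sup>2)"
    by (simp add: norm_mult power_mult_distrib sum_distrib_left)
  also have "... \<le> (cmod (z - z'))\<^sup>2 * (1 / (Im z')\<^sup>2)"
    using green_diag_norm(1)[OF S sym z' j] by (intro mult_left_mono) (auto simp: u'_def)
  finally have 1: "(Im z)\<^sup>2 * (\<Sum>i\<in>S. (cmod (u i - u' i))\<^sup>2) \<le> (cmod (z - z') / Im z')\<^sup>2"
    by (simp add: power_divide)
  have "(cmod (u j - u' j))\<^sup>2 \<le> (\<Sum>i\<in>S. (cmod (u i - u' i))\<^sup>2)"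
    using S j by (intro member_le_sum) auto
  then have "(Im z * cmod (u j - u' j))\<^sup>2 \<le> (Im z)\<^sup>2 * (\<Sum>i\<in>S. (cmod (u i - u' i))\<^sup>2)"
    unfolding power_mult_distrib by (intro mult_left_mono) auto
  with 1 have "(Im z * cmod (u j - u' j))\<^sup>2 \<le> (cmod (z - z') / Im z')\<^sup>2" by linarith
  then have "Im z * cmod (u j - u' j) \<le> cmod (z - z') / Im z'"
    using z z' by (rule_tac power2_le_imp_le) auto
  then show ?thesis using z z' by (simp add: u_def u'_def field_simps)
qed

text \<open>
  Adding a constant to all entries is a rank-one perturbation by a multiple of the all-ones matrix.
  By the Sherman-Morrison formula the trace changes by - c (sum u_i^2) / (1 + c a), where u is the
  solution of (W - z) u = 1 and a is the sum of its entries. The identity for u gives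
  Im a = Im z (sum |u_i|^2), which bounds the denominator from below by the numerator times Im z.
  This is how the conditional mean of the entries is removed without any smallness assumption on it.
\<close>

lemma green_trace_rank_one:
  assumes S: "finite S" and sym: "sym_kernel W" and z: "Im z > 0"
  shows "cmod ((\<Sum>i\<in>S. green S (\<lambda>i j. W i j + c) z i i) - (\<Sum>i\<in>S. green S W z i i)) \<le> 1 / Im z"
proof -
  define W' where "W' i j = W i j + c" for i j
  define G where "G = green S W z"
  define G' where "G' = green S W' z"
  have sym': "sym_kernel W'" using sym by (simp add: sym_kernel_def W'_def)
  define u where "u i = (\<Sum>j\<in>S. G i j)" for i
  define u' where "u' j = (\<Sum>i\<in>S. G' i j)" for j
  define a where "a = (\<Sum>i\<in>S. u i)"
  define U where "U = (\<Sum>i\<in>S. (cmod (u i))\<^sup>2)"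
  have ueq: "(\<Sum>j\<in>S. of_real (W i j) * u j) - z * u i = 1" if "i \<in> S" for i
  proof -
    have "(\<Sum>j\<in>S. of_real (W i j) * u j) = (\<Sum>l\<in>S. \<Sum>j\<in>S. of_real (W i j) * G j l)"
      unfolding u_def sum_distrib_left by (rule sum.swap)
    then have "(\<Sum>j\<in>S. of_real (W i j) * u j) - z * u i = (\<Sum>l\<in>S. (\<Sum>j\<in>S. of_real (W i j) * G j l) - z * G i l)"
      by (simp add: u_def sum_subtractf sum_distrib_left)
    also have "... = (\<Sum>l\<in>S. if i = l then 1 else 0)"
      using that by (intro sum.cong) (auto simp: G_def green_column[OF S sym z])
    finally show ?thesis using S that by simp
  qed
  have rel: "G' i j = G i j - of_real c * u' j * u i" if "i \<in> S" "j \<in> S" for i j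
  proof (rule resolvent_vector_unique[where u = "\<lambda>i. G' i j" and u' = "\<lambda>i. G i j - of_real c * u' j * u i"
        and v = "\<lambda>i. (if i = j then 1 else 0) - of_real c * u' j", OF S sym z _ _ \<open>i \<in> S\<close>])
    fix i assume i: "i \<in> S"
    have "(\<Sum>l\<in>S. of_real (W' i l) * G' l j) - z * G' i j = (if i = j then 1 else 0)"
      unfolding G'_def by (rule green_column[OF S sym' z i \<open>j \<in> S\<close>])
    then show "(\<Sum>l\<in>S. of_real (W i l) * G' l j) - z * G' i j = (if i = j then 1 else 0) - of_real c * u' j"
      by (simp add: W'_def u'_def algebra_simps sum.distrib sum_distrib_left)
    have "(\<Sum>l\<in>S. of_real (W i l) * (G l j - of_real c * u' j * u l)) - z * (G i j - of_real c * u' j * u i)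
      = ((\<Sum>l\<in>S. of_real (W i l) * G l j) - z * G i j) - of_real c * u' j * ((\<Sum>l\<in>S. of_real (W i l) * u l) - z * u i)"
      by (simp add: algebra_simps sum_subtractf sum_distrib_left)
    also have "... = (if i = j then 1 else 0) - of_real c * u' j"
      using green_column[OF S sym z i \<open>j \<in> S\<close>] ueq[OF i] by (simp add: G_def)
    finally show "(\<Sum>l\<in>S. of_real (W i l) * (G l j - of_real c * u' j * u l)) - z * (G i j - of_real c * u' j * u i)
      = (if i = j then 1 else 0) - of_real c * u' j" .
  qed
  have u': "(1 + of_real c * a) * u' j = u j" if "j \<in> S" for j
  proof -
    have "u' j = (\<Sum>i\<in>S. G' i j)" by (simp add: u'_def)
    also have "... = (\<Sum>i\<in>S. G i j - of_real c * u' j * u i)"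
      by (intro sum.cong refl rel that)
    finally have "u' j = (\<Sum>i\<in>S. G i j) - of_real c * u' j * a"
      by (simp add: a_def sum_subtractf sum_distrib_left)
    moreover have "(\<Sum>i\<in>S. G i j) = u j"
      unfolding u_def G_def by (intro sum.cong refl is_green_sym[OF S sym green_is_green[OF S sym z]])
    ultimately show ?thesis by (simp add: algebra_simps)
  qed
  have Ima: "Im a = Im z * U"
  proof -
    have "Im (\<Sum>i\<in>S. cnj (u i) * 1) = - Im z * U" unfolding U_def by (rule ward_vector[OF sym ueq])
    moreover have "(\<Sum>i\<in>S. cnj (u i) * 1) = cnj a" by (simp add: a_def)
    ultimately have "Im (cnj a) = - Im z * U" by metis
    then show ?thesis by simp
  qed
  have U0: "U \<ge> 0" by (simp add: U_def sum_nonneg)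
  let ?D = "(\<Sum>i\<in>S. G' i i) - (\<Sum>i\<in>S. G i i)"
  have D: "?D = - of_real c * (\<Sum>i\<in>S. u' i * u i)"
    by (simp add: rel sum_subtractf sum_distrib_left sum_negf mult.assoc cong: sum.cong)
  then have "(1 + of_real c * a) * ?D = - of_real c * (\<Sum>i\<in>S. ((1 + of_real c * a) * u' i) * u i)"
    by (simp add: sum_distrib_left mult_ac)
  also have "... = - of_real c * (\<Sum>i\<in>S. u i * u i)" by (simp add: u' cong: sum.cong)
  finally have "cmod (1 + of_real c * a) * cmod ?D = \<bar>c\<bar> * cmod (\<Sum>i\<in>S. u i * u i)"
    by (metis norm_minus_cancel norm_mult norm_of_real)
  also have "... \<le> \<bar>c\<bar> * U"
    unfolding U_def by (intro mult_left_mono order_trans[OF norm_sum]) (auto simp: norm_mult power2_eq_square)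
  finally have 1: "cmod (1 + of_real c * a) * cmod ?D \<le> \<bar>c\<bar> * U" .
  have 2: "\<bar>c\<bar> * (Im z * U) \<le> cmod (1 + of_real c * a)"
    using abs_Im_le_cmod[of "1 + of_real c * a"] Ima z U0 by (simp add: abs_mult)
  have "cmod ?D \<le> 1 / Im z"
  proof (cases "\<bar>c\<bar> * U = 0")
    case True
    then have "c = 0 \<or> (\<forall>i\<in>S. u i = 0)" using S by (auto simp: U_def sum_nonneg_eq_0_iff)
    then have "?D = 0" unfolding D by auto
    then show ?thesis using z by simp
  next
    case False
    then have p: "\<bar>c\<bar> * U > 0" using U0 by (simp add: less_le)
    have "\<bar>c\<bar> * U * (Im z * cmod ?D) = \<bar>c\<bar> * (Im z * U) * cmod ?D" by simp
    also have "... \<le> \<bar>c\<bar> * U * 1"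
      using mult_right_mono[OF 2, of "cmod ?D"] 1 by simp
    finally show ?thesis using p z by (simp only: mult_le_cancel_left_pos[OF p]) (simp add: field_simps)
  qed
  moreover have "W' = (\<lambda>i j. W i j + c)" by (simp add: W'_def fun_eq_iff)
  ultimately show ?thesis by (simp add: G'_def G_def)
qed

text \<open>
  The bordered inverse expresses the Green function by rational operations on the entries.
\<close>

lemma borel_measurable_green:
  assumes "finite S" and sym: "\<And>x. sym_kernel (W x)" and z: "Im z > 0"
    and meas: "\<And>i j. i \<in> S \<Longrightarrow> j \<in> S \<Longrightarrow> (\<lambda>x. W x i j) \<in> borel_measurable M"
  shows "(\<lambda>x. green S (W x) z i j) \<in> borel_measurable M"
  using assms(1) meas
proof (induction S arbitrary: i j)
  case empty
  have "green {} (W x) z i j = 0" for x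
    using green_is_green[OF finite.emptyI sym z] by (simp add: is_green_def)
  then show ?case by simp
next
  case (insert k S)
  note [measurable] = insert.IH[OF insert.prems]
  have [measurable]: "(\<lambda>x. W x i j) \<in> borel_measurable M" if "i \<in> insert k S" "j \<in> insert k S" for i j
    using insert.prems that by auto
  have v[measurable]: "(\<lambda>x. schur_vec S (W x) (green S (W x) z) k i) \<in> borel_measurable M" for i
    unfolding schur_vec_def by measurable
  have [measurable]: "(\<lambda>x. schur_den S (W x) z (green S (W x) z) k) \<in> borel_measurable M"
    unfolding schur_den_def by measurable
  show ?case
    unfolding green_insert[OF insert.hyps sym z] schur_ext_def Let_def by measurable
qed

lemma stieltjes_eq_trace_green:
  fixes A :: "real mat"
  assumes A: "A \<in> carrier_mat n n" and sym: "sym_kernel W" and z: "Im z > 0"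
    and WA: "\<And>i j. i < n \<Longrightarrow> j < n \<Longrightarrow> W i j = A $$ (i, j)"
  shows "stieltjes A z = (\<Sum>i<n. green {..<n} W z i i) / of_nat n"
proof -
  define B where "B = map_mat complex_of_real A - z \<cdot>\<^sub>m 1\<^sub>m (dim_row A)"
  have B: "B \<in> carrier_mat n n" using A by (auto simp: B_def)
  have Bij: "B $$ (i, j) = of_real (W i j) - (if i = j then z else 0)" if "i < n" "j < n" for i j
    using A that by (auto simp: B_def WA)
  define R where "R = mat n n (\<lambda>(i, j). green {..<n} W z i j)"
  have R: "R \<in> carrier_mat n n" by (simp add: R_def)
  have prod: "(B * C) $$ (i, j) = (\<Sum>k<n. of_real (W i k) * C $$ (k, j)) - z * C $$ (i, j)"
    if "C \<in> carrier_mat n n" "i < n" "j < n" for C i j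
  proof -
    have "(B * C) $$ (i, j) = (\<Sum>k<n. B $$ (i, k) * C $$ (k, j))"
      using B that by (simp add: scalar_prod_def atLeast0LessThan)
    also have "... = (\<Sum>k<n. of_real (W i k) * C $$ (k, j) - (if i = k then z * C $$ (k, j) else 0))"
      using that by (intro sum.cong) (auto simp: Bij algebra_simps)
    also have "... = (\<Sum>k<n. of_real (W i k) * C $$ (k, j)) - z * C $$ (i, j)"
      using that by (simp add: sum_subtractf)
    finally show ?thesis .
  qed
  have BR: "B * R = 1\<^sub>m n"
  proof (rule eq_matI)
    fix i j assume "i < dim_row (1\<^sub>m n :: complex mat)" "j < dim_col (1\<^sub>m n :: complex mat)"
    then have ij: "i < n" "j < n" by auto
    have "(B * R) $$ (i, j) = (\<Sum>k<n. of_real (W i k) * green {..<n} W z k j) - z * green {..<n} W z i j"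
      unfolding prod[OF R ij] using ij by (simp add: R_def)
    also have "... = (if i = j then 1 else 0)"
      using ij by (intro green_column[OF finite_lessThan sym z]) auto
    finally show "(B * R) $$ (i, j) = 1\<^sub>m n $$ (i, j)" using ij by simp
  qed (use B R in auto)
  then have "R * B = 1\<^sub>m n" using mat_mult_left_right_inverse[OF B R] by simp
  with BR have "B \<in> Units (ring_mat TYPE(complex) n ())"
    using B R by (auto simp: Units_def ring_mat_def)
  then obtain C where C: "mat_inverse B = Some C"
    using mat_inverse(1)[OF B, where b = "()"] by (cases "mat_inverse B") auto
  then have BC: "B * C = 1\<^sub>m n" and Cc: "C \<in> carrier_mat n n" using mat_inverse(2)[OF B] by auto
  have "is_green {..<n} W z (\<lambda>i j. if i < n \<and> j < n then C $$ (i, j) else 0)"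
    unfolding is_green_def
  proof (intro conjI ballI)
    fix i j assume ij: "i \<in> {..<n}" "j \<in> {..<n}"
    then have "(B * C) $$ (i, j) = (if i = j then 1 else 0)" unfolding BC by auto
    then show "(\<Sum>k<n. of_real (W i k) * (if k < n \<and> j < n then C $$ (k, j) else 0)) -
       z * (if i < n \<and> j < n then C $$ (i, j) else 0) = (if i = j then 1 else 0)"
      using ij by (simp add: prod[OF Cc])
  qed auto
  from green_eqI[OF finite_lessThan sym z this]
  have "green {..<n} W z i i = C $$ (i, i)" if "i < n" for i using that by simp
  moreover have "resolvent A z = C" unfolding resolvent_def B_def[symmetric] C by simp
  ultimately show ?thesis using A Cc by (simp add: stieltjes_def mat_trace_def)
qed

section \<open>Moments of linear and quadratic forms\<close>

text \<open>
  A Taylor expansion of the even power in which all terms from the second order on are replaced by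
  the two extreme ones: a mixed term is at most g^(2p-2) w^2 if |w| is at most |g|, and at most w^(2p)
  otherwise. The first-order term is kept exactly, because it vanishes once w is replaced by a
  centred random variable.
\<close>

lemma power_add_le_second_order:
  fixes g w :: real
  assumes p: "p \<ge> 1"
  shows "(g + w) ^ (2 * p) \<le> g ^ (2 * p) + 2 * real p * g ^ (2 * p - 1) * w + 4 ^ p * (g ^ (2 * p - 2) * w\<^sup>2 + w ^ (2 * p))"
proof -
  define R where "R = g ^ (2 * p - 2) * w\<^sup>2 + w ^ (2 * p)"
  have e: "even (2 * p - 2)" by simp
  have R0: "0 \<le> R" unfolding R_def by (intro add_nonneg_nonneg mult_nonneg_nonneg) (auto simp: zero_le_even_power)
  have bound: "w ^ k * g ^ (2 * p - k) \<le> R" if k: "k \<in> {2..2 * p}" for k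
  proof -
    have "w ^ k * g ^ (2 * p - k) \<le> \<bar>w\<bar> ^ k * \<bar>g\<bar> ^ (2 * p - k)"
      by (metis abs_ge_self abs_mult power_abs)
    also have "... \<le> R"
    proof (cases "\<bar>w\<bar> \<le> \<bar>g\<bar>")
      case True
      have "\<bar>w\<bar> ^ k * \<bar>g\<bar> ^ (2 * p - k) = \<bar>w\<bar> ^ 2 * \<bar>w\<bar> ^ (k - 2) * \<bar>g\<bar> ^ (2 * p - k)"
        using k by (metis atLeastAtMost_iff le_add_diff_inverse power_add)
      also have "... \<le> \<bar>w\<bar> ^ 2 * \<bar>g\<bar> ^ (k - 2) * \<bar>g\<bar> ^ (2 * p - k)"
        using True by (intro mult_right_mono mult_left_mono power_mono) auto
      also have "... = \<bar>w\<bar> ^ 2 * \<bar>g\<bar> ^ (2 * p - 2)"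
        using k by (simp add: mult.assoc flip: power_add)
      also have "... \<le> R"
        unfolding R_def power_even_abs[OF e] by (simp add: zero_le_even_power mult.commute)
      finally show ?thesis .
    next
      case False
      have "\<bar>w\<bar> ^ k * \<bar>g\<bar> ^ (2 * p - k) \<le> \<bar>w\<bar> ^ k * \<bar>w\<bar> ^ (2 * p - k)"
        using False by (intro mult_left_mono power_mono) auto
      also have "... = w ^ (2 * p)" using k power_even_abs[of "2 * p" w] by (simp flip: power_add)
      also have "... \<le> R" unfolding R_def by (simp add: zero_le_even_power)
      finally show ?thesis .
    qed
    finally show ?thesis .
  qed
  have "(g + w) ^ (2 * p) = (\<Sum>k\<le>2 * p. of_nat (2 * p choose k) * w ^ k * g ^ (2 * p - k))"
    by (subst add.commute) (rule binomial_ring)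
  also have "{..2 * p} = insert 0 (insert 1 {2..2 * p})" using p by auto
  also have "(\<Sum>k\<in>insert 0 (insert 1 {2..2 * p}). of_nat (2 * p choose k) * w ^ k * g ^ (2 * p - k))
     = g ^ (2 * p) + 2 * real p * g ^ (2 * p - 1) * w + (\<Sum>k = 2..2 * p. of_nat (2 * p choose k) * (w ^ k * g ^ (2 * p - k)))"
    by (simp add: mult.assoc)
  also have "(\<Sum>k = 2..2 * p. of_nat (2 * p choose k) * (w ^ k * g ^ (2 * p - k))) \<le> (\<Sum>k = 2..2 * p. of_nat (2 * p choose k) * R)"
    by (intro sum_mono mult_left_mono bound) auto
  also have "... \<le> (\<Sum>k\<le>2 * p. of_nat (2 * p choose k) * R)"
    using R0 by (intro sum_mono2) auto
  also have "... = 4 ^ p * R"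
    using choose_row_sum[of "2 * p"] by (simp flip: sum_distrib_right of_nat_sum add: power_mult)
  finally show ?thesis by (simp add: R_def)
qed

lemma young_power:
  fixes g h \<theta> :: real
  assumes p: "p \<ge> 1" and \<theta>: "\<theta> > 0"
  shows "g ^ (2 * p - 2) * h\<^sup>2 \<le> \<theta> * g ^ (2 * p) + (1 / \<theta>) ^ (p - 1) * h ^ (2 * p)"
proof -
  define a where "a = g\<^sup>2"
  define b where "b = h\<^sup>2"
  have ab: "a \<ge> 0" "b \<ge> 0" by (auto simp: a_def b_def)
  have "a ^ (p - 1) * b \<le> \<theta> * a ^ p + (1 / \<theta>) ^ (p - 1) * b ^ p"
  proof (cases "b \<le> \<theta> * a")
    case True
    have "a ^ (p - 1) * b \<le> a ^ (p - 1) * (\<theta> * a)" using True ab by (intro mult_left_mono) auto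
    also have "... = \<theta> * a ^ p" using p by (cases p) auto
    finally show ?thesis using ab \<theta> by (simp add: add_increasing2)
  next
    case False
    have "a ^ (p - 1) * b \<le> (1 / \<theta> * b) ^ (p - 1) * b"
      using False ab \<theta> by (intro mult_right_mono power_mono) (auto simp: field_simps)
    also have "... = (1 / \<theta>) ^ (p - 1) * b ^ p" using p by (cases p) (auto simp: power_divide power_mult_distrib)
    finally show ?thesis using ab \<theta> by (simp add: add_increasing)
  qed
  then show ?thesis unfolding a_def b_def
    by (simp add: power_mult[symmetric] right_diff_distrib')
qed

text \<open>
  The induction step of the moment bounds, with the probability removed: t is the moment of order 2p
  after one more variable has been added, C u^p is the bound before, and c v^p is the bound for the
  coefficient of the new variable. The free parameter \<theta> comes from Young's inequality. It is chosen
  proportional to v / u, so that the error C \<theta> u^p becomes C v u^(p-1) up to a small factor; this is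
  covered by the growth of C (u + v)^p over C u^p. So the constant C does not deteriorate with the
  number of variables.
\<close>

lemma moment_bound_from_recursion:
  fixes C u v B c t :: real
  assumes p: "p \<ge> 1" and B: "B \<ge> 0" and c: "c \<ge> 0" and u: "u \<ge> 0" and v: "v \<ge> 0"
    and C: "C = c * (4 * (B + 1)) ^ p"
    and t: "\<And>\<theta>. \<theta> > 0 \<Longrightarrow> t \<le> C * u ^ p + B * (\<theta> * (C * u ^ p) + ((1 / \<theta>) ^ (p - 1) + 1) * (c * v ^ p))"
  shows "t \<le> C * (u + v) ^ p"
proof -
  have C0: "C \<ge> 0" using B c by (simp add: C)
  have B4: "4 * (B + 1) \<le> (4 * (B + 1)) ^ p" using p B by (intro self_le_power) auto
  have Cc: "4 * (B + 1) * c \<le> C" unfolding C using mult_right_mono[OF B4 c] by (simp add: mult_ac)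
  have sup: "u ^ p + v * u ^ (p - 1) \<le> (u + v) ^ p" "u ^ p + v ^ p \<le> (u + v) ^ p"
  proof -
    obtain q where q: "p = Suc q" using p by (cases p) auto
    have 1: "u * u ^ q \<le> u * (u + v) ^ q" using u v by (intro mult_left_mono power_mono) auto
    have 2: "v * u ^ q \<le> v * (u + v) ^ q" using u v by (intro mult_left_mono power_mono) auto
    have 3: "v * v ^ q \<le> v * (u + v) ^ q" using u v by (intro mult_left_mono power_mono) auto
    show "u ^ p + v * u ^ (p - 1) \<le> (u + v) ^ p" "u ^ p + v ^ p \<le> (u + v) ^ p"
      using 1 2 3 by (auto simp: q distrib_right)
  qed
  consider "u = 0" | "v = 0" | "u > 0" "v > 0" using u v by fastforce
  then show ?thesis
  proof cases
    case 1
    have "t \<le> B * (2 * (c * v ^ p))" using t[of 1] p 1 by (simp add: zero_power)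
    also have "... \<le> C * v ^ p"
    proof -
      define X where "X = c * v ^ p"
      have X: "X \<ge> 0" "B * X \<ge> 0" using B c v by (auto simp: X_def)
      have "4 * (B + 1) * X \<le> C * v ^ p"
        using mult_right_mono[OF Cc, of "v ^ p"] v by (simp add: X_def mult.assoc)
      then show ?thesis using X unfolding X_def[symmetric] by (simp add: algebra_simps)
    qed
    finally show ?thesis using 1 by simp
  next
    case 2
    \<comment> \<open>Here v = 0, and the bound follows by letting the free parameter tend to 0.\<close>
    have "t \<le> C * u ^ p + e" if e: "e > 0" for e
    proof -
      define \<theta> where "\<theta> = e / (B * (C * u ^ p) + 1)"
      have X: "B * (C * u ^ p) \<ge> 0" using B C0 u by simp
      then have "\<theta> > 0" using e by (auto simp: \<theta>_def intro!: divide_pos_pos)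
      have "\<theta> * (B * (C * u ^ p)) \<le> e" using X e by (auto simp: \<theta>_def field_simps)
      then show ?thesis using t[OF \<open>\<theta> > 0\<close>] p 2 by (simp add: algebra_simps power_0_left)
    qed
    then have "t \<le> C * u ^ p" by (rule field_le_epsilon)
    then show ?thesis using 2 by simp
  next
    case 3
    define D where "D = 4 * (B + 1)"
    have D: "D > 0" using B by (simp add: D_def)
    \<comment> \<open>With this choice the two terms produced by Young's inequality are multiples of v u^(p-1).\<close>
    define \<theta> where "\<theta> = v / u / D"
    have "\<theta> > 0" using 3 D by (simp add: \<theta>_def)
    define X where "X = v * u ^ (p - 1)"
    have X: "X \<ge> 0" using u v by (simp add: X_def)
    have e1: "\<theta> * u ^ p = X / D" using p 3 by (cases p) (auto simp: \<theta>_def X_def)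
    have e2: "(1 / \<theta>) ^ (p - 1) * v ^ p = D ^ (p - 1) * X"
      using p 3 D by (cases p) (auto simp: \<theta>_def X_def field_simps power_mult_distrib power_divide)
    have e3: "c * D ^ (p - 1) = C / D" using p D by (cases p) (auto simp: C D_def)
    have "t \<le> C * u ^ p + B * (C * (\<theta> * u ^ p) + c * ((1 / \<theta>) ^ (p - 1) * v ^ p) + c * v ^ p)"
      using t[OF \<open>\<theta> > 0\<close>] by (simp add: algebra_simps)
    also have "... = C * u ^ p + 2 * (B / D) * (C * X) + B * (c * v ^ p)"
    proof -
      have "c * (D ^ (p - 1) * X) = C / D * X" using e3 by (simp flip: mult.assoc)
      then show ?thesis unfolding e1 e2 by (simp add: algebra_simps)
    qed
    also have "... \<le> C * u ^ p + 1 / 2 * (C * X) + 1 / 2 * (C * v ^ p)"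
    proof (intro add_mono order_refl mult_right_mono)
      show "2 * (B / D) \<le> 1 / 2" using D B by (simp add: D_def field_simps)
      show "0 \<le> C * X" using C0 X by simp
      have "B * c \<le> 1 / 2 * C" using Cc mult_nonneg_nonneg[OF B c] c by (simp add: algebra_simps)
      from mult_right_mono[OF this, of "v ^ p"] show "B * (c * v ^ p) \<le> 1 / 2 * (C * v ^ p)"
        using v by (simp add: mult.assoc)
    qed
    also have "... = C * (1 / 2 * (u ^ p + X) + 1 / 2 * (u ^ p + v ^ p))" by (simp add: field_simps)
    also have "... \<le> C * (u + v) ^ p"
    proof (intro mult_left_mono C0)
      show "1 / 2 * (u ^ p + X) + 1 / 2 * (u ^ p + v ^ p) \<le> (u + v) ^ p"
        using sup[folded X_def] by argo
    qed
    finally show ?thesis .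
  qed
qed

abbreviation iid :: "'i set \<Rightarrow> 'x measure \<Rightarrow> ('i \<Rightarrow> 'x) measure" where
  "iid I Q \<equiv> Pi\<^sub>M I (\<lambda>_. Q)"

text \<open>
  The second moment is bounded separately: together with the moment of order 2p it controls the
  two extreme terms of the expansion of an even power.
\<close>

definition centred_moments :: "'x measure \<Rightarrow> ('x \<Rightarrow> real) \<Rightarrow> nat \<Rightarrow> real \<Rightarrow> bool" where
  "centred_moments Q \<phi> p K \<longleftrightarrow> prob_space Q \<and> \<phi> \<in> borel_measurable Q \<and> integrable Q (\<lambda>y. \<phi> y ^ (2 * p)) \<and>
     (\<integral>y. \<phi> y \<partial>Q) = 0 \<and> (\<integral>y. (\<phi> y)\<^sup>2 \<partial>Q) \<le> K \<and> (\<integral>y. \<phi> y ^ (2 * p) \<partial>Q) \<le> K"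

lemma integrable_lower_power:
  fixes \<phi> :: "'x \<Rightarrow> real"
  assumes "prob_space Q" "\<phi> \<in> borel_measurable Q" "integrable Q (\<lambda>y. \<phi> y ^ (2 * p))" "l \<le> 2 * p"
  shows "integrable Q (\<lambda>y. \<phi> y ^ l)"
proof -
  interpret prob_space Q by fact
  show ?thesis
  proof (rule Bochner_Integration.integrable_bound)
    show "integrable Q (\<lambda>y. 1 + \<phi> y ^ (2 * p))" using assms(3) by simp
    show "(\<lambda>y. \<phi> y ^ l) \<in> borel_measurable Q" using assms(2) by measurable
    show "AE y in Q. norm (\<phi> y ^ l) \<le> norm (1 + \<phi> y ^ (2 * p))"
    proof (intro AE_I2)
      fix y
      have "\<bar>\<phi> y\<bar> ^ l \<le> 1 + \<bar>\<phi> y\<bar> ^ (2 * p)"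
      proof (cases "\<bar>\<phi> y\<bar> \<le> 1")
        case True
        have "\<bar>\<phi> y\<bar> ^ l \<le> 1" using True by (intro power_le_one) auto
        also have "... \<le> 1 + \<bar>\<phi> y\<bar> ^ (2 * p)" by simp
        finally show ?thesis .
      next
        case False
        have "\<bar>\<phi> y\<bar> ^ l \<le> \<bar>\<phi> y\<bar> ^ (2 * p)" using False assms(4) by (intro power_increasing) auto
        then show ?thesis by simp
      qed
      then show "norm (\<phi> y ^ l) \<le> norm (1 + \<phi> y ^ (2 * p))"
        using power_even_abs[of "2 * p" "\<phi> y"] by (simp add: power_abs zero_le_even_power)
    qed
  qed
qed

text \<open>
  The factor by which the constant grows from constants to linear forms and from linear to quadratic
  forms is the p-th power of this number.
\<close>

abbreviation mz :: "nat \<Rightarrow> real \<Rightarrow> real" where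
  "mz p K \<equiv> 4 * (4 ^ p * K + 1)"

text \<open>
  Integrating out a new centred variable, which enters linearly with coefficient h, kills the
  first-order term of the expansion. What remains is handled by Young's inequality and the
  recursion above.
\<close>

lemma moment_step:
  fixes g h :: "'m \<Rightarrow> real" and \<phi> :: "'x \<Rightarrow> real"
  assumes p: "p \<ge> 1" and Q: "centred_moments Q \<phi> p K" and K: "K \<ge> 0"
    and [measurable]: "g \<in> borel_measurable M" "h \<in> borel_measurable M"
    and u: "u \<ge> 0" and v: "v \<ge> 0" and c: "c \<ge> 0"
    and C: "C = c * mz p K ^ p"
    and g: "(\<integral>\<^sup>+x. ennreal (g x ^ (2 * p)) \<partial>M) \<le> ennreal (C * u ^ p)"
    and h: "(\<integral>\<^sup>+x. ennreal (h x ^ (2 * p)) \<partial>M) \<le> ennreal (c * v ^ p)"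
  shows "(\<integral>\<^sup>+x. \<integral>\<^sup>+y. ennreal ((g x + \<phi> y * h x) ^ (2 * p)) \<partial>Q \<partial>M) \<le> ennreal (C * (u + v) ^ p)"
proof -
  interpret Q: prob_space Q using Q by (simp add: centred_moments_def)
  have \<phi>[measurable]: "\<phi> \<in> borel_measurable Q" and ip: "integrable Q (\<lambda>y. \<phi> y ^ (2 * p))"
    and m1: "(\<integral>y. \<phi> y \<partial>Q) = 0" and m2: "(\<integral>y. (\<phi> y)\<^sup>2 \<partial>Q) \<le> K" and mp: "(\<integral>y. \<phi> y ^ (2 * p) \<partial>Q) \<le> K"
    using Q by (auto simp: centred_moments_def)
  have il: "integrable Q (\<lambda>y. \<phi> y ^ l)" if "l \<le> 2 * p" for l
    by (rule integrable_lower_power[OF Q.prob_space_axioms \<phi> ip that])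
  have i1: "integrable Q \<phi>" using il[of 1] p by simp
  have i2: "integrable Q (\<lambda>y. (\<phi> y)\<^sup>2)" using il[of 2] p by simp
  define B where "B = 4 ^ p * K"
  have B: "B \<ge> 0" using K by (simp add: B_def)
  have C0: "C \<ge> 0" using K c by (simp add: C)
  have ev: "even (2 * p - 2)" by simp
  have inner: "(\<integral>\<^sup>+y. ennreal ((a + \<phi> y * b) ^ (2 * p)) \<partial>Q)
      \<le> ennreal (a ^ (2 * p) + B * (a ^ (2 * p - 2) * b\<^sup>2 + b ^ (2 * p)))" for a b
  proof -
    let ?f = "\<lambda>y. a ^ (2 * p) + 2 * real p * a ^ (2 * p - 1) * (\<phi> y * b)
        + 4 ^ p * (a ^ (2 * p - 2) * (\<phi> y * b)\<^sup>2 + (\<phi> y * b) ^ (2 * p))"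
    have le: "(a + \<phi> y * b) ^ (2 * p) \<le> ?f y" for y by (rule power_add_le_second_order[OF p])
    have f0: "0 \<le> ?f y" for y by (rule order_trans[OF _ le]) (simp add: zero_le_even_power)
    have int: "integrable Q ?f" using i1 i2 ip by (simp add: power_mult_distrib)
    have "(\<integral>\<^sup>+y. ennreal ((a + \<phi> y * b) ^ (2 * p)) \<partial>Q) \<le> (\<integral>\<^sup>+y. ennreal (?f y) \<partial>Q)"
      by (intro nn_integral_mono ennreal_leI le)
    also have "... = ennreal (\<integral>y. ?f y \<partial>Q)"
      using f0 by (intro nn_integral_eq_integral int) auto
    finally have 2: "(\<integral>\<^sup>+y. ennreal ((a + \<phi> y * b) ^ (2 * p)) \<partial>Q) \<le> ennreal (\<integral>y. ?f y \<partial>Q)" .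
    have "(\<integral>y. ?f y \<partial>Q) = a ^ (2 * p) + 4 ^ p * (a ^ (2 * p - 2) * (b\<^sup>2 * (\<integral>y. (\<phi> y)\<^sup>2 \<partial>Q)) + b ^ (2 * p) * (\<integral>y. \<phi> y ^ (2 * p) \<partial>Q))"
      using i1 i2 ip by (simp add: power_mult_distrib m1 Q.prob_space mult.commute)
    also have "... \<le> a ^ (2 * p) + 4 ^ p * (a ^ (2 * p - 2) * (b\<^sup>2 * K) + b ^ (2 * p) * K)"
      by (intro add_left_mono mult_left_mono add_mono m2 mp) (auto simp: zero_le_even_power ev)
    also have "... = a ^ (2 * p) + B * (a ^ (2 * p - 2) * b\<^sup>2 + b ^ (2 * p))"
      by (simp add: B_def algebra_simps)
    finally show ?thesis by (rule order_trans[OF 2 ennreal_leI])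
  qed
  define T where "T = (\<integral>\<^sup>+x. \<integral>\<^sup>+y. ennreal ((g x + \<phi> y * h x) ^ (2 * p)) \<partial>Q \<partial>M)"
  have T: "T \<le> ennreal (C * u ^ p + B * (\<theta> * (C * u ^ p) + ((1 / \<theta>) ^ (p - 1) + 1) * (c * v ^ p)))"
    if \<theta>: "\<theta> > 0" for \<theta>
  proof -
    let ?r = "(1 / \<theta>) ^ (p - 1) + 1"
    have r: "?r \<ge> 0" using \<theta> by (simp add: add_nonneg_nonneg)
    have "T \<le> (\<integral>\<^sup>+x. ennreal (g x ^ (2 * p) + B * (g x ^ (2 * p - 2) * (h x)\<^sup>2 + h x ^ (2 * p))) \<partial>M)"
      unfolding T_def by (intro nn_integral_mono inner)
    also have "... \<le> (\<integral>\<^sup>+x. ennreal ((1 + B * \<theta>) * g x ^ (2 * p) + B * ?r * h x ^ (2 * p)) \<partial>M)"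
    proof (intro nn_integral_mono ennreal_leI)
      fix x
      have "g x ^ (2 * p) + B * (g x ^ (2 * p - 2) * (h x)\<^sup>2 + h x ^ (2 * p))
         \<le> g x ^ (2 * p) + B * ((\<theta> * g x ^ (2 * p) + (1 / \<theta>) ^ (p - 1) * h x ^ (2 * p)) + h x ^ (2 * p))"
        using young_power[OF p \<theta>, of "g x" "h x"] B by (intro add_left_mono mult_left_mono add_right_mono)
      also have "... = (1 + B * \<theta>) * g x ^ (2 * p) + B * ?r * h x ^ (2 * p)" by (simp add: algebra_simps)
      finally show "g x ^ (2 * p) + B * (g x ^ (2 * p - 2) * (h x)\<^sup>2 + h x ^ (2 * p))
        \<le> (1 + B * \<theta>) * g x ^ (2 * p) + B * ?r * h x ^ (2 * p)" .
    qed
    also have "... = ennreal (1 + B * \<theta>) * (\<integral>\<^sup>+x. ennreal (g x ^ (2 * p)) \<partial>M) + ennreal (B * ?r) * (\<integral>\<^sup>+x. ennreal (h x ^ (2 * p)) \<partial>M)"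
      using B \<theta> r
      by (simp add: zero_le_even_power ennreal_mult nn_integral_add nn_integral_cmult add_nonneg_nonneg)
    also have "... \<le> ennreal (1 + B * \<theta>) * ennreal (C * u ^ p) + ennreal (B * ?r) * ennreal (c * v ^ p)"
      by (intro add_mono mult_left_mono g h) auto
    also have "... = ennreal ((1 + B * \<theta>) * (C * u ^ p) + B * ?r * (c * v ^ p))"
      using B \<theta> r C0 c u v by (subst ennreal_plus) (auto simp: ennreal_mult intro!: mult_nonneg_nonneg add_nonneg_nonneg)
    also have "... = ennreal (C * u ^ p + B * (\<theta> * (C * u ^ p) + ?r * (c * v ^ p)))"
      by (simp add: algebra_simps)
    finally show ?thesis .
  qed
  have "T < \<infinity>" using T[of 1] by (simp add: order_le_less_trans)
  then obtain t where t: "T = ennreal t" "t \<ge> 0" by (cases T) auto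
  have "t \<le> C * (u + v) ^ p"
  proof (rule moment_bound_from_recursion[OF p B c u v C[folded B_def]])
    fix \<theta> :: real assume \<theta>: "\<theta> > 0"
    have "0 \<le> C * u ^ p + B * (\<theta> * (C * u ^ p) + ((1 / \<theta>) ^ (p - 1) + 1) * (c * v ^ p))"
      using \<theta> C0 u v B c by (intro add_nonneg_nonneg mult_nonneg_nonneg) auto
    then show "t \<le> C * u ^ p + B * (\<theta> * (C * u ^ p) + ((1 / \<theta>) ^ (p - 1) + 1) * (c * v ^ p))"
      using T[OF \<theta>] by (simp add: t)
  qed
  then show ?thesis unfolding T_def[symmetric] t by (rule ennreal_leI)
qed

text \<open>
  A Marcinkiewicz-Zygmund type inequality with a constant depending only on p and the moment bound,
  proved by adding one variable at a time. The variables are the coordinates r i, so that the entries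
  of one row of a matrix can be addressed by their column index.
\<close>

lemma linear_form_moment:
  fixes \<phi> :: "'x \<Rightarrow> real" and a :: "'k \<Rightarrow> real" and r :: "'k \<Rightarrow> 'i"
  assumes p: "p \<ge> 1" and Q: "centred_moments Q \<phi> p K" and K: "K \<ge> 0"
    and "finite S" "inj_on r S"
  shows "(\<integral>\<^sup>+x. ennreal ((\<Sum>i\<in>S. a i * \<phi> (x (r i))) ^ (2 * p)) \<partial>iid (r ` S) Q)
     \<le> ennreal (mz p K ^ p * (\<Sum>i\<in>S. (a i)\<^sup>2) ^ p)"
  using assms(4,5)
proof (induction S)
  case empty
  then show ?case using p by (simp add: power_0_left)
next
  case (insert n S)
  interpret Q: prob_space Q using Q by (simp add: centred_moments_def)
  interpret product_sigma_finite "\<lambda>_::'i. Q" by standard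
  have [measurable]: "\<phi> \<in> borel_measurable Q" using Q by (simp add: centred_moments_def)
  have rn: "r n \<notin> r ` S" using insert.hyps insert.prems by auto
  have rne: "r i \<noteq> r n" if "i \<in> S" for i using rn that by (metis imageI)
  let ?g = "\<lambda>x. \<Sum>i\<in>S. a i * \<phi> (x (r i))"
  have [measurable]: "?g \<in> borel_measurable (iid (r ` S) Q)"
    by (intro borel_measurable_sum borel_measurable_times borel_measurable_const measurable_compose[OF measurable_component_singleton]) auto
  have m: "(\<lambda>x. \<Sum>i\<in>insert n S. a i * \<phi> (x (r i))) \<in> borel_measurable (iid (insert (r n) (r ` S)) Q)"
    by (intro borel_measurable_sum borel_measurable_times borel_measurable_const measurable_compose[OF measurable_component_singleton]) auto
  have "(\<integral>\<^sup>+x. ennreal ((\<Sum>i\<in>insert n S. a i * \<phi> (x (r i))) ^ (2 * p)) \<partial>iid (insert (r n) (r ` S)) Q)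
     = (\<integral>\<^sup>+x. \<integral>\<^sup>+y. ennreal ((?g x + \<phi> y * a n) ^ (2 * p)) \<partial>Q \<partial>iid (r ` S) Q)"
    using insert.hyps rn m
    by (subst product_nn_integral_insert) (auto simp: rne add.commute mult.commute cong: sum.cong)
  also have "... \<le> ennreal (mz p K ^ p * ((\<Sum>i\<in>S. (a i)\<^sup>2) + (a n)\<^sup>2) ^ p)"
  proof (rule moment_step[OF p Q K, where c = 1])
    show "(\<integral>\<^sup>+x. ennreal (a n ^ (2 * p)) \<partial>iid (r ` S) Q) \<le> ennreal (1 * (a n)\<^sup>2 ^ p)"
    proof -
      interpret P: prob_space "iid (r ` S) Q" by (intro prob_space_PiM) unfold_locales
      show ?thesis by (simp add: P.emeasure_space_1 power_mult)
    qed
  qed (use insert in \<open>auto simp: sum_nonneg\<close>)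
  finally show ?case using insert.hyps by (simp add: add.commute)
qed

text \<open>
  The induction is again over the variables. The coefficient of the last one is a linear form in the
  others, to which the previous inequality applies. The factor 2 compensates for combining a i n and
  a n i into one coefficient.
\<close>

lemma quadratic_form_moment:
  fixes \<phi> :: "'x \<Rightarrow> real" and a :: "'k \<Rightarrow> 'k \<Rightarrow> real" and r :: "'k \<Rightarrow> 'i"
  assumes p: "p \<ge> 1" and Q: "centred_moments Q \<phi> p K" and K: "K \<ge> 0"
    and "finite S" "inj_on r S"
  shows "(\<integral>\<^sup>+x. ennreal ((\<Sum>i\<in>S. \<Sum>j\<in>S - {i}. a i j * \<phi> (x (r i)) * \<phi> (x (r j))) ^ (2 * p)) \<partial>iid (r ` S) Q)
     \<le> ennreal (mz p K ^ (2 * p) * (2 * (\<Sum>i\<in>S. \<Sum>j\<in>S - {i}. (a i j)\<^sup>2)) ^ p)"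
  using assms(4,5)
proof (induction S)
  case empty
  then show ?case using p by (simp add: power_0_left)
next
  case (insert n S)
  interpret Q: prob_space Q using Q by (simp add: centred_moments_def)
  interpret product_sigma_finite "\<lambda>_::'i. Q" by standard
  have [measurable]: "\<phi> \<in> borel_measurable Q" using Q by (simp add: centred_moments_def)
  have rn: "r n \<notin> r ` S" using insert.hyps insert.prems by auto
  have rne: "r i \<noteq> r n" if "i \<in> S" for i using rn that by (metis imageI)
  have split: "(\<Sum>i\<in>insert n S. \<Sum>j\<in>insert n S - {i}. f i j) = (\<Sum>i\<in>S. \<Sum>j\<in>S - {i}. f i j) + (\<Sum>i\<in>S. f i n + f n i)"
    for f :: "'k \<Rightarrow> 'k \<Rightarrow> real"
  proof -
    have "(\<Sum>j\<in>insert n S - {i}. f i j) = f i n + (\<Sum>j\<in>S - {i}. f i j)" if "i \<in> S" for i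
    proof -
      have "insert n S - {i} = insert n (S - {i})" using that insert.hyps by auto
      then show ?thesis using insert.hyps by simp
    qed
    then have "(\<Sum>i\<in>S. \<Sum>j\<in>insert n S - {i}. f i j) = (\<Sum>i\<in>S. f i n + (\<Sum>j\<in>S - {i}. f i j))" by simp
    moreover have "insert n S - {n} = S" using insert.hyps by auto
    ultimately show ?thesis using insert.hyps by (simp add: sum.distrib)
  qed
  let ?g = "\<lambda>x. \<Sum>i\<in>S. \<Sum>j\<in>S - {i}. a i j * \<phi> (x (r i)) * \<phi> (x (r j))"
  let ?h = "\<lambda>x. \<Sum>i\<in>S. (a i n + a n i) * \<phi> (x (r i))"
  have [measurable]: "(\<lambda>x. \<phi> (x (r i))) \<in> borel_measurable (iid (r ` S) Q)" if "i \<in> S" for i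
    using that by (intro measurable_compose[OF measurable_component_singleton]) auto
  have mg[measurable]: "?g \<in> borel_measurable (iid (r ` S) Q)"
    by (intro borel_measurable_sum borel_measurable_times borel_measurable_const) auto
  have mh[measurable]: "?h \<in> borel_measurable (iid (r ` S) Q)"
    by (intro borel_measurable_sum borel_measurable_times borel_measurable_const) auto
  have "(\<lambda>x. \<phi> (x (r i))) \<in> borel_measurable (iid (insert (r n) (r ` S)) Q)" if "i \<in> insert n S" for i
    using that by (intro measurable_compose[OF measurable_component_singleton]) auto
  then have m: "(\<lambda>x. \<Sum>i\<in>insert n S. \<Sum>j\<in>insert n S - {i}. a i j * \<phi> (x (r i)) * \<phi> (x (r j)))
     \<in> borel_measurable (iid (insert (r n) (r ` S)) Q)"
    by (intro borel_measurable_sum borel_measurable_times borel_measurable_const) auto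
  have eq: "(\<Sum>i\<in>insert n S. \<Sum>j\<in>insert n S - {i}. a i j * \<phi> ((x(r n := y)) (r i)) * \<phi> ((x(r n := y)) (r j)))
      = ?g x + \<phi> y * ?h x" for x y
    unfolding split sum_distrib_left
    by (intro arg_cong2[of _ _ _ _ "(+)"] sum.cong refl) (auto simp: rne algebra_simps)
  have "(\<integral>\<^sup>+x. ennreal ((\<Sum>i\<in>insert n S. \<Sum>j\<in>insert n S - {i}. a i j * \<phi> (x (r i)) * \<phi> (x (r j))) ^ (2 * p)) \<partial>iid (insert (r n) (r ` S)) Q)
     = (\<integral>\<^sup>+x. \<integral>\<^sup>+y. ennreal ((?g x + \<phi> y * ?h x) ^ (2 * p)) \<partial>Q \<partial>iid (r ` S) Q)"
    using insert.hyps rn m by (subst product_nn_integral_insert) (auto simp only: eq finite_imageI measurable_compose[OF m] intro!: measurable_compose[OF _ measurable_ennreal] borel_measurable_power)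
  also have "... \<le> ennreal (mz p K ^ (2 * p) * ((2 * (\<Sum>i\<in>S. \<Sum>j\<in>S - {i}. (a i j)\<^sup>2)) + (\<Sum>i\<in>S. (a i n + a n i)\<^sup>2)) ^ p)"
  proof (rule moment_step[OF p Q K, where c = "mz p K ^ p"])
    show "(\<integral>\<^sup>+x. ennreal (?h x ^ (2 * p)) \<partial>iid (r ` S) Q)
      \<le> ennreal (mz p K ^ p * (\<Sum>i\<in>S. (a i n + a n i)\<^sup>2) ^ p)"
      by (rule linear_form_moment[OF p Q K insert.hyps(1)]) (use insert.prems in auto)
    show "mz p K ^ (2 * p) = mz p K ^ p * mz p K ^ p"
      by (simp add: mult_2 power_add)
    show "(\<integral>\<^sup>+x. ennreal (?g x ^ (2 * p)) \<partial>iid (r ` S) Q)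
      \<le> ennreal (mz p K ^ (2 * p) * (2 * (\<Sum>i\<in>S. \<Sum>j\<in>S - {i}. (a i j)\<^sup>2)) ^ p)"
      using insert.IH insert.prems by auto
  qed (use K in \<open>auto intro!: sum_nonneg mult_nonneg_nonneg\<close>)
  also have "... \<le> ennreal (mz p K ^ (2 * p) * (2 * (\<Sum>i\<in>insert n S. \<Sum>j\<in>insert n S - {i}. (a i j)\<^sup>2)) ^ p)"
  proof (intro ennreal_leI mult_left_mono power_mono)
    have "(x + y)\<^sup>2 \<le> 2 * (x\<^sup>2 + y\<^sup>2)" for x y :: real
      using sum_squares_bound[of x y] by (simp add: power2_sum)
    then show "2 * (\<Sum>i\<in>S. \<Sum>j\<in>S - {i}. (a i j)\<^sup>2) + (\<Sum>i\<in>S. (a i n + a n i)\<^sup>2)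
       \<le> 2 * (\<Sum>i\<in>insert n S. \<Sum>j\<in>insert n S - {i}. (a i j)\<^sup>2)"
      unfolding split by (auto simp: sum_distrib_left distrib_left intro!: sum_mono simp del: sum.distrib)
  qed (use K in \<open>auto intro!: sum_nonneg add_nonneg_nonneg\<close>)
  finally show ?case by simp
qed

section \<open>Concentration of the quadratic forms in the rows\<close>

lemma green_cong:
  assumes "\<And>i j. i \<in> S \<Longrightarrow> j \<in> S \<Longrightarrow> W i j = W' i j"
  shows "green S W z = green S W' z"
proof -
  have "is_green S W z = is_green S W' z"
    using assms by (intro ext) (auto simp: is_green_def cong: sum.cong)
  then show ?thesis by (simp add: green_def)
qed

lemma borel_measurable_PiM_component:
  fixes \<phi> :: "'x \<Rightarrow> real"
  assumes "\<phi> \<in> borel_measurable Q" "i \<in> I"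
  shows "(\<lambda>x. \<phi> (x i)) \<in> borel_measurable (iid I Q)"
  using assms by measurable

lemma borel_measurable_complex_of_real:
  assumes "f \<in> borel_measurable M"
  shows "(\<lambda>x. complex_of_real (f x)) \<in> borel_measurable M"
  using assms by measurable

lemma sum_four_power_le:
  fixes x a b c d :: real
  assumes "\<bar>x\<bar> \<le> \<bar>a\<bar> + \<bar>b\<bar> + \<bar>c\<bar> + \<bar>d\<bar>"
  shows "x ^ (2 * p) \<le> 4 ^ (2 * p) * (a ^ (2 * p) + b ^ (2 * p) + c ^ (2 * p) + d ^ (2 * p))"
proof -
  define M where "M = max (max \<bar>a\<bar> \<bar>b\<bar>) (max \<bar>c\<bar> \<bar>d\<bar>)"
  have e: "\<bar>y\<bar> ^ (2 * p) = y ^ (2 * p)" for y :: real by (rule power_even_abs) simp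
  have e0: "0 \<le> y ^ (2 * p)" for y :: real by (rule zero_le_even_power) simp
  have "\<bar>x\<bar> \<le> 4 * M" using assms unfolding M_def by linarith
  then have "\<bar>x\<bar> ^ (2 * p) \<le> (4 * M) ^ (2 * p)" by (intro power_mono) auto
  also have "... = 4 ^ (2 * p) * M ^ (2 * p)" by (rule power_mult_distrib)
  also have "M ^ (2 * p) \<le> a ^ (2 * p) + b ^ (2 * p) + c ^ (2 * p) + d ^ (2 * p)"
    using e0[of a] e0[of b] e0[of c] e0[of d] unfolding M_def
    by (auto simp: max_def e)
  finally show ?thesis by (simp add: e)
qed

text \<open>
  The factor 4^(2p) comes from splitting a complex quadratic form into the real and imaginary parts
  of its off-diagonal and diagonal contributions; the two constants in the sum belong to the
  off-diagonal (quadratic) and the diagonal (linear) parts.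
\<close>

definition quad_const :: "nat \<Rightarrow> real \<Rightarrow> real" where
  "quad_const p K = 4 ^ (2 * p) * (2 * mz p K ^ p + 2 * (mz p K ^ (2 * p) * 2 ^ p))"

lemma markov_power:
  fixes f :: "'m \<Rightarrow> real"
  assumes [measurable]: "f \<in> borel_measurable M" and c: "c > 0" and \<Lambda>: "\<Lambda> > 0"
    and bd: "(\<integral>\<^sup>+x. ennreal (f x ^ (2 * p)) \<partial>M) \<le> ennreal (C * c ^ (2 * p))"
  shows "emeasure M {x \<in> space M. \<bar>f x\<bar> > \<Lambda> * c} \<le> ennreal (C / \<Lambda> ^ (2 * p))"
proof -
  have e: "\<bar>y\<bar> ^ (2 * p) = y ^ (2 * p)" for y :: real by (rule power_even_abs) simp
  define u where "u = (\<Lambda> * c) ^ (2 * p)"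
  have u: "u > 0" using \<Lambda> c by (simp add: u_def)
  have "emeasure M {x \<in> space M. \<bar>f x\<bar> > \<Lambda> * c} = (\<integral>\<^sup>+x. indicator {x \<in> space M. \<bar>f x\<bar> > \<Lambda> * c} x \<partial>M)"
    by simp
  also have "... \<le> (\<integral>\<^sup>+x. ennreal (1 / u) * ennreal (f x ^ (2 * p)) \<partial>M)"
  proof (intro nn_integral_mono)
    fix x
    show "indicator {x \<in> space M. \<bar>f x\<bar> > \<Lambda> * c} x \<le> ennreal (1 / u) * ennreal (f x ^ (2 * p))"
    proof (cases "\<bar>f x\<bar> > \<Lambda> * c")
      case True
      have "u \<le> \<bar>f x\<bar> ^ (2 * p)" unfolding u_def using True \<Lambda> c by (intro power_mono) auto
      then have "1 \<le> 1 / u * f x ^ (2 * p)" using u by (simp add: e)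
      then have "ennreal 1 \<le> ennreal (1 / u * f x ^ (2 * p))" by (rule ennreal_leI)
      also have "... = ennreal (1 / u) * ennreal (f x ^ (2 * p))"
        using u by (intro ennreal_mult) (auto simp: zero_le_even_power)
      finally show ?thesis by (auto simp: indicator_def)
    qed auto
  qed
  also have "... = ennreal (1 / u) * (\<integral>\<^sup>+x. ennreal (f x ^ (2 * p)) \<partial>M)"
    by (intro nn_integral_cmult) measurable
  also have "... \<le> ennreal (1 / u) * ennreal (C * c ^ (2 * p))"
    by (intro mult_left_mono bd) auto
  also have "... = ennreal (1 / u * (C * c ^ (2 * p)))"
    using u by (intro ennreal_mult'[symmetric]) simp
  also have "1 / u * (C * c ^ (2 * p)) = C / \<Lambda> ^ (2 * p)"
    using c \<Lambda> by (simp add: u_def power_mult_distrib)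
  finally show ?thesis .
qed

text \<open>
  A Hanson-Wright type inequality with polynomial tails: the quadratic form in the independent
  variables \<phi> (x (r i)) is close to its mean, at the scale of the Hilbert-Schmidt norm of the
  coefficients. The off-diagonal part is a quadratic form in centred variables, and the diagonal part
  is a linear form in the centred variables \<phi>^2 - \<sigma>2.
\<close>

lemma quadratic_form_concentration:
  fixes \<phi> :: "'x \<Rightarrow> real" and G :: "'k \<Rightarrow> 'k \<Rightarrow> complex" and r :: "'k \<Rightarrow> 'i"
  assumes p: "p \<ge> 1" and Q: "centred_moments Q \<phi> p K" and Q2: "centred_moments Q (\<lambda>y. (\<phi> y)\<^sup>2 - \<sigma>2) p K"
    and K: "K \<ge> 0" and S: "finite S" and r: "inj_on r S" and \<Lambda>: "\<Lambda> > 0"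
  shows "emeasure (iid (r ` S) Q) {x \<in> space (iid (r ` S) Q).
      cmod ((\<Sum>i\<in>S. \<Sum>j\<in>S. G i j * of_real (\<phi> (x (r i)) * \<phi> (x (r j)))) - of_real \<sigma>2 * (\<Sum>i\<in>S. G i i))
        > \<Lambda> * sqrt (\<Sum>i\<in>S. \<Sum>j\<in>S. (cmod (G i j))\<^sup>2)} \<le> ennreal (quad_const p K / \<Lambda> ^ (2 * p))"
proof -
  let ?P = "iid (r ` S) Q"
  define A where "A = (\<Sum>i\<in>S. \<Sum>j\<in>S. (cmod (G i j))\<^sup>2)"
  define Z where "Z x = (\<Sum>i\<in>S. \<Sum>j\<in>S. G i j * of_real (\<phi> (x (r i)) * \<phi> (x (r j)))) - of_real \<sigma>2 * (\<Sum>i\<in>S. G i i)" for x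
  define off where "off a x = (\<Sum>i\<in>S. \<Sum>j\<in>S - {i}. a i j * \<phi> (x (r i)) * \<phi> (x (r j)))" for a :: "'k \<Rightarrow> 'k \<Rightarrow> real" and x
  define dia where "dia a x = (\<Sum>i\<in>S. a i * ((\<phi> (x (r i)))\<^sup>2 - \<sigma>2))" for a :: "'k \<Rightarrow> real" and x
  define re where "re i j = Re (G i j)" for i j
  define im where "im i j = Im (G i j)" for i j
  define c1 where "c1 = mz p K ^ p"
  define c2 where "c2 = mz p K ^ (2 * p) * 2 ^ p"
  have c: "c1 \<ge> 0" "c2 \<ge> 0" using K by (auto simp: c1_def c2_def)
  have A0: "A \<ge> 0" by (simp add: A_def sum_nonneg)
  have \<phi>m: "\<phi> \<in> borel_measurable Q" using Q by (simp add: centred_moments_def)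
  have \<phi>r[measurable]: "(\<lambda>x. \<phi> (x (r i))) \<in> borel_measurable ?P" if "i \<in> S" for i
    using that by (intro borel_measurable_PiM_component[OF \<phi>m]) auto
  have [measurable]: "off a \<in> borel_measurable ?P" for a unfolding off_def
    by (intro borel_measurable_sum borel_measurable_times borel_measurable_const) auto
  have [measurable]: "dia a \<in> borel_measurable ?P" for a unfolding dia_def
    by (intro borel_measurable_sum borel_measurable_times borel_measurable_const borel_measurable_diff borel_measurable_power) auto
  have "Z \<in> borel_measurable ?P" unfolding Z_def
    by (intro borel_measurable_diff borel_measurable_sum borel_measurable_times borel_measurable_const
        borel_measurable_complex_of_real) auto
  then have Zm[measurable]: "(\<lambda>x. cmod (Z x)) \<in> borel_measurable ?P" by measurable
  have split: "(\<Sum>i\<in>S. \<Sum>j\<in>S. f i j) = (\<Sum>i\<in>S. \<Sum>j\<in>S - {i}. f i j) + (\<Sum>i\<in>S. f i i)" for f :: "'k \<Rightarrow> 'k \<Rightarrow> real"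
    using S by (simp add: sum.remove[OF S] sum.distrib[symmetric] add.commute cong: sum.cong)
  have ReZ: "Re (Z x) = off re x + dia (\<lambda>i. re i i) x" for x
    unfolding Z_def off_def dia_def re_def
    by (simp add: split sum_distrib_left sum_subtractf power2_eq_square algebra_simps)
  have ImZ: "Im (Z x) = off im x + dia (\<lambda>i. im i i) x" for x
    unfolding Z_def off_def dia_def im_def
    by (simp add: split sum_distrib_left sum_subtractf power2_eq_square algebra_simps)
  have le: "cmod (Z x) ^ (2 * p) \<le> 4 ^ (2 * p) * (off re x ^ (2 * p) + off im x ^ (2 * p) + dia (\<lambda>i. re i i) x ^ (2 * p) + dia (\<lambda>i. im i i) x ^ (2 * p))" for x
    using cmod_le[of "Z x"] unfolding ReZ ImZ 
    by (intro sum_four_power_le) (use norm_ge_zero[of "Z x"] in linarith)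
  have offb: "(\<integral>\<^sup>+x. ennreal (off a x ^ (2 * p)) \<partial>?P) \<le> ennreal (c2 * A ^ p)"
    if a: "\<And>i j. (a i j)\<^sup>2 \<le> (cmod (G i j))\<^sup>2" for a
  proof -
    have "(\<integral>\<^sup>+x. ennreal (off a x ^ (2 * p)) \<partial>?P) \<le> ennreal (mz p K ^ (2 * p) * (2 * (\<Sum>i\<in>S. \<Sum>j\<in>S - {i}. (a i j)\<^sup>2)) ^ p)"
      unfolding off_def by (rule quadratic_form_moment[OF p Q K S r])
    also have "... \<le> ennreal (mz p K ^ (2 * p) * (2 * A) ^ p)"
    proof (intro ennreal_leI mult_left_mono power_mono)
      have "(\<Sum>i\<in>S. \<Sum>j\<in>S - {i}. (a i j)\<^sup>2) \<le> (\<Sum>i\<in>S. \<Sum>j\<in>S. (a i j)\<^sup>2)"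
        using S by (intro sum_mono sum_mono2) auto
      also have "... \<le> A" unfolding A_def by (intro sum_mono a)
      finally show "(\<Sum>i\<in>S. \<Sum>j\<in>S - {i}. (a i j)\<^sup>2) \<le> A" .
    qed (use K in \<open>auto intro!: sum_nonneg\<close>)
    finally show ?thesis by (simp add: c2_def power_mult_distrib mult_ac)
  qed
  have diab: "(\<integral>\<^sup>+x. ennreal (dia a x ^ (2 * p)) \<partial>?P) \<le> ennreal (c1 * A ^ p)"
    if a: "\<And>i. (a i)\<^sup>2 \<le> (cmod (G i i))\<^sup>2" for a
  proof -
    have "(\<integral>\<^sup>+x. ennreal (dia a x ^ (2 * p)) \<partial>?P) \<le> ennreal (mz p K ^ p * (\<Sum>i\<in>S. (a i)\<^sup>2) ^ p)"
      unfolding dia_def by (rule linear_form_moment[OF p Q2 K S r])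
    also have "... \<le> ennreal (mz p K ^ p * A ^ p)"
    proof (intro ennreal_leI mult_left_mono power_mono)
      have "(\<Sum>i\<in>S. (a i)\<^sup>2) \<le> (\<Sum>i\<in>S. (cmod (G i i))\<^sup>2)" by (intro sum_mono a)
      also have "... \<le> A" unfolding A_def using S by (intro sum_mono member_le_sum) auto
      finally show "(\<Sum>i\<in>S. (a i)\<^sup>2) \<le> A" .
    qed (use K in \<open>auto intro!: sum_nonneg\<close>)
    finally show ?thesis by (simp add: c1_def)
  qed
  have sq: "(re i j)\<^sup>2 \<le> (cmod (G i j))\<^sup>2" "(im i j)\<^sup>2 \<le> (cmod (G i j))\<^sup>2" for i j
    by (simp_all add: re_def im_def cmod_power2)
  have ep: "0 \<le> y ^ (2 * p)" for y :: real by (rule zero_le_even_power) simp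
  have "(\<integral>\<^sup>+x. ennreal (cmod (Z x) ^ (2 * p)) \<partial>?P)
     \<le> (\<integral>\<^sup>+x. ennreal (4 ^ (2 * p)) * (ennreal (off re x ^ (2 * p)) + ennreal (off im x ^ (2 * p)) + ennreal (dia (\<lambda>i. re i i) x ^ (2 * p)) + ennreal (dia (\<lambda>i. im i i) x ^ (2 * p))) \<partial>?P)"
  proof (intro nn_integral_mono)
    fix x
    have "ennreal (cmod (Z x) ^ (2 * p)) \<le> ennreal (4 ^ (2 * p) * (off re x ^ (2 * p) + off im x ^ (2 * p) + dia (\<lambda>i. re i i) x ^ (2 * p) + dia (\<lambda>i. im i i) x ^ (2 * p)))"
      by (intro ennreal_leI le)
    also have "... = ennreal (4 ^ (2 * p)) * (ennreal (off re x ^ (2 * p)) + ennreal (off im x ^ (2 * p)) + ennreal (dia (\<lambda>i. re i i) x ^ (2 * p)) + ennreal (dia (\<lambda>i. im i i) x ^ (2 * p)))"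
      by (simp add: ennreal_mult ennreal_plus ep add_nonneg_nonneg del: ennreal_power)
    finally show "ennreal (cmod (Z x) ^ (2 * p)) \<le> ..." .
  qed
  also have "... = ennreal (4 ^ (2 * p)) * ((\<integral>\<^sup>+x. ennreal (off re x ^ (2 * p)) \<partial>?P) + (\<integral>\<^sup>+x. ennreal (off im x ^ (2 * p)) \<partial>?P)
       + (\<integral>\<^sup>+x. ennreal (dia (\<lambda>i. re i i) x ^ (2 * p)) \<partial>?P) + (\<integral>\<^sup>+x. ennreal (dia (\<lambda>i. im i i) x ^ (2 * p)) \<partial>?P))"
    by (simp add: nn_integral_cmult nn_integral_add)
  also have "... \<le> ennreal (4 ^ (2 * p)) * (ennreal (c2 * A ^ p) + ennreal (c2 * A ^ p) + ennreal (c1 * A ^ p) + ennreal (c1 * A ^ p))"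
    by (intro mult_left_mono add_mono offb diab sq) auto
  also have "... = ennreal (4 ^ (2 * p) * (c2 * A ^ p + c2 * A ^ p + c1 * A ^ p + c1 * A ^ p))"
  proof -
    have "0 \<le> c1 * A ^ p" "0 \<le> c2 * A ^ p" using c A0 by auto
    then show ?thesis by (simp only: ennreal_plus[symmetric] ennreal_mult'[symmetric] add_nonneg_nonneg zero_le_power zero_le_numeral)
  qed
  also have "4 ^ (2 * p) * (c2 * A ^ p + c2 * A ^ p + c1 * A ^ p + c1 * A ^ p) = quad_const p K * sqrt A ^ (2 * p)"
  proof -
    have "sqrt A ^ (2 * p) = A ^ p" using A0 by (simp add: power_mult)
    then show ?thesis unfolding quad_const_def c1_def[symmetric] c2_def[symmetric] by (simp add: algebra_simps)
  qed
  finally have mom: "(\<integral>\<^sup>+x. ennreal (cmod (Z x) ^ (2 * p)) \<partial>?P) \<le> ennreal (quad_const p K * sqrt A ^ (2 * p))" .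
  have "emeasure ?P {x \<in> space ?P. cmod (Z x) > \<Lambda> * sqrt A} \<le> ennreal (quad_const p K / \<Lambda> ^ (2 * p))"
  proof (cases "A = 0")
    case True
    have "G i j = 0" if "i \<in> S" "j \<in> S" for i j
      using True S that unfolding A_def by (auto simp: sum_nonneg_eq_0_iff sum_nonneg)
    then have "Z x = 0" for x unfolding Z_def by simp
    then show ?thesis using True by simp
  next
    case False
    then have "sqrt A > 0" using A0 by simp
    from markov_power[OF Zm this \<Lambda> mom] show ?thesis by simp
  qed
  then show ?thesis unfolding Z_def A_def .
qed

text \<open>
  A bound that holds conditionally on the coordinates outside J, uniformly in their values, holds
  for the whole product measure. Below, J is the set of the positions in one row of the matrix.
\<close>

lemma PiM_fubini_bound:
  fixes Q :: "'x measure" and I :: "'i set"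
  assumes Q: "prob_space Q" and I: "finite I" "J \<subseteq> I"
    and E: "E \<in> sets (iid I Q)"
    and bd: "\<And>y. y \<in> space (iid (I - J) Q) \<Longrightarrow>
       emeasure (iid J Q) {w \<in> space (iid J Q). merge (I - J) J (y, w) \<in> E} \<le> c"
  shows "emeasure (iid I Q) E \<le> c"
proof -
  interpret Q: prob_space Q by fact
  interpret product_sigma_finite "\<lambda>_::'i. Q" by standard
  interpret P: prob_space "iid (I - J) Q" by (intro prob_space_PiM) unfold_locales
  have IJ: "(I - J) \<union> J = I" using I by auto
  have "emeasure (iid I Q) E = (\<integral>\<^sup>+x. indicator E x \<partial>iid ((I - J) \<union> J) Q)"
    unfolding IJ by (rule nn_integral_indicator[OF E, symmetric])
  also have "... = (\<integral>\<^sup>+y. \<integral>\<^sup>+w. indicator E (merge (I - J) J (y, w)) \<partial>iid J Q \<partial>iid (I - J) Q)"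
  proof (rule product_nn_integral_fold)
    show "indicator E \<in> borel_measurable (iid ((I - J) \<union> J) Q)"
      unfolding IJ using E by simp
  qed (use I finite_subset in auto)
  also have "... \<le> (\<integral>\<^sup>+y. c \<partial>iid (I - J) Q)"
  proof (intro nn_integral_mono)
    fix y assume y: "y \<in> space (iid (I - J) Q)"
    have m: "(\<lambda>w. merge (I - J) J (y, w)) \<in> iid J Q \<rightarrow>\<^sub>M iid I Q"
      using measurable_compose[OF measurable_Pair1'[OF y] measurable_merge[of "I - J" J "\<lambda>_. Q"]]
      unfolding IJ .
    have "{w \<in> space (iid J Q). merge (I - J) J (y, w) \<in> E} \<in> sets (iid J Q)"
      using measurable_sets[OF m E] by (simp add: vimage_def Int_def conj_commute)
    then have "(\<integral>\<^sup>+w. indicator {w \<in> space (iid J Q). merge (I - J) J (y, w) \<in> E} w \<partial>iid J Q) \<le> c"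
      using bd[OF y] by simp
    also have "(\<integral>\<^sup>+w. indicator {w \<in> space (iid J Q). merge (I - J) J (y, w) \<in> E} w \<partial>iid J Q)
      = (\<integral>\<^sup>+w. indicator E (merge (I - J) J (y, w)) \<partial>iid J Q)"
      by (intro nn_integral_cong) (auto simp: indicator_def)
    finally show "(\<integral>\<^sup>+w. indicator E (merge (I - J) J (y, w)) \<partial>iid J Q) \<le> c" .
  qed
  also have "... = c" by (simp add: P.emeasure_space_1)
  finally show ?thesis .
qed

text \<open>
  The random entries live on the pairs with i \<le> j; sym_ext below extends them to a symmetric kernel.
\<close>

definition pairs :: "nat \<Rightarrow> (nat \<times> nat) set" where "pairs N = {(i, j). i \<le> j \<and> j < N}"

definition sym_ext :: "(nat \<times> nat \<Rightarrow> 'b) \<Rightarrow> nat \<Rightarrow> nat \<Rightarrow> 'b" where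
  "sym_ext x i j = x (min i j, max i j)"

lemma finite_pairs: "finite (pairs N)"
  by (rule finite_subset[of _ "{..<N} \<times> {..<N}"]) (auto simp: pairs_def)

lemma sym_kernel_sym_ext: "sym_kernel (\<lambda>i j. f (sym_ext x i j))"
  by (simp add: sym_kernel_def sym_ext_def min.commute max.commute)

text \<open>
  The map \<phi> subtracts the conditional mean in the applications, and is the identity when the original
  matrix is meant.
\<close>

definition scaled :: "('x \<Rightarrow> real) \<Rightarrow> nat \<Rightarrow> (nat \<times> nat \<Rightarrow> 'x) \<Rightarrow> nat \<Rightarrow> nat \<Rightarrow> real" where
  "scaled \<phi> N x i j = \<phi> (sym_ext x i j) / sqrt N"

lemma sym_kernel_scaled: "sym_kernel (scaled \<phi> N x)"
  by (simp add: sym_kernel_def scaled_def sym_ext_def min.commute max.commute)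

lemma measurable_sym_ext:
  fixes \<phi> :: "'x \<Rightarrow> real"
  assumes "\<phi> \<in> borel_measurable Q" "i < N" "j < N"
  shows "(\<lambda>x. \<phi> (sym_ext x i j)) \<in> borel_measurable (iid (pairs N) Q)"
  unfolding sym_ext_def using assms(2,3)
  by (intro borel_measurable_PiM_component[OF assms(1)]) (auto simp: pairs_def)

lemma measurable_green_of_entries:
  assumes \<phi>: "\<phi> \<in> borel_measurable Q" and "S \<subseteq> {..<N}" and z: "Im z > 0"
  shows "(\<lambda>x. green S (scaled \<phi> N x) z i j) \<in> borel_measurable (iid (pairs N) Q)"
proof (rule borel_measurable_green[OF _ sym_kernel_scaled z])
  show "finite S" using assms(2) finite_subset by auto
  fix i j assume "i \<in> S" "j \<in> S"
  then have "i < N" "j < N" using assms(2) by auto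
  note [measurable] = measurable_sym_ext[OF \<phi> this]
  show "(\<lambda>x. scaled \<phi> N x i j) \<in> borel_measurable (iid (pairs N) Q)"
    unfolding scaled_def by measurable
qed

definition minor_set :: "nat \<Rightarrow> nat \<Rightarrow> nat set" where "minor_set N k = {..<N} - {k}"

text \<open>
  The deviation of the quadratic form in row k from its conditional mean, given the minor without
  row and column k.
\<close>

definition quad_dev :: "('x \<Rightarrow> real) \<Rightarrow> real \<Rightarrow> nat \<Rightarrow> complex \<Rightarrow> nat \<Rightarrow> (nat \<times> nat \<Rightarrow> 'x) \<Rightarrow> complex" where
  "quad_dev \<phi> \<sigma>2 N z k x = (let S = minor_set N k; G = green S (scaled \<phi> N x) z in
     (\<Sum>i\<in>S. \<Sum>j\<in>S. G i j * of_real (\<phi> (sym_ext x k i) * \<phi> (sym_ext x k j))) - of_real \<sigma>2 * (\<Sum>i\<in>S. G i i))"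

text \<open>
  The Hilbert-Schmidt norm of the Green function of the minor.
\<close>

definition hs_norm :: "('x \<Rightarrow> real) \<Rightarrow> nat \<Rightarrow> complex \<Rightarrow> nat \<Rightarrow> (nat \<times> nat \<Rightarrow> 'x) \<Rightarrow> real" where
  "hs_norm \<phi> N z k x = (let S = minor_set N k; G = green S (scaled \<phi> N x) z in
     sqrt (\<Sum>i\<in>S. \<Sum>j\<in>S. (cmod (G i j))\<^sup>2))"

text \<open>
  The minor does not involve the entries of row k. Hence its Green function is constant when the
  other coordinates are fixed, and the concentration inequality for deterministic coefficients applies.
\<close>

lemma quad_dev_prob:
  fixes \<phi> :: "'x \<Rightarrow> real"
  assumes p: "p \<ge> 1" and Q: "centred_moments Q \<phi> p K" and Q2: "centred_moments Q (\<lambda>y. (\<phi> y)\<^sup>2 - \<sigma>2) p K"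
    and K: "K \<ge> 0" and \<Lambda>: "\<Lambda> > 0" and k: "k < N" and z: "Im z > 0"
  defines "E \<equiv> {x \<in> space (iid (pairs N) Q). cmod (quad_dev \<phi> \<sigma>2 N z k x) > \<Lambda> * hs_norm \<phi> N z k x}"
  shows "E \<in> sets (iid (pairs N) Q)"
    and "emeasure (iid (pairs N) Q) E \<le> ennreal (quad_const p K / \<Lambda> ^ (2 * p))"
proof -
  let ?P = "iid (pairs N) Q"
  let ?S = "minor_set N k"
  have S: "finite ?S" "?S \<subseteq> {..<N}" by (auto simp: minor_set_def)
  have \<phi>: "\<phi> \<in> borel_measurable Q" and Qp: "prob_space Q" using Q by (auto simp: centred_moments_def)
  note [measurable] = measurable_green_of_entries[OF \<phi> S(2) z]
  have m1: "(\<lambda>x. \<phi> (sym_ext x k i)) \<in> borel_measurable ?P" if "i \<in> ?S" for i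
    using measurable_sym_ext[OF \<phi> k, of i] that S(2) by auto
  have [measurable]: "quad_dev \<phi> \<sigma>2 N z k \<in> borel_measurable ?P"
    unfolding quad_dev_def Let_def
    by (intro borel_measurable_diff borel_measurable_sum borel_measurable_times borel_measurable_const
        borel_measurable_complex_of_real m1 measurable_green_of_entries[OF \<phi> S(2) z])
  have [measurable]: "hs_norm \<phi> N z k \<in> borel_measurable ?P"
    unfolding hs_norm_def Let_def by measurable
  show E: "E \<in> sets ?P" unfolding E_def by measurable
  define r where "r i = (min k i, max k i)" for i :: nat
  have inj: "inj_on r ?S" by (auto simp: inj_on_def r_def min_def max_def split: if_splits)
  define J where "J = r ` ?S"
  have J: "J \<subseteq> pairs N" using k by (auto simp: J_def r_def pairs_def minor_set_def)
  show "emeasure ?P E \<le> ennreal (quad_const p K / \<Lambda> ^ (2 * p))"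
  proof (rule PiM_fubini_bound[OF Qp finite_pairs J E])
    fix y assume y: "y \<in> space (iid (pairs N - J) Q)"
    define G where "G = green ?S (scaled \<phi> N y) z"
    have row: "sym_ext (merge (pairs N - J) J (y, w)) k i = w (r i)" if "i \<in> ?S" for i w
      using that by (auto simp: sym_ext_def r_def[symmetric] merge_def J_def)
    have Geq: "green ?S (scaled \<phi> N (merge (pairs N - J) J (y, w))) z = G" for w
      unfolding G_def
    proof (rule green_cong)
      fix i j assume ij: "i \<in> ?S" "j \<in> ?S"
      have "(min i j, max i j) \<in> pairs N - J"
        using ij by (auto simp: pairs_def minor_set_def J_def r_def min_def max_def split: if_splits)
      then show "scaled \<phi> N (merge (pairs N - J) J (y, w)) i j = scaled \<phi> N y i j"
        by (simp add: scaled_def sym_ext_def merge_def)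
    qed
    have "{w \<in> space (iid J Q). merge (pairs N - J) J (y, w) \<in> E}
      \<subseteq> {w \<in> space (iid J Q).
      cmod ((\<Sum>i\<in>?S. \<Sum>j\<in>?S. G i j * of_real (\<phi> (w (r i)) * \<phi> (w (r j)))) - of_real \<sigma>2 * (\<Sum>i\<in>?S. G i i))
        > \<Lambda> * sqrt (\<Sum>i\<in>?S. \<Sum>j\<in>?S. (cmod (G i j))\<^sup>2)}" (is "?L \<subseteq> ?R")
      by (auto simp: E_def quad_dev_def hs_norm_def Let_def Geq row cong: sum.cong)
    moreover have "?R \<in> sets (iid J Q)"
    proof -
      have "(\<lambda>w. \<phi> (w (r i))) \<in> borel_measurable (iid J Q)" if "i \<in> ?S" for i
        using that by (intro borel_measurable_PiM_component[OF \<phi>]) (auto simp: J_def)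
      then have "(\<lambda>w. (\<Sum>i\<in>?S. \<Sum>j\<in>?S. G i j * of_real (\<phi> (w (r i)) * \<phi> (w (r j)))) - of_real \<sigma>2 * (\<Sum>i\<in>?S. G i i))
         \<in> borel_measurable (iid J Q)"
        by (intro borel_measurable_diff borel_measurable_sum borel_measurable_times borel_measurable_const
          borel_measurable_complex_of_real)
      then show ?thesis by measurable
    qed
    ultimately have "emeasure (iid J Q) ?L \<le> emeasure (iid J Q) ?R" by (rule emeasure_mono)
    also have "... \<le> ennreal (quad_const p K / \<Lambda> ^ (2 * p))"
      unfolding J_def by (rule quadratic_form_concentration[OF p Q Q2 K S(1) inj \<Lambda>])
    finally show "emeasure (iid J Q) ?L \<le> ennreal (quad_const p K / \<Lambda> ^ (2 * p))" .
  qed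
qed

lemma diagonal_entry_prob:
  fixes \<phi> :: "'x \<Rightarrow> real"
  assumes p: "p \<ge> 1" and Q: "centred_moments Q \<phi> p K"
    and K: "K \<ge> 0" and \<Lambda>: "\<Lambda> > 0" and k: "k < N"
  defines "E \<equiv> {x \<in> space (iid (pairs N) Q). \<bar>\<phi> (sym_ext x k k)\<bar> > \<Lambda>}"
  shows "E \<in> sets (iid (pairs N) Q)"
    and "emeasure (iid (pairs N) Q) E \<le> ennreal (quad_const p K / \<Lambda> ^ (2 * p))"
proof -
  let ?P = "iid (pairs N) Q"
  have \<phi>: "\<phi> \<in> borel_measurable Q" and Qp: "prob_space Q" using Q by (auto simp: centred_moments_def)
  note [measurable] = measurable_sym_ext[OF \<phi> k k]
  show E: "E \<in> sets ?P" unfolding E_def by measurable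
  define J where "J = (\<lambda>_::unit. (k, k)) ` {()}"
  have J: "J \<subseteq> pairs N" using k by (auto simp: J_def pairs_def)
  show "emeasure ?P E \<le> ennreal (quad_const p K / \<Lambda> ^ (2 * p))"
  proof (rule PiM_fubini_bound[OF Qp finite_pairs J E])
    fix y assume y: "y \<in> space (iid (pairs N - J) Q)"
    let ?R = "{w \<in> space (iid J Q). \<bar>\<phi> (w (k, k))\<bar> > \<Lambda> * 1}"
    have [measurable]: "(\<lambda>w. \<phi> (w (k, k))) \<in> borel_measurable (iid J Q)"
      by (intro borel_measurable_PiM_component[OF \<phi>]) (auto simp: J_def)
    have "{w \<in> space (iid J Q). merge (pairs N - J) J (y, w) \<in> E} \<subseteq> ?R" (is "?L \<subseteq> _")
      by (auto simp: E_def sym_ext_def merge_def J_def)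
    then have "emeasure (iid J Q) ?L \<le> emeasure (iid J Q) ?R"
      by (intro emeasure_mono) measurable
    also have "... \<le> ennreal (mz p K ^ p / \<Lambda> ^ (2 * p))"
    proof (rule markov_power[OF _ _ \<Lambda>])
      have "inj_on (\<lambda>_::unit. (k, k)) {()}" by simp
      from linear_form_moment[OF p Q K _ this, of "\<lambda>_. 1"]
      show "(\<integral>\<^sup>+w. ennreal (\<phi> (w (k, k)) ^ (2 * p)) \<partial>iid J Q) \<le> ennreal (mz p K ^ p * 1 ^ (2 * p))"
        by (simp add: J_def)
    qed auto
    also have "... \<le> ennreal (quad_const p K / \<Lambda> ^ (2 * p))"
    proof (intro ennreal_leI divide_right_mono)
      have "1 * mz p K ^ p \<le> 4 ^ (2 * p) * (2 * mz p K ^ p + 2 * (mz p K ^ (2 * p) * 2 ^ p))"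
        using K by (intro mult_mono) (auto intro!: add_nonneg_nonneg add_increasing2)
      then show "mz p K ^ p \<le> quad_const p K" by (simp add: quad_const_def)
    qed (use \<Lambda> in auto)
    finally show "emeasure (iid J Q) ?L \<le> ennreal (quad_const p K / \<Lambda> ^ (2 * p))" .
  qed
qed

section \<open>The perturbed self-consistent equation\<close>

text \<open>
  The Schur complement at k equals - (z + s + \<Omega>), where s is the normalised trace and \<Omega> collects four
  errors: the diagonal entry, the fluctuation of the quadratic form, the deviation of the variance
  from 1, and the difference between the traces of the matrix and of the minor. The fluctuation is
  bounded with the Ward identity, which expresses the Hilbert-Schmidt norm by the imaginary part of
  the trace. The a priori bound on s keeps all the prefactors constant; the contributions
  1 + 3/2 + 9/4 + 1 add up to less than 6.
\<close>

lemma schur_error_bound: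
  fixes x :: "nat \<times> nat \<Rightarrow> 'x" and \<phi> :: "'x \<Rightarrow> real"
  defines "W \<equiv> \<lambda>N. scaled \<phi> N x"
  defines "s \<equiv> \<lambda>N z. (\<Sum>i<N. green {..<N} (W N) z i i) / of_nat N"
  assumes k: "k < N" and z: "Im z > 0"
    and diag: "\<bar>\<phi> (sym_ext x k k)\<bar> \<le> L"
    and quad: "cmod (quad_dev \<phi> \<sigma>2 N z k x) \<le> L * hs_norm \<phi> N z k x"
    and \<sigma>2: "\<bar>\<sigma>2 - 1\<bar> \<le> L / sqrt N"
    and s: "cmod (s N z) \<le> 5 / 4" and L: "L \<ge> 1"
    and \<delta>: "1 / sqrt N \<le> \<delta>" "1 / (N * Im z) \<le> \<delta>\<^sup>2" "\<delta> \<le> 1"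
  obtains \<Omega> where "cmod \<Omega> \<le> 6 * L * \<delta>" "green {..<N} (W N) z k k * (z + s N z + \<Omega>) = - 1"
proof -
  define S where "S = minor_set N k"
  define G where "G = green S (W N) z"
  define T where "T = (\<Sum>i\<in>S. G i i)"
  define Y where "Y = (\<Sum>i\<in>S. \<Sum>j\<in>S. G i j * of_real (\<phi> (sym_ext x k i) * \<phi> (sym_ext x k j)))"
  define h where "h = hs_norm \<phi> N z k x"
  have N: "N > 0" using k by simp
  have S: "finite S" "k \<notin> S" "insert k S = {..<N}" using k by (auto simp: S_def minor_set_def)
  have sym: "sym_kernel (W N)" unfolding W_def by (rule sym_kernel_scaled)
  have G: "is_green S (W N) z G" unfolding G_def by (rule green_is_green[OF S(1) sym z])
  have \<delta>0: "\<delta> > 0" using less_le_trans[of 0 "1 / sqrt N" \<delta>] \<delta>(1) N by simp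
  have \<delta>2: "\<delta>\<^sup>2 \<le> \<delta>" using \<delta>0 \<delta>(3) by (simp add: power2_eq_square mult_left_le_one_le)
  define d where "d = schur_den S (W N) z G k"
  have d0: "d \<noteq> 0" unfolding d_def by (rule schur_den_bound(2)[OF S(1) sym z G])
  have Gkk: "green {..<N} (W N) z k k = 1 / d"
    using green_diag_schur[OF S(1,2) sym z] by (simp add: S(3) d_def G_def)
  have "(\<Sum>i\<in>S. of_real (W N k i) * schur_vec S (W N) G k i) = Y / of_nat N"
  proof -
    have sq: "complex_of_real (sqrt N) * complex_of_real (sqrt N) = of_nat N"
      by (simp flip: of_real_mult)
    have "(\<Sum>i\<in>S. of_real (W N k i) * schur_vec S (W N) G k i)
      = (\<Sum>i\<in>S. \<Sum>j\<in>S. G i j * of_real (\<phi> (sym_ext x k i) * \<phi> (sym_ext x k j)) / of_nat N)"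
      unfolding schur_vec_def sum_distrib_left sq[symmetric]
      by (intro sum.cong refl) (simp add: W_def scaled_def sym_ext_def min.commute max.commute)
    then show ?thesis by (simp add: Y_def sum_divide_distrib)
  qed
  then have d: "d = of_real (W N k k) - z - Y / of_nat N" by (simp add: d_def schur_den_def)
  have qd: "quad_dev \<phi> \<sigma>2 N z k x = Y - of_real \<sigma>2 * T"
    by (simp add: quad_dev_def Let_def Y_def T_def G_def S_def W_def)
  define \<Omega> where "\<Omega> = - d - z - s N z"
  have \<Omega>: "\<Omega> = - of_real (W N k k) + quad_dev \<phi> \<sigma>2 N z k x / of_nat N
     + of_real (\<sigma>2 - 1) * (T / of_nat N) + (T / of_nat N - s N z)"
    by (simp add: \<Omega>_def d qd diff_divide_distrib algebra_simps)
  have Ts: "cmod (T / of_nat N - s N z) \<le> 1 / (N * Im z)"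
  proof -
    have "T / of_nat N - s N z = - ((\<Sum>i<N. green {..<N} (W N) z i i) - T) / of_nat N"
      by (simp add: s_def diff_divide_distrib)
    then have "cmod (T / of_nat N - s N z) = cmod ((\<Sum>i<N. green {..<N} (W N) z i i) - T) / N"
      by (simp add: norm_divide norm_minus_commute)
    also have "... \<le> (1 / Im z) / N"
      using green_trace_minor[OF S(1,2) sym z] unfolding S(3) by (intro divide_right_mono) (auto simp: T_def G_def)
    finally show ?thesis by (simp add: mult.commute)
  qed
  have TN: "cmod (T / of_nat N) \<le> 9 / 4"
  proof -
    have "cmod (T / of_nat N) \<le> cmod (s N z) + cmod (T / of_nat N - s N z)"
      by (metis add.commute diff_add_cancel norm_triangle_ineq)
    also have "... \<le> 5 / 4 + 1" using s Ts \<delta> \<delta>2 by linarith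
    finally show ?thesis by simp
  qed
  have hN: "h / N \<le> 3 / 2 * \<delta>"
  proof -
    have "h\<^sup>2 = (\<Sum>i\<in>S. \<Sum>j\<in>S. (cmod (G i j))\<^sup>2)"
      by (simp add: h_def hs_norm_def Let_def S_def G_def W_def sum_nonneg)
    also have "... = (\<Sum>j\<in>S. \<Sum>i\<in>S. (cmod (G i j))\<^sup>2)" by (rule sum.swap)
    also have "... = (\<Sum>j\<in>S. Im (G j j) / Im z)"
      unfolding G_def by (intro sum.cong refl green_ward[OF S(1) sym z])
    also have "... = Im T / Im z" by (simp add: T_def sum_divide_distrib)
    also have "... \<le> cmod T / Im z" using z abs_Im_le_cmod[of T] by (intro divide_right_mono) auto
    finally have "(h / N)\<^sup>2 \<le> (cmod T / Im z) / (real N)\<^sup>2" unfolding power_divide by (intro divide_right_mono) auto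
    also have "... = cmod (T / of_nat N) * (1 / (N * Im z))"
      by (simp add: norm_divide power2_eq_square)
    also have "... \<le> 9 / 4 * \<delta>\<^sup>2" using TN \<delta>(2) z by (intro mult_mono) auto
    also have "... = (3 / 2 * \<delta>)\<^sup>2" by (simp add: power2_eq_square)
    finally show ?thesis using \<delta>0 by (intro power2_le_imp_le[of "h / N"]) auto
  qed
  have "cmod \<Omega> \<le> L * \<delta> + L * (3 / 2 * \<delta>) + L * \<delta> * (9 / 4) + L * \<delta>"
    unfolding \<Omega>
  proof (intro order_trans[OF norm_triangle_ineq] add_mono)
    have Lt: "L * t \<le> L * \<delta>" if "t \<le> \<delta>" for t using that L by (intro mult_left_mono) auto
    have "cmod (- of_real (W N k k)) = \<bar>\<phi> (sym_ext x k k)\<bar> * (1 / sqrt N)"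
      by (simp add: W_def scaled_def norm_divide)
    also have "... \<le> L * \<delta>" using diag L \<delta>(1) by (intro mult_mono) auto
    finally show "cmod (- of_real (W N k k)) \<le> L * \<delta>" .
    have "cmod (quad_dev \<phi> \<sigma>2 N z k x / of_nat N) \<le> L * h / N"
      unfolding norm_divide using quad by (auto simp: h_def intro: divide_right_mono)
    also have "... \<le> L * (3 / 2 * \<delta>)" using hN L mult_left_mono[of "h / N" "3 / 2 * \<delta>" L] by simp
    finally show "cmod (quad_dev \<phi> \<sigma>2 N z k x / of_nat N) \<le> L * (3 / 2 * \<delta>)" .
    have "\<bar>\<sigma>2 - 1\<bar> \<le> L * \<delta>" using \<sigma>2 Lt[OF \<delta>(1)] by simp
    then show "cmod (of_real (\<sigma>2 - 1) * (T / of_nat N)) \<le> L * \<delta> * (9 / 4)"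
      unfolding norm_mult norm_of_real using TN L \<delta>0 by (intro mult_mono) auto
    have "\<delta> \<le> L * \<delta>" using L \<delta>0 by simp
    then show "cmod (T / of_nat N - s N z) \<le> L * \<delta>" using Ts \<delta>(2) \<delta>2 by linarith
  qed
  also have "... \<le> 6 * L * \<delta>" using mult_pos_pos[of L \<delta>] L \<delta>0 by simp
  finally have "cmod \<Omega> \<le> 6 * L * \<delta>" .
  moreover have "green {..<N} (W N) z k k * (z + s N z + \<Omega>) = - 1"
    using d0 by (simp add: Gkk \<Omega>_def)
  ultimately show ?thesis using that by blast
qed

text \<open>
  Each relation gives g_k (z + s) + 1 = - g_k \<Omega>_k; averaging over k produces the quadratic polynomial
  in s. Since |z + s| is at least 3/4 and |\<Omega>_k| is at most 1/4, every |g_k| is at most 2.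
\<close>

lemma self_consistent_equation:
  fixes g \<Omega> :: "nat \<Rightarrow> complex"
  assumes N: "N > 0" and s: "s = (\<Sum>k<N. g k) / of_nat N"
    and g: "\<And>k. k < N \<Longrightarrow> g k * (z + s + \<Omega> k) = - 1"
    and \<Omega>: "\<And>k. k < N \<Longrightarrow> cmod (\<Omega> k) \<le> \<omega>" and \<omega>: "\<omega> \<le> 1 / 4"
    and zs: "cmod (z + s) \<ge> 3 / 4"
  shows "cmod (s\<^sup>2 + z * s + 1) \<le> 2 * \<omega>"
proof -
  have gb: "cmod (g k) \<le> 2" if "k < N" for k
  proof -
    have "cmod (z + s) \<le> cmod (z + s + \<Omega> k) + cmod (\<Omega> k)"
      by (metis add_diff_cancel_right' norm_triangle_ineq4)
    then have "1 / 2 \<le> cmod (z + s + \<Omega> k)" using zs \<Omega>[OF that] \<omega> by linarith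
    then have "cmod (g k) * (1 / 2) \<le> cmod (g k) * cmod (z + s + \<Omega> k)" by (intro mult_left_mono) auto
    also have "... = 1" using g[OF that] by (metis norm_minus_cancel norm_mult norm_one)
    finally show ?thesis by simp
  qed
  have "(\<Sum>k<N. g k * (z + s) + 1) = (\<Sum>k<N. - (g k * \<Omega> k))"
  proof (intro sum.cong refl)
    fix k assume "k \<in> {..<N}"
    then have "g k * (z + s + \<Omega> k) + 1 - g k * \<Omega> k = - (g k * \<Omega> k)" using g[of k] by simp
    then show "g k * (z + s) + 1 = - (g k * \<Omega> k)" by (simp add: algebra_simps)
  qed
  moreover have "(\<Sum>k<N. g k) = of_nat N * s" using N by (simp add: s)
  ultimately have "of_nat N * (s\<^sup>2 + z * s + 1) = - (\<Sum>k<N. g k * \<Omega> k)"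
    by (simp add: sum.distrib sum_negf flip: sum_distrib_right) (simp add: algebra_simps power2_eq_square)
  from arg_cong[OF this, of cmod] have "N * cmod (s\<^sup>2 + z * s + 1) = cmod (\<Sum>k<N. g k * \<Omega> k)"
    by (simp add: norm_mult)
  also have "... \<le> (\<Sum>k<N. 2 * \<omega>)"
    unfolding sum_distrib_left
    by (rule order_trans[OF norm_sum], intro sum_mono)
       (auto simp: norm_mult intro!: mult_mono gb \<Omega>)
  also have "... = N * (2 * \<omega>)" by simp
  finally show ?thesis using N by simp
qed

section \<open>The Stieltjes transform of the semicircle law\<close>

lemma Im_of_reciprocal:
  fixes a b :: complex
  assumes "a * b = 1"
  shows "Im b = - Im a / (cmod a)\<^sup>2"
proof -
  have "b = inverse a" using assms by (simp add: inverse_unique)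
  then show ?thesis by (simp add: cmod_power2)
qed

text \<open>
  The Stieltjes transform of the semicircle law: the root of m^2 + z m + 1 in the upper half plane.
  The other root is - z - m, because the roots add up to - z.
\<close>

definition msc :: "complex \<Rightarrow> complex" where
  "msc z = (SOME m. m\<^sup>2 + z * m + 1 = 0 \<and> Im m > 0)"

text \<open>
  The roots are reciprocal to each other, so their imaginary parts have opposite signs or both vanish.
  As they add up to - Im z, they cannot both vanish, and one of the roots lies in the upper half plane.
\<close>

lemma
  assumes z: "Im z > 0"
  shows msc_eq: "(msc z)\<^sup>2 + z * msc z + 1 = 0" and Im_msc: "Im (msc z) > 0"
proof -
  define w where "w = csqrt (z\<^sup>2 - 4)"
  define m m' where "m = (- z + w) / 2" and "m' = (- z - w) / 2"
  have w: "w\<^sup>2 = z\<^sup>2 - 4" by (simp add: w_def)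
  have e: "m\<^sup>2 + z * m + 1 = 0" "m'\<^sup>2 + z * m' + 1 = 0"
  proof -
    have "m\<^sup>2 + z * m + 1 = (w\<^sup>2 - (z\<^sup>2 - 4)) / 4" "m'\<^sup>2 + z * m' + 1 = (w\<^sup>2 - (z\<^sup>2 - 4)) / 4"
      by (auto simp: m_def m'_def field_simps power2_eq_square)
    then show "m\<^sup>2 + z * m + 1 = 0" "m'\<^sup>2 + z * m' + 1 = 0" by (simp_all add: w)
  qed
  have "m * m' = (z\<^sup>2 - w\<^sup>2) / 4" by (simp add: m_def m'_def field_simps power2_eq_square)
  then have "m * m' = 1" using w by simp
  then have Im': "Im m' = - Im m / (cmod m)\<^sup>2" and m: "m \<noteq> 0" by (auto simp: Im_of_reciprocal)
  have sum: "Im m + Im m' = - Im z" by (simp add: m_def m'_def field_simps)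
  have "Im m > 0 \<or> Im m' > 0"
  proof (rule ccontr)
    assume "\<not> ?thesis"
    then have a: "Im m \<le> 0" "Im m' \<le> 0" by auto
    have "0 \<le> - Im m / (cmod m)\<^sup>2" using a by (intro divide_nonneg_nonneg) auto
    with a Im' have "Im m' = 0" by linarith
    then have "Im m = 0" using Im' m by simp
    with \<open>Im m' = 0\<close> sum z show False by simp
  qed
  with e have "\<exists>m. m\<^sup>2 + z * m + 1 = 0 \<and> Im m > 0" by blast
  from someI_ex[OF this] show "(msc z)\<^sup>2 + z * msc z + 1 = 0" "Im (msc z) > 0"
    unfolding msc_def by auto
qed

lemma msc_mult: "Im z > 0 \<Longrightarrow> msc z * (- z - msc z) = 1"
proof -
  assume "Im z > 0"
  then have "1 - ((msc z)\<^sup>2 + z * msc z + 1) = 1" by (simp add: msc_eq)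
  then show ?thesis by (simp add: algebra_simps power2_eq_square)
qed

text \<open>
  The two roots are reciprocal to each other, and the imaginary part of - z - m has modulus
  Im m + Im z, which exceeds Im m. Hence m is the root inside the unit disc.
\<close>

lemma msc_bounds:
  assumes z: "Im z > 0"
  shows "cmod (msc z) \<le> 1" "cmod (msc z) \<le> 1 / Im z" "1 \<le> cmod (z + msc z)" "Im z \<le> cmod (z + msc z)"
proof -
  define m where "m = msc z"
  have Im: "Im m > 0" using Im_msc[OF z] by (simp add: m_def)
  have mm: "m * (- z - m) = 1" using msc_mult[OF z] by (simp add: m_def)
  from arg_cong[OF this, of cmod] have "cmod m * cmod (- z - m) = 1" by (simp add: norm_mult)
  moreover have "cmod (- z - m) = cmod (z + m)" using norm_minus_cancel[of "z + m"] by simp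
  ultimately have p: "cmod m * cmod (z + m) = 1" by simp
  have m0: "m \<noteq> 0" using mm by auto
  have "Im z \<le> \<bar>Im (z + m)\<bar>" using Im z by simp
  then show a: "Im z \<le> cmod (z + msc z)" using abs_Im_le_cmod[of "z + m"] by (simp add: m_def)
  have "cmod m * Im z \<le> 1" using mult_left_mono[OF a[folded m_def], of "cmod m"] p by simp
  then show "cmod (msc z) \<le> 1 / Im z" using z by (simp add: m_def field_simps)
  from Im_of_reciprocal[OF mm] have "- Im z - Im m = - Im m / (cmod m)\<^sup>2" by simp
  then have "Im m / (cmod m)\<^sup>2 = Im m + Im z" by simp
  then have "Im m = (Im m + Im z) * (cmod m)\<^sup>2" using m0 by (simp add: field_simps)
  moreover have "Im m * (cmod m)\<^sup>2 \<le> (Im m + Im z) * (cmod m)\<^sup>2" using z by (intro mult_right_mono) auto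
  ultimately have "Im m * (cmod m)\<^sup>2 \<le> Im m * 1" by simp
  then have "(cmod m)\<^sup>2 \<le> 1" using Im by (simp only: mult_le_cancel_left_pos)
  then have 1: "cmod m \<le> 1" by (simp add: power2_le_iff_abs_le power_le_one_iff abs_square_le_1)
  then show "cmod (msc z) \<le> 1" by (simp add: m_def)
  have "1 * cmod (z + m) \<ge> cmod m * cmod (z + m)" using 1 by (intro mult_right_mono) auto
  then show "1 \<le> cmod (z + msc z)" using p by (simp add: m_def)
qed

lemma msc_lipschitz:
  assumes z: "Im z > 0" and z': "Im z' > 0"
  shows "cmod (msc z - msc z') \<le> cmod (z - z') / Im z"
proof -
  define m m' where "m = msc z" and "m' = msc z'"
  have e: "m\<^sup>2 + z * m + 1 = 0" "m'\<^sup>2 + z' * m' + 1 = 0" using msc_eq[OF z] msc_eq[OF z'] by (auto simp: m_def m'_def)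
  have "(m - m') * (m + m' + z) = (m\<^sup>2 + z * m + 1) - (m'\<^sup>2 + z' * m' + 1) - (z - z') * m'"
    by (simp add: algebra_simps power2_eq_square)
  then have "(m - m') * (m + m' + z) = - ((z - z') * m')" unfolding e by simp
  from arg_cong[OF this, of cmod] have "cmod (m - m') * cmod (m + m' + z) = cmod (z - z') * cmod m'"
    by (simp add: norm_mult)
  also have "... \<le> cmod (z - z') * 1" using msc_bounds(1)[OF z'] by (intro mult_left_mono) (auto simp: m'_def)
  finally have 1: "cmod (m - m') * cmod (m + m' + z) \<le> cmod (z - z')" by simp
  have "Im z \<le> \<bar>Im (m + m' + z)\<bar>" using Im_msc[OF z] Im_msc[OF z'] z by (simp add: m_def m'_def)
  also have "... \<le> cmod (m + m' + z)" by (rule abs_Im_le_cmod)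
  finally have "cmod (m - m') * Im z \<le> cmod (m - m') * cmod (m + m' + z)" by (intro mult_left_mono) auto
  with 1 show ?thesis using z by (simp add: m_def m'_def field_simps)
qed

text \<open>
  The distance between the two roots m and - z - m.
\<close>

definition root_gap :: "complex \<Rightarrow> real" where "root_gap z = cmod (2 * msc z + z)"

lemma root_gap_sq: "Im z > 0 \<Longrightarrow> (root_gap z)\<^sup>2 = cmod (z - 2) * cmod (z + 2)"
proof -
  assume z: "Im z > 0"
  have "(2 * msc z + z)\<^sup>2 = (z - 2) * (z + 2)"
  proof -
    have "(2 * msc z + z)\<^sup>2 = 4 * ((msc z)\<^sup>2 + z * msc z + 1) + (z - 2) * (z + 2)"
      by (simp add: power2_eq_square algebra_simps)
    then show ?thesis by (simp add: msc_eq[OF z])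
  qed
  from arg_cong[OF this, of cmod] show ?thesis unfolding root_gap_def by (simp add: norm_mult norm_power)
qed

text \<open>
  The square of the gap is |z - 2| |z + 2|, and both factors increase with the distance to the real
  axis. So the roots only approach each other on the way down.
\<close>

lemma root_gap_mono:
  assumes "0 < b" "b \<le> a"
  shows "root_gap (Complex E b) \<le> root_gap (Complex E a)"
proof -
  have "cmod (Complex E b + of_real c) \<le> cmod (Complex E a + of_real c)" for c
    using assms by (simp add: cmod_def power_mono)
  from this[of 2] this[of "-2"]
  have "(root_gap (Complex E b))\<^sup>2 \<le> (root_gap (Complex E a))\<^sup>2"
    using assms by (simp add: root_gap_sq mult_mono)
  then show ?thesis by (rule power2_le_imp_le) (simp add: root_gap_def)
qed

section \<open>Bootstrapping from large to small imaginary part\<close>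

text \<open>
  The quadratic polynomial is the product of the distances to its two roots up to sign, so one of
  these distances is at most the square root of the error. This loss of a square root is responsible
  for the exponent 1/4 in the final rate.
\<close>

lemma near_one_root:
  assumes z: "Im z > 0" and q: "cmod (s\<^sup>2 + z * s + 1) \<le> \<beta>\<^sup>2" and \<beta>: "\<beta> > 0"
  shows "cmod (s - msc z) \<le> \<beta> \<or> cmod (s - (- z - msc z)) \<le> \<beta>"
proof (rule ccontr)
  assume "\<not> ?thesis"
  then have "\<beta> * \<beta> < cmod (s - msc z) * cmod (s - (- z - msc z))"
    using \<beta> by (intro mult_strict_mono) auto
  also have "... = cmod ((s - msc z) * (s - (- z - msc z)))" by (simp add: norm_mult)
  also have "(s - msc z) * (s - (- z - msc z)) = s\<^sup>2 + z * s + msc z * (- z - msc z)"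
    by (simp add: algebra_simps power2_eq_square)
  finally show False using q msc_mult[OF z] by (simp add: power2_eq_square)
qed

text \<open>
  The dichotomy above does not tell which of the two roots is approximated. At height 8 both s and m
  are small while the other root is large, which settles the question. On the way down, in steps so
  small that s and m move by at most \<beta>/2 altogether, s stays near m as long as the roots are more than
  4 \<beta> apart. Once they are closer than that they stay closer, and then being near the other root also
  means being within 5 \<beta> of m. The error 5 \<beta> + \<beta>/2 remains below 1/4, so the a priori assumption under
  which the equation was derived holds again at the next step.
\<close>

lemma bootstrap_down:
  fixes s :: "complex \<Rightarrow> complex" and \<eta> :: "nat \<Rightarrow> real"
  assumes J: "J > 0" and \<eta>1: "0 < \<eta>1" "\<eta>1 \<le> 8"
    and \<eta>: "\<And>j. \<eta> j = 8 - real j / real J * (8 - \<eta>1)"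
    and bd: "\<And>z. Im z > 0 \<Longrightarrow> cmod (s z) \<le> 1 / Im z"
    and lip: "\<And>z z'. Im z > 0 \<Longrightarrow> Im z' > 0 \<Longrightarrow> cmod (s z - s z') \<le> cmod (z - z') / (Im z * Im z')"
    and sce: "\<And>j. j \<le> J \<Longrightarrow> cmod (s (Complex E (\<eta> j)) - msc (Complex E (\<eta> j))) \<le> 1 / 4 \<Longrightarrow>
       cmod ((s (Complex E (\<eta> j)))\<^sup>2 + Complex E (\<eta> j) * s (Complex E (\<eta> j)) + 1) \<le> \<beta>\<^sup>2"
    and \<beta>: "0 < \<beta>" "\<beta> \<le> 1 / 40" and step: "8 / J / \<eta>1\<^sup>2 + 8 / J / \<eta>1 \<le> \<beta> / 2"
  shows "cmod (s (Complex E \<eta>1) - msc (Complex E \<eta>1)) \<le> 5 * \<beta>"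
proof -
  define z where "z j = Complex E (\<eta> j)" for j
  define err where "err j = cmod (s (z j) - msc (z j))" for j
  have \<eta>ge: "\<eta>1 \<le> \<eta> j" if "j \<le> J" for j
  proof -
    have "real j / real J * (8 - \<eta>1) \<le> 1 * (8 - \<eta>1)" using that J \<eta>1 by (intro mult_right_mono) auto
    then show ?thesis by (simp add: \<eta>)
  qed
  have pos: "Im (z j) > 0" if "j \<le> J" for j using \<eta>ge[OF that] \<eta>1 by (simp add: z_def)
  have other: "root_gap (z j) \<le> cmod (s (z j) - (- z j - msc (z j))) + err j" for j
  proof -
    have "2 * msc (z j) + z j = (s (z j) - (- z j - msc (z j))) - (s (z j) - msc (z j))" by simp
    then show ?thesis unfolding root_gap_def err_def by (metis norm_triangle_ineq4)
  qed
  have main: "err j \<le> 5 * \<beta> \<and> (root_gap (z j) > 4 * \<beta> \<longrightarrow> err j \<le> \<beta>)" if "j \<le> J" for j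
    using that
  proof (induction j)
    case 0
    have z0: "Im (z 0) = 8" by (simp add: z_def \<eta>)
    have e0: "err 0 \<le> 1 / 4"
      using bd[of "z 0"] msc_bounds(2)[of "z 0"] norm_triangle_ineq4[of "s (z 0)" "msc (z 0)"] z0
      by (simp add: err_def)
    have q: "cmod ((s (z 0))\<^sup>2 + z 0 * s (z 0) + 1) \<le> \<beta>\<^sup>2"
      using sce[of 0] e0 by (simp add: z_def err_def)
    have "cmod (s (z 0) - (- z 0 - msc (z 0))) > \<beta>"
    proof -
      have "8 \<le> cmod (z 0 + msc (z 0))" using msc_bounds(4)[of "z 0"] z0 by simp
      also have "... \<le> cmod (s (z 0) - (- z 0 - msc (z 0))) + cmod (s (z 0))"
        using norm_triangle_ineq4[of "s (z 0) - (- z 0 - msc (z 0))" "s (z 0)"] by simp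
      finally show ?thesis using bd[of "z 0"] z0 \<beta> by simp
    qed
    then have "err 0 \<le> \<beta>" using near_one_root[OF _ q \<beta>(1)] z0 by (auto simp: err_def)
    then show ?case using \<beta> by auto
  next
    case (Suc j)
    then have j: "j \<le> J" and IH: "err j \<le> 5 * \<beta>" "root_gap (z j) > 4 * \<beta> \<Longrightarrow> err j \<le> \<beta>" by auto
    note p = pos[OF j] pos[OF Suc.prems]
    note g = \<eta>ge[OF j] \<eta>ge[OF Suc.prems]
    have diff: "\<eta> j - \<eta> (Suc j) = (8 - \<eta>1) / J" using J by (simp add: \<eta> field_simps)
    have le: "\<eta> (Suc j) \<le> \<eta> j" 
    proof -
      have "0 \<le> (8 - \<eta>1) / real J" using \<eta>1 by simp
      with diff show ?thesis by linarith
    qed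
    have dz: "cmod (z (Suc j) - z j) \<le> 8 / J"
    proof -
      have "z (Suc j) - z j = Complex 0 (- ((8 - \<eta>1) / J))" using diff by (simp add: z_def complex_eq_iff)
      then have "cmod (z (Suc j) - z j) = (8 - \<eta>1) / J" using \<eta>1 by (simp add: cmod_def)
      also have "... \<le> 8 / J" using \<eta>1 by (intro divide_right_mono) auto
      finally show ?thesis .
    qed
    have d1: "cmod (s (z (Suc j)) - s (z j)) \<le> 8 / J / \<eta>1\<^sup>2"
    proof -
      have "cmod (s (z (Suc j)) - s (z j)) \<le> cmod (z (Suc j) - z j) / (Im (z (Suc j)) * Im (z j))"
        by (rule lip[OF p(2) p(1)])
      also have "... \<le> (8 / J) / (\<eta>1 * \<eta>1)"
        using dz g \<eta>1 by (intro frac_le mult_mono) (auto simp: z_def)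
      finally show ?thesis by (simp add: power2_eq_square)
    qed
    have d2: "cmod (msc (z (Suc j)) - msc (z j)) \<le> 8 / J / \<eta>1"
    proof -
      have "cmod (msc (z (Suc j)) - msc (z j)) \<le> cmod (z (Suc j) - z j) / Im (z (Suc j))"
        by (rule msc_lipschitz[OF p(2) p(1)])
      also have "... \<le> (8 / J) / \<eta>1" using dz g \<eta>1 by (intro frac_le) (auto simp: z_def)
      finally show ?thesis .
    qed
    have move: "err (Suc j) \<le> err j + \<beta> / 2"
    proof -
      have "s (z (Suc j)) - msc (z (Suc j)) = (s (z j) - msc (z j)) + (s (z (Suc j)) - s (z j)) - (msc (z (Suc j)) - msc (z j))"
        by simp
      then have "err (Suc j) \<le> err j + cmod (s (z (Suc j)) - s (z j)) + cmod (msc (z (Suc j)) - msc (z j))"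
        unfolding err_def by (metis norm_triangle_ineq norm_triangle_ineq4 add_right_mono order_trans)
      then show ?thesis using d1 d2 step by linarith
    qed
    \<comment> \<open>The a priori bound 1/4 at the new height: the old error 5 \<beta> plus one step.\<close>
    have q: "cmod ((s (z (Suc j)))\<^sup>2 + z (Suc j) * s (z (Suc j)) + 1) \<le> \<beta>\<^sup>2"
      using sce[OF Suc.prems] move IH(1) \<beta> by (simp add: z_def err_def)
    have gap: "root_gap (z (Suc j)) \<le> root_gap (z j)"
      unfolding z_def using le g \<eta>1 by (intro root_gap_mono) auto
    from near_one_root[OF p(2) q \<beta>(1)] show ?case
    proof
      assume "cmod (s (z (Suc j)) - msc (z (Suc j))) \<le> \<beta>"
      then show ?thesis using \<beta> by (simp add: err_def)
    next
      assume o: "cmod (s (z (Suc j)) - (- z (Suc j) - msc (z (Suc j)))) \<le> \<beta>"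
      have "\<not> root_gap (z (Suc j)) > 4 * \<beta>"
      proof
        assume a: "root_gap (z (Suc j)) > 4 * \<beta>"
        then have "err j \<le> \<beta>" using IH(2) gap by linarith
        then show False using move other[of "Suc j"] o a \<beta> by linarith
      qed
      moreover have "err (Suc j) \<le> root_gap (z (Suc j)) + \<beta>"
      proof -
        have "s (z (Suc j)) - msc (z (Suc j)) = (s (z (Suc j)) - (- z (Suc j) - msc (z (Suc j)))) - (2 * msc (z (Suc j)) + z (Suc j))"
          by simp
        then have "err (Suc j) \<le> cmod (s (z (Suc j)) - (- z (Suc j) - msc (z (Suc j)))) + root_gap (z (Suc j))"
          unfolding err_def root_gap_def by (metis norm_triangle_ineq4)
        then show ?thesis using o by linarith
      qed
      ultimately show ?thesis by auto
    qed
  qed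
  have "\<eta> J = \<eta>1" using J by (simp add: \<eta>)
  then show ?thesis using main[of J] by (simp add: err_def z_def)
qed

text \<open>
  Up to the error \<eta>, 2 pi times the two quantities are the imaginary parts of square roots of z^2 - 4
  and of E^2 - 4. These numbers differ by O(\<eta>), so the square roots differ by O(sqrt \<eta>) up to the
  sign, and the sign is determined because both imaginary parts are nonnegative.
\<close>

lemma Im_msc_near_semicircle:
  assumes \<eta>: "0 < \<eta>" "\<eta> \<le> 1"
  shows "\<bar>1 / pi * Im (msc (Complex E \<eta>)) - semicircle_density E\<bar> \<le> (sqrt (2 * \<bar>E\<bar> + 1) + 1) * sqrt \<eta>"
proof -
  define z where "z = Complex E \<eta>"
  define w where "w = 2 * msc z + z"
  \<comment> \<open>A square root of E^2 - 4 with nonnegative imaginary part.\<close>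
  define w0 where "w0 = (if E\<^sup>2 \<le> 4 then Complex 0 (sqrt (4 - E\<^sup>2)) else of_real (sqrt (E\<^sup>2 - 4)))"
  have z: "Im z > 0" using \<eta> by (simp add: z_def)
  have w: "w\<^sup>2 = z\<^sup>2 - 4"
  proof -
    have "w\<^sup>2 = 4 * ((msc z)\<^sup>2 + z * msc z + 1) + (z\<^sup>2 - 4)"
      unfolding w_def by (simp add: power2_eq_square algebra_simps)
    then show ?thesis by (simp add: msc_eq[OF z])
  qed
  have Imw: "Im w = 2 * Im (msc z) + \<eta>" by (simp add: w_def z_def)
  have w0: "w0\<^sup>2 = of_real (E\<^sup>2 - 4)" and Imw0: "Im w0 = sqrt (max 0 (4 - E\<^sup>2))"
    by (auto simp: w0_def complex_eq_iff power2_eq_square max_def)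
  have Im0: "Im w > 0" "Im w0 \<ge> 0" using Im_msc[OF z] \<eta> by (auto simp: Imw Imw0)
  define K where "K = sqrt (\<eta> * (2 * \<bar>E\<bar> + 1))"
  have "(w - w0) * (w + w0) = w\<^sup>2 - w0\<^sup>2" by (simp add: algebra_simps power2_eq_square)
  also have "... = z\<^sup>2 - of_real (E\<^sup>2)" unfolding w w0 by simp
  also have "z\<^sup>2 - of_real (E\<^sup>2) = \<i> * of_real \<eta> * (2 * of_real E + \<i> * of_real \<eta>)"
    by (simp add: z_def complex_eq_iff power2_eq_square)
  finally have "cmod (w - w0) * cmod (w + w0) = \<eta> * cmod (2 * of_real E + \<i> * of_real \<eta>)"
    using \<eta> by (simp flip: norm_mult) (simp add: norm_mult)
  also have "cmod (2 * of_real E + \<i> * of_real \<eta>) \<le> 2 * \<bar>E\<bar> + 1"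
    using norm_triangle_ineq[of "2 * of_real E" "\<i> * of_real \<eta>"] \<eta> by (simp add: norm_mult)
  finally have prod: "cmod (w - w0) * cmod (w + w0) \<le> K * K" using \<eta> by (simp add: K_def mult_left_mono)
  have K0: "K \<ge> 0" using \<eta> by (simp add: K_def)
  have "cmod (w - w0) \<le> K \<or> cmod (w + w0) \<le> K"
  proof (rule ccontr)
    assume "\<not> ?thesis"
    then have "K * K < cmod (w - w0) * cmod (w + w0)" using K0 by (intro mult_strict_mono') auto
    with prod show False by simp
  qed
  then have 1: "\<bar>Im w - Im w0\<bar> \<le> K"
    using abs_Im_le_cmod[of "w - w0"] abs_Im_le_cmod[of "w + w0"] Im0 by auto
  have "1 / pi * Im (msc z) - semicircle_density E = (Im w - Im w0 - \<eta>) / (2 * pi)"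
    by (simp add: Imw Imw0 semicircle_density_def field_simps)
  also have "\<bar>...\<bar> = \<bar>Im w - Im w0 - \<eta>\<bar> / (2 * pi)" by (simp add: abs_divide)
  also have "... \<le> (K + \<eta>) / 1"
    using 1 \<eta> K0 pi_ge_two by (intro frac_le) auto
  also have "K + \<eta> \<le> K + sqrt \<eta>"
  proof -
    have "\<eta>\<^sup>2 \<le> \<eta>" using \<eta> by (simp add: power2_eq_square mult_left_le_one_le)
    then show ?thesis using real_le_rsqrt by auto
  qed
  also have "K + sqrt \<eta> = (sqrt (2 * \<bar>E\<bar> + 1) + 1) * sqrt \<eta>"
    unfolding K_def real_sqrt_mult by (simp add: algebra_simps)
  finally show ?thesis by (simp add: z_def)
qed

section \<open>The law on an interval of energies\<close>

definition avg_green :: "nat \<Rightarrow> (nat \<Rightarrow> nat \<Rightarrow> real) \<Rightarrow> complex \<Rightarrow> complex" where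
  "avg_green N W z = (\<Sum>i<N. green {..<N} W z i i) / of_nat N"

lemma avg_green_bound:
  assumes "sym_kernel W" "Im z > 0" "N > 0"
  shows "cmod (avg_green N W z) \<le> 1 / Im z"
proof -
  have "cmod (\<Sum>i<N. green {..<N} W z i i) \<le> (\<Sum>i<N. 1 / Im z)"
    using assms by (intro order_trans[OF norm_sum] sum_mono green_diag_norm(2)) auto
  then show ?thesis using assms by (simp add: avg_green_def norm_divide field_simps)
qed

lemma avg_green_lipschitz:
  assumes "sym_kernel W" "Im z > 0" "Im z' > 0" "N > 0"
  shows "cmod (avg_green N W z - avg_green N W z') \<le> cmod (z - z') / (Im z * Im z')"
proof -
  let ?c = "cmod (z - z') / (Im z * Im z')"
  have "avg_green N W z - avg_green N W z' = (\<Sum>i<N. green {..<N} W z i i - green {..<N} W z' i i) / of_nat N"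
    by (simp add: avg_green_def sum_subtractf diff_divide_distrib)
  then have "cmod (avg_green N W z - avg_green N W z') = cmod (\<Sum>i<N. green {..<N} W z i i - green {..<N} W z' i i) / N"
    by (simp add: norm_divide)
  also have "... \<le> (\<Sum>i<N. ?c) / N"
    using assms by (intro divide_right_mono order_trans[OF norm_sum] sum_mono green_lipschitz) auto
  also have "... = ?c" using assms(4) by simp
  finally show ?thesis .
qed

lemma avg_green_rank_one:
  fixes N :: nat
  assumes "sym_kernel W" "Im z > 0" "N > 0"
  shows "cmod (avg_green N (\<lambda>i j. W i j + c) z - avg_green N W z) \<le> 1 / (N * Im z)"
proof -
  have "cmod (avg_green N (\<lambda>i j. W i j + c) z - avg_green N W z)
     = cmod ((\<Sum>i<N. green {..<N} (\<lambda>i j. W i j + c) z i i) - (\<Sum>i<N. green {..<N} W z i i)) / N"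
    by (simp add: avg_green_def norm_divide flip: diff_divide_distrib)
  also have "... \<le> (1 / Im z) / N"
    using assms by (intro divide_right_mono green_trace_rank_one) auto
  finally show ?thesis by (simp add: mult.commute)
qed

text \<open>
  The heights descend from 8 to \<eta> in J equal steps.
\<close>

definition eta_grid :: "nat \<Rightarrow> real \<Rightarrow> nat \<Rightarrow> real" where
  "eta_grid J \<eta> j = 8 - real j / real J * (8 - \<eta>)"

lemma eta_grid_ge:
  assumes "j \<le> J" "\<eta> \<le> 8" "0 < J"
  shows "\<eta> \<le> eta_grid J \<eta> j"
proof -
  have "real j / real J * (8 - \<eta>) \<le> 1 * (8 - \<eta>)" using assms by (intro mult_right_mono) auto
  then show ?thesis by (simp add: eta_grid_def)
qed

text \<open>
  The two random events behind the Schur complement estimate: all diagonal entries are of size L, and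
  all quadratic forms deviate by at most L times their natural scale.
\<close>

definition good_config :: "(real \<Rightarrow> real) \<Rightarrow> real \<Rightarrow> nat \<Rightarrow> real \<Rightarrow> complex \<Rightarrow> (nat \<times> nat \<Rightarrow> real) \<Rightarrow> bool" where
  "good_config \<phi> \<sigma>2 N L z x \<longleftrightarrow> (\<forall>k<N. \<bar>\<phi> (sym_ext x k k)\<bar> \<le> L \<and>
      cmod (quad_dev \<phi> \<sigma>2 N z k x) \<le> L * hs_norm \<phi> N z k x)"

text \<open>
  On good configurations the errors \<Omega>_k are at most 6 L \<delta>, so the quadratic polynomial at s is at most
  12 L \<delta>. The bootstrap therefore runs with \<beta> = sqrt (12 L \<delta>), and the bound 1/1600 ensures
  \<beta> \<le> 1/40.
\<close>

lemma law_at_energy: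
  fixes N J :: nat and L \<eta> \<delta> \<sigma>2 :: real
  assumes N: "N > 0" and J: "J > 0" and \<eta>: "0 < \<eta>" "\<eta> \<le> 1" and L: "L \<ge> 1"
    and \<sigma>2: "\<bar>\<sigma>2 - 1\<bar> \<le> L / sqrt N"
    and \<delta>: "0 < \<delta>" "1 / sqrt N \<le> \<delta>" "1 / (N * \<eta>) \<le> \<delta>\<^sup>2" and small: "12 * L * \<delta> \<le> 1 / 1600"
    and step: "8 / J / \<eta>\<^sup>2 + 8 / J / \<eta> \<le> sqrt (12 * L * \<delta>) / 2"
    and good: "\<And>j. j \<le> J \<Longrightarrow> good_config \<phi> \<sigma>2 N L (Complex E (eta_grid J \<eta> j)) x"
  shows "cmod (avg_green N (scaled \<phi> N x) (Complex E \<eta>) - msc (Complex E \<eta>)) \<le> 5 * sqrt (12 * L * \<delta>)"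
proof -
  let ?\<beta> = "sqrt (12 * L * \<delta>)"
  let ?s = "avg_green N (scaled \<phi> N x)"
  have Ld: "L * \<delta> > 0" using L \<delta> by simp
  have "?\<beta> \<le> sqrt ((1 / 40)\<^sup>2)" using small by (intro real_sqrt_le_mono) (simp add: power2_eq_square)
  then have \<beta>: "0 < ?\<beta>" "?\<beta> \<le> 1 / 40" using Ld by auto
  have \<beta>2: "?\<beta>\<^sup>2 = 12 * L * \<delta>" using Ld by simp
  have "\<delta> \<le> L * \<delta>" using L \<delta> by simp
  then have \<delta>1: "\<delta> \<le> 1" using small by linarith
  show ?thesis
  proof (rule bootstrap_down[where \<beta> = ?\<beta> and J = J and \<eta> = "eta_grid J \<eta>"])
    fix j assume j: "j \<le> J"
    define z where "z = Complex E (eta_grid J \<eta> j)"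
    assume "cmod (?s (Complex E (eta_grid J \<eta> j)) - msc (Complex E (eta_grid J \<eta> j))) \<le> 1 / 4"
    then have near: "cmod (?s z - msc z) \<le> 1 / 4" by (simp add: z_def)
    have Imz: "\<eta> \<le> Im z" using eta_grid_ge[OF j _ J] \<eta> by (simp add: z_def)
    then have z: "Im z > 0" using \<eta> by simp
    have s: "cmod (?s z) \<le> 5 / 4"
      using near msc_bounds(1)[OF z] norm_triangle_ineq[of "?s z - msc z" "msc z"] by simp
    have zs: "3 / 4 \<le> cmod (z + ?s z)"
      using near msc_bounds(3)[OF z] norm_triangle_ineq4[of "z + ?s z" "?s z - msc z"] by simp
    have "1 / (N * Im z) \<le> 1 / (N * \<eta>)" using N \<eta> Imz by (intro divide_left_mono mult_left_mono) auto
    then have \<delta>z: "1 / (N * Im z) \<le> \<delta>\<^sup>2" using \<delta>(3) by linarith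
    have "\<exists>\<Omega>. cmod \<Omega> \<le> 6 * L * \<delta> \<and> green {..<N} (scaled \<phi> N x) z k k * (z + ?s z + \<Omega>) = - 1" if "k < N" for k
      using good[OF j] that schur_error_bound[OF that z _ _ \<sigma>2 _ L \<delta>(2) \<delta>z \<delta>1, of \<phi> x] s
      by (auto simp: good_config_def z_def[symmetric] avg_green_def)
    then obtain \<Omega> where \<Omega>: "\<And>k. k < N \<Longrightarrow> cmod (\<Omega> k) \<le> 6 * L * \<delta>"
      "\<And>k. k < N \<Longrightarrow> green {..<N} (scaled \<phi> N x) z k k * (z + ?s z + \<Omega> k) = - 1" by metis
    have "cmod ((?s z)\<^sup>2 + z * ?s z + 1) \<le> 2 * (6 * L * \<delta>)"
      by (rule self_consistent_equation[OF N avg_green_def \<Omega>(2) \<Omega>(1) _ zs]) (use small in auto)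
    then show "cmod ((?s (Complex E (eta_grid J \<eta> j)))\<^sup>2 + Complex E (eta_grid J \<eta> j) * ?s (Complex E (eta_grid J \<eta> j)) + 1) \<le> ?\<beta>\<^sup>2"
      unfolding \<beta>2 by (simp add: z_def)
  qed (use \<eta> \<beta> J N step in \<open>auto simp: eta_grid_def intro!: avg_green_bound avg_green_lipschitz sym_kernel_scaled\<close>)
qed

lemma semicircle_density_holder:
  "\<bar>semicircle_density E - semicircle_density E'\<bar> \<le> sqrt (\<bar>E - E'\<bar> * (\<bar>E\<bar> + \<bar>E'\<bar>))"
proof -
  define u v where "u = max 0 (4 - E\<^sup>2)" and "v = max 0 (4 - E'\<^sup>2)"
  have sq: "\<bar>sqrt a - sqrt b\<bar> \<le> sqrt \<bar>a - b\<bar>" if "a \<ge> 0" "b \<ge> 0" for a b :: real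
  proof -
    have *: "sqrt a - sqrt b \<le> sqrt \<bar>a - b\<bar>" if "a \<ge> 0" "b \<ge> 0" for a b :: real
    proof -
      have "sqrt a \<le> sqrt (b + \<bar>a - b\<bar>)" by (intro real_sqrt_le_mono) simp
      also have "... \<le> sqrt b + sqrt \<bar>a - b\<bar>" using that by (intro sqrt_add_le_add_sqrt) auto
      finally show ?thesis by simp
    qed
    show ?thesis using *[OF that] *[OF that(2,1)] by (simp add: abs_le_iff abs_minus_commute)
  qed
  have "\<bar>u - v\<bar> \<le> \<bar>E\<^sup>2 - E'\<^sup>2\<bar>" by (auto simp: u_def v_def max_def)
  also have "... = \<bar>E - E'\<bar> * \<bar>E + E'\<bar>" by (simp add: power2_eq_square square_diff_square_factored abs_mult mult.commute)
  also have "... \<le> \<bar>E - E'\<bar> * (\<bar>E\<bar> + \<bar>E'\<bar>)" by (intro mult_left_mono) auto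
  finally have uv: "\<bar>u - v\<bar> \<le> \<bar>E - E'\<bar> * (\<bar>E\<bar> + \<bar>E'\<bar>)" .
  have "\<bar>semicircle_density E - semicircle_density E'\<bar> = \<bar>sqrt u - sqrt v\<bar> / (2 * pi)"
    by (simp add: semicircle_density_def u_def v_def abs_divide flip: diff_divide_distrib)
  also have "... \<le> \<bar>sqrt u - sqrt v\<bar> / 1" using pi_ge_two by (intro divide_left_mono) auto
  also have "... \<le> sqrt \<bar>u - v\<bar>" using sq[of u v] by (simp add: u_def v_def)
  also have "... \<le> sqrt (\<bar>E - E'\<bar> * (\<bar>E\<bar> + \<bar>E'\<bar>))" using uv by (rule real_sqrt_le_mono)
  finally show ?thesis .
qed

definition energy_grid :: "nat \<Rightarrow> real \<Rightarrow> nat \<Rightarrow> real" where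
  "energy_grid J a i = - a + real i / real J * (2 * a)"

lemma energy_grid_dense:
  assumes J: "J > 0" and a: "a > 0" and E: "E \<in> {-a..a}"
  obtains i where "i \<le> J" "\<bar>E - energy_grid J a i\<bar> \<le> 2 * a / J" "\<bar>energy_grid J a i\<bar> \<le> a"
proof -
  define u where "u = (E + a) / (2 * a) * J"
  have "0 \<le> (E + a) / (2 * a)" "(E + a) / (2 * a) \<le> 1" using E a by auto
  then have u: "0 \<le> u" "u \<le> J"
    unfolding u_def using mult_right_mono[of "(E + a) / (2 * a)" 1 "real J"]
      mult_nonneg_nonneg[of "(E + a) / (2 * a)" "real J"] by auto
  \<comment> \<open>The grid point to the left of E.\<close>
  define i where "i = nat \<lfloor>u\<rfloor>"
  have i: "real i \<le> u" "u \<le> real i + 1" using u(1) by (auto simp: i_def)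
  have iJ: "i \<le> J" using i(1) u(2) by linarith
  have E_eq: "E - energy_grid J a i = (u - i) * (2 * a / J)"
    using a J by (simp add: energy_grid_def u_def field_simps)
  have "\<bar>E - energy_grid J a i\<bar> = \<bar>u - i\<bar> * (2 * a / J)"
    unfolding E_eq abs_mult using a by simp
  also have "... \<le> 1 * (2 * a / J)" using i a by (intro mult_right_mono) auto
  finally have 1: "\<bar>E - energy_grid J a i\<bar> \<le> 2 * a / J" by simp
  have "real i / J \<le> 1" using iJ J by simp
  then have "0 \<le> real i / J * (2 * a)" "real i / J * (2 * a) \<le> 1 * (2 * a)"
    using a by (simp, intro mult_right_mono) auto
  then have "\<bar>energy_grid J a i\<bar> \<le> a" by (simp add: energy_grid_def abs_le_iff)
  with 1 iJ show ?thesis using that by blast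
qed

abbreviation density_dev :: "nat \<Rightarrow> (nat \<Rightarrow> nat \<Rightarrow> real) \<Rightarrow> real \<Rightarrow> real \<Rightarrow> real" where
  "density_dev N W \<eta> E \<equiv> \<bar>1 / pi * Im (avg_green N W (Complex E \<eta>)) - semicircle_density E\<bar>"

text \<open>
  In this order: the error at a grid point, the rank-one shift, the distance to the nearest grid point
  for the trace, the regularisation of the density, and the distance to the nearest grid point for the
  density. The first of them is b.
\<close>

abbreviation law_error :: "nat \<Rightarrow> nat \<Rightarrow> real \<Rightarrow> real \<Rightarrow> real \<Rightarrow> real" where
  "law_error N J a \<eta> b \<equiv> b + 1 / (real N * \<eta>) + 2 * a / real J / \<eta>\<^sup>2 + (sqrt (2 * a + 1) + 1) * sqrt \<eta> + sqrt (2 * a / real J * (2 * a))"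

text \<open>
  Outside the grid both the trace and the semicircle density are controlled by their moduli of
  continuity. Passing from W to W + c costs 1 / (N \<eta>) by the rank-one bound.
\<close>

lemma law_uniform_in_energy:
  fixes N J :: nat and a \<eta> b :: real
  assumes W: "sym_kernel W" and N: "N > 0" and J: "J > 0" and a: "a > 0" and \<eta>: "0 < \<eta>" "\<eta> \<le> 1"
    and grid: "\<And>i. i \<le> J \<Longrightarrow> cmod (avg_green N W (Complex (energy_grid J a i) \<eta>) - msc (Complex (energy_grid J a i) \<eta>)) \<le> b"
    and E: "E \<in> {-a..a}"
  shows "density_dev N (\<lambda>i j. W i j + c) \<eta> E
    \<le> law_error N J a \<eta> b"
proof -
  obtain i where i: "i \<le> J" "\<bar>E - energy_grid J a i\<bar> \<le> 2 * a / J" "\<bar>energy_grid J a i\<bar> \<le> a"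
    by (rule energy_grid_dense[OF J a E])
  define E' where "E' = energy_grid J a i"
  define z z' where "z = Complex E \<eta>" and "z' = Complex E' \<eta>"
  define s where "s = avg_green N (\<lambda>i j. W i j + c)"
  have Im: "Im z = \<eta>" "Im z' = \<eta>" by (auto simp: z_def z'_def)
  have W': "sym_kernel (\<lambda>i j. W i j + c)" using W by (simp add: sym_kernel_def)
  have zz: "cmod (z - z') = \<bar>E - E'\<bar>" by (simp add: z_def z'_def cmod_def)
  have "cmod (s z - s z') \<le> cmod (z - z') / (Im z * Im z')"
    unfolding s_def using \<eta> N by (intro avg_green_lipschitz W') (auto simp: Im)
  also have "... \<le> (2 * a / J) / \<eta>\<^sup>2"
    unfolding zz Im power2_eq_square using i(2) \<eta> by (intro divide_right_mono) (auto simp: E'_def)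
  finally have 1: "cmod (s z - s z') \<le> 2 * a / J / \<eta>\<^sup>2" .
  have 2: "cmod (s z' - avg_green N W z') \<le> 1 / (N * \<eta>)"
    using avg_green_rank_one[OF W _ N, of z' c] \<eta> by (simp add: s_def Im)
  have 3: "cmod (avg_green N W z' - msc z') \<le> b" using grid[OF i(1)] by (simp add: z'_def E'_def)
  have "s z - msc z' = (s z - s z') + (s z' - avg_green N W z') + (avg_green N W z' - msc z')" by simp
  then have "cmod (s z - msc z') \<le> 2 * a / J / \<eta>\<^sup>2 + 1 / (N * \<eta>) + b"
    using 1 2 3 by (metis (no_types, lifting) add_mono norm_triangle_mono)
  then have "\<bar>Im (s z - msc z')\<bar> \<le> 2 * a / J / \<eta>\<^sup>2 + 1 / (N * \<eta>) + b"
    using abs_Im_le_cmod order_trans by blast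
  moreover have "\<bar>1 / pi * (Im (s z) - Im (msc z'))\<bar> \<le> 1 * \<bar>Im (s z - msc z')\<bar>"
    unfolding abs_mult using pi_ge_two by (intro mult_mono) (auto simp: divide_simps)
  ultimately have 4: "\<bar>1 / pi * Im (s z) - 1 / pi * Im (msc z')\<bar> \<le> 2 * a / J / \<eta>\<^sup>2 + 1 / (N * \<eta>) + b"
    by (simp add: right_diff_distrib)
  have "\<bar>1 / pi * Im (msc z') - semicircle_density E'\<bar> \<le> (sqrt (2 * \<bar>E'\<bar> + 1) + 1) * sqrt \<eta>"
    unfolding z'_def by (rule Im_msc_near_semicircle[OF \<eta>])
  also have "... \<le> (sqrt (2 * a + 1) + 1) * sqrt \<eta>"
    using i(3) \<eta> by (intro mult_right_mono add_right_mono real_sqrt_le_mono) (auto simp: E'_def)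
  finally have 5: "\<bar>1 / pi * Im (msc z') - semicircle_density E'\<bar> \<le> (sqrt (2 * a + 1) + 1) * sqrt \<eta>" .
  have "\<bar>semicircle_density E - semicircle_density E'\<bar> \<le> sqrt (\<bar>E - E'\<bar> * (\<bar>E\<bar> + \<bar>E'\<bar>))"
    by (rule semicircle_density_holder)
  also have "... \<le> sqrt (2 * a / J * (2 * a))"
    using i E a by (intro real_sqrt_le_mono mult_mono) (auto simp: E'_def)
  finally have 6: "\<bar>semicircle_density E - semicircle_density E'\<bar> \<le> sqrt (2 * a / J * (2 * a))" .
  show ?thesis using 4 5 6 unfolding z_def[symmetric] s_def[symmetric] by linarith
qed

section \<open>The probability of bad configurations\<close>

definition good_on_grid :: "(real \<Rightarrow> real) \<Rightarrow> real \<Rightarrow> nat \<Rightarrow> real \<Rightarrow> nat \<Rightarrow> real \<Rightarrow> real \<Rightarrow> (nat \<times> nat \<Rightarrow> real) \<Rightarrow> bool" where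
  "good_on_grid \<phi> \<sigma>2 N L J a \<eta> x \<longleftrightarrow>
     (\<forall>i\<le>J. \<forall>j\<le>J. good_config \<phi> \<sigma>2 N L (Complex (energy_grid J a i) (eta_grid J \<eta> j)) x)"

text \<open>
  A union bound over the grid points and the rows. The number of events is polynomial in N, which is
  harmless because every single probability decays faster than any power of N.
\<close>

lemma bad_config_prob:
  fixes \<phi> :: "real \<Rightarrow> real" and N :: nat
  assumes p: "p \<ge> 1" and Q: "centred_moments Q \<phi> p K" and Q2: "centred_moments Q (\<lambda>y. (\<phi> y)\<^sup>2 - \<sigma>2) p K"
    and K: "K \<ge> 0" and L: "L > 0" and J: "J > 0" and \<eta>: "0 < \<eta>" "\<eta> \<le> 1"
  defines "P \<equiv> iid (pairs N) Q"
  obtains B where "B \<in> sets P" "\<And>x. x \<in> space P - B \<Longrightarrow> good_on_grid \<phi> \<sigma>2 N L J a \<eta> x"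
    "emeasure P B \<le> ennreal (2 * N * (real J + 1)\<^sup>2 * (quad_const p K / L ^ (2 * p)))"
proof -
  define z where "z ij = Complex (energy_grid J a (fst ij)) (eta_grid J \<eta> (snd ij))" for ij :: "nat \<times> nat"
  define D where "D k = {x \<in> space P. \<bar>\<phi> (sym_ext x k k)\<bar> > L}" for k
  define F where "F ij k = {x \<in> space P. cmod (quad_dev \<phi> \<sigma>2 N (z ij) k x) > L * hs_norm \<phi> N (z ij) k x}" for ij k
  define I where "I = ({..J} \<times> {..J}) \<times> {..<N}"
  define B where "B = (\<Union>(ij, k)\<in>I. D k \<union> F ij k)"
  define h where "h = quad_const p K / L ^ (2 * p)"
  have h0: "h \<ge> 0" using K L by (auto simp: h_def quad_const_def intro!: divide_nonneg_nonneg mult_nonneg_nonneg add_nonneg_nonneg)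
  have zpos: "Im (z ij) > 0" if "(ij, k) \<in> I" for ij k
    using eta_grid_ge[of "snd ij" J \<eta>] that J \<eta> by (auto simp: z_def I_def)
  have D: "D k \<in> sets P" "emeasure P (D k) \<le> ennreal h" if "(ij, k) \<in> I" for ij k
    using diagonal_entry_prob[OF p Q K L, of k N] that unfolding D_def P_def h_def by (auto simp: I_def)
  have F: "F ij k \<in> sets P" "emeasure P (F ij k) \<le> ennreal h" if "(ij, k) \<in> I" for ij k
    using quad_dev_prob[OF p Q Q2 K L _ zpos[OF that], of k N] that unfolding F_def P_def h_def by (auto simp: I_def)
  have DF: "D k \<union> F ij k \<in> sets P" if "(ij, k) \<in> I" for ij k using D F that by auto
  have fI: "finite I" by (simp add: I_def)
  show ?thesis
  proof (rule that)
    show "B \<in> sets P" unfolding B_def using fI DF by (intro sets.finite_UN) auto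
    fix x assume x: "x \<in> space P - B"
    show "good_on_grid \<phi> \<sigma>2 N L J a \<eta> x"
      unfolding good_on_grid_def good_config_def
    proof (intro allI impI)
      fix i j k assume "i \<le> J" "j \<le> J" "k < N"
      then have "((i, j), k) \<in> I" by (simp add: I_def)
      then have "x \<notin> D k \<union> F (i, j) k" using x unfolding B_def by blast
      then show "\<bar>\<phi> (sym_ext x k k)\<bar> \<le> L \<and> cmod (quad_dev \<phi> \<sigma>2 N (Complex (energy_grid J a i) (eta_grid J \<eta> j)) k x)
            \<le> L * hs_norm \<phi> N (Complex (energy_grid J a i) (eta_grid J \<eta> j)) k x"
        using x by (auto simp: D_def F_def z_def not_less)
    qed
  next
    have "emeasure P B \<le> (\<Sum>q\<in>I. emeasure P (case q of (ij, k) \<Rightarrow> D k \<union> F ij k))"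
      unfolding B_def using fI DF by (intro emeasure_subadditive_finite) auto
    also have "... \<le> (\<Sum>q\<in>I. ennreal (2 * h))"
    proof (intro sum_mono)
      fix q assume "q \<in> I"
      obtain ij k where q: "q = (ij, k)" by (cases q)
      have "emeasure P (D k \<union> F ij k) \<le> emeasure P (D k) + emeasure P (F ij k)"
        using D F \<open>q \<in> I\<close> by (intro emeasure_subadditive) (auto simp: q)
      also have "... \<le> ennreal h + ennreal h" using D F \<open>q \<in> I\<close> by (intro add_mono) (auto simp: q)
      also have "... = ennreal (2 * h)" using h0 by (simp flip: ennreal_plus)
      finally show "emeasure P (case q of (ij, k) \<Rightarrow> D k \<union> F ij k) \<le> ennreal (2 * h)" by (simp add: q)
    qed
    also have "... = ennreal (real (card I) * (2 * h))"
      using h0 by (simp add: ennreal_mult ennreal_of_nat_eq_real_of_nat)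
    also have "real (card I) * (2 * h) = 2 * N * (real J + 1)\<^sup>2 * h"
      by (simp add: I_def card_cartesian_product power2_eq_square algebra_simps)
    finally show "emeasure P B \<le> ennreal (2 * N * (real J + 1)\<^sup>2 * (quad_const p K / L ^ (2 * p)))" by (simp add: h_def)
  qed
qed

section \<open>Integration over the mixing parameter\<close>

text \<open>
  By definition of the weak topology, preimages of open sets under integration against a bounded
  continuous function are open.
\<close>

lemma measurable_integral_weak_borel:
  fixes f :: "real \<Rightarrow> real"
  assumes "continuous_on UNIV f" "bounded (range f)"
  shows "(\<lambda>Q. \<integral>x. f x \<partial>Q) \<in> borel_measurable weak_borel"
proof (rule borel_measurableI)
  fix U :: "real set" assume "open U"
  then have "openin weak_topology {Q \<in> prob_measures. (\<integral>x. f x \<partial>Q) \<in> U}"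
    unfolding weak_topology_def using assms by (intro topology_generated_by_Basis) blast
  then have "{Q \<in> prob_measures. (\<integral>x. f x \<partial>Q) \<in> U} \<in> sets weak_borel"
    unfolding sets_weak_borel by (intro sigma_sets.Basic) simp
  also have "{Q \<in> prob_measures. (\<integral>x. f x \<partial>Q) \<in> U} = (\<lambda>Q. \<integral>x. f x \<partial>Q) -` U \<inter> space weak_borel"
    by (auto simp: space_weak_borel)
  finally show "(\<lambda>Q. \<integral>x. f x \<partial>Q) -` U \<inter> space weak_borel \<in> sets weak_borel" .
qed

text \<open>
  The powers are not bounded, so their integrals are limits of the integrals of truncations.
\<close>

lemma measurable_moment:
  assumes P: "P \<in> T \<rightarrow>\<^sub>M weak_borel"
    and int: "\<And>t. t \<in> space T \<Longrightarrow> integrable (P t) (\<lambda>x. x ^ l)"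
  shows "(\<lambda>t. moment l (P t)) \<in> borel_measurable T"
proof -
  define f where "f n x = max (- real n) (min (real n) (x ^ l))" for n and x :: real
  have "(\<lambda>t. \<integral>x. f n x \<partial>P t) \<in> borel_measurable T" for n
  proof -
    have "continuous_on UNIV (f n)" unfolding f_def by (intro continuous_intros)
    moreover have "bounded (range (f n))"
      by (rule boundedI[of _ "real n"]) (auto simp: f_def)
    ultimately show ?thesis
      using measurable_compose[OF P measurable_integral_weak_borel] by blast
  qed
  then show ?thesis
  proof (rule borel_measurable_LIMSEQ_real[rotated])
    fix t assume t: "t \<in> space T"
    have Pt: "sets (P t) = sets borel" using measurable_space[OF P t] by (simp add: space_weak_borel)
    have [measurable_cong]: "sets (P t) = sets borel" by (rule Pt)
    have lim: "(\<lambda>n. f n x) \<longlonglongrightarrow> x ^ l" for x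
    proof (rule tendsto_eventually)
      obtain m where m: "\<bar>x ^ l\<bar> \<le> real m" using real_arch_simple by blast
      show "eventually (\<lambda>n. f n x = x ^ l) sequentially"
        using eventually_ge_at_top[of m] by eventually_elim (use m in \<open>auto simp: f_def\<close>)
    qed
    show "(\<lambda>n. \<integral>x. f n x \<partial>P t) \<longlonglongrightarrow> moment l (P t)"
      unfolding moment_def
    proof (rule integral_dominated_convergence[where w = "\<lambda>x. \<bar>x ^ l\<bar>"])
      show "(\<lambda>x. x ^ l) \<in> borel_measurable (P t)" by measurable
      show "f n \<in> borel_measurable (P t)" for n unfolding f_def by measurable
      show "integrable (P t) (\<lambda>x. \<bar>x ^ l\<bar>)" using int[OF t] by simp
      show "AE x in P t. (\<lambda>n. f n x) \<longlonglongrightarrow> x ^ l" using lim by simp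
      show "AE x in P t. norm (f n x) \<le> \<bar>x ^ l\<bar>" for n by (intro AE_I2) (auto simp: f_def)
    qed
  qed
qed

lemma
  fixes Q :: "real measure"
  assumes Q: "prob_space Q" "sets Q = sets borel" and q: "q > 0" "even q"
    and b: "(\<integral>\<^sup>+y. ennreal (\<bar>y - m\<bar> ^ q) \<partial>Q) \<le> ennreal K" and K: "K \<ge> 0"
  shows integrable_of_nn_moment: "integrable Q (\<lambda>y. (y - m) ^ q)"
    and integral_of_nn_moment: "(\<integral>y. (y - m) ^ q \<partial>Q) \<le> K"
proof -
  have [measurable_cong]: "sets Q = sets borel" by fact
  have e: "\<bar>y - m\<bar> ^ q = (y - m) ^ q" for y using q by (simp add: power_even_abs)
  show i: "integrable Q (\<lambda>y. (y - m) ^ q)"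
  proof (rule integrableI_bounded)
    show "(\<integral>\<^sup>+y. ennreal (norm ((y - m) ^ q)) \<partial>Q) < \<infinity>"
      using b by (simp add: power_abs e order_le_less_trans)
  qed measurable
  have "ennreal (\<integral>y. (y - m) ^ q \<partial>Q) = (\<integral>\<^sup>+y. ennreal ((y - m) ^ q) \<partial>Q)"
    using q by (intro nn_integral_eq_integral[symmetric] i) (auto simp: zero_le_even_power)
  also have "... \<le> ennreal K" using b by (simp add: e)
  finally show "(\<integral>y. (y - m) ^ q \<partial>Q) \<le> K" using K by simp
qed

text \<open>
  The bounds for \<phi>^2 - \<sigma>2 follow from those for the powers of \<phi>: its second moment is the fourth
  moment of \<phi> minus \<sigma>2^2, and its moment of order 2p is at most 4^p times the sum of the moment of \<phi>
  of order 4p and \<sigma>2^(2p).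
\<close>

lemma centred_moments_of_moment_bounds:
  fixes Q :: "real measure" and Kf :: "nat \<Rightarrow> real"
  assumes Q: "prob_space Q" "sets Q = sets borel" and p: "p \<ge> 1"
    and Kf: "\<And>q. q > 0 \<Longrightarrow> even q \<Longrightarrow> 0 \<le> Kf q"
    and b: "\<And>q. q > 0 \<Longrightarrow> even q \<Longrightarrow> (\<integral>\<^sup>+y. ennreal (\<bar>y - moment 1 Q\<bar> ^ q) \<partial>Q) \<le> ennreal (Kf q)"
  defines "\<phi> \<equiv> \<lambda>y. y - moment 1 Q" and "\<sigma>2 \<equiv> moment 2 Q - (moment 1 Q)\<^sup>2"
    and "K \<equiv> Kf 2 + Kf (2 * p) + Kf 4 + 4 ^ p * (Kf (4 * p) + Kf 2 ^ (2 * p))"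
  shows "centred_moments Q \<phi> p K" "centred_moments Q (\<lambda>y. (\<phi> y)\<^sup>2 - \<sigma>2) p K" "K \<ge> 0"
    "integrable Q (\<lambda>y. y ^ 1)" "integrable Q (\<lambda>y. y ^ 2)"
proof -
  interpret prob_space Q by fact
  have [measurable_cong]: "sets Q = sets borel" by fact
  have \<phi>m[measurable]: "\<phi> \<in> borel_measurable Q" unfolding \<phi>_def by measurable
  have i: "integrable Q (\<lambda>y. \<phi> y ^ q)" and le: "(\<integral>y. \<phi> y ^ q \<partial>Q) \<le> Kf q" if "q > 0" "even q" for q
    unfolding \<phi>_def using integrable_of_nn_moment[OF Q that b[OF that] Kf[OF that]]
      integral_of_nn_moment[OF Q that b[OF that] Kf[OF that]] .
  have i1: "integrable Q \<phi>"
    using integrable_lower_power[OF Q(1) \<phi>m, of 1 1] i[of 2] by simp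
  have i2: "integrable Q (\<lambda>y. (\<phi> y)\<^sup>2)" using i[of 2] by simp
  have iy: "integrable Q (\<lambda>y. y)" using Bochner_Integration.integrable_add[OF i1 integrable_const[of "moment 1 Q"]] by (simp add: \<phi>_def)
  then show "integrable Q (\<lambda>y. y ^ 1)" by simp
  have iy2: "integrable Q (\<lambda>y. y\<^sup>2)"
  proof -
    have "integrable Q (\<lambda>y. (\<phi> y)\<^sup>2 + 2 * moment 1 Q * y - (moment 1 Q)\<^sup>2)" using i2 iy by simp
    also have "(\<lambda>y. (\<phi> y)\<^sup>2 + 2 * moment 1 Q * y - (moment 1 Q)\<^sup>2) = (\<lambda>y. y\<^sup>2)"
      by (simp add: \<phi>_def fun_eq_iff power2_eq_square algebra_simps)
    finally show ?thesis .
  qed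
  then show "integrable Q (\<lambda>y. y ^ 2)" by simp
  have m1: "(\<integral>y. \<phi> y \<partial>Q) = 0" using iy by (simp add: \<phi>_def moment_def prob_space)
  have var: "(\<integral>y. (\<phi> y)\<^sup>2 \<partial>Q) = \<sigma>2"
  proof -
    have "(\<integral>y. (\<phi> y)\<^sup>2 \<partial>Q) = (\<integral>y. y\<^sup>2 - 2 * moment 1 Q * y + (moment 1 Q)\<^sup>2 \<partial>Q)"
      by (simp add: \<phi>_def power2_eq_square algebra_simps)
    also have "... = \<sigma>2" using iy iy2
      by (simp add: prob_space \<sigma>2_def) (simp add: moment_def power2_eq_square)
    finally show ?thesis .
  qed
  have \<sigma>: "0 \<le> \<sigma>2" "\<sigma>2 \<le> Kf 2" using le[of 2] unfolding var[symmetric] by auto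
  have K0: "0 \<le> Kf 2" "0 \<le> Kf (2 * p)" "0 \<le> Kf 4" "0 \<le> 4 ^ p * (Kf (4 * p) + Kf 2 ^ (2 * p))"
    using Kf p by (auto intro!: mult_nonneg_nonneg add_nonneg_nonneg)
  show "K \<ge> 0" using K0 by (simp add: K_def)
  have p2: "2 * p > 0" "even (2 * p)" "4 * p > 0" "even (4 * p)" using p by auto
  show "centred_moments Q \<phi> p K"
    unfolding centred_moments_def
    using Q(1) i[OF p2(1,2)] m1 le[of 2] le[OF p2(1,2)] K0 by (auto simp: K_def)
  have x4: "(\<integral>y. ((\<phi> y)\<^sup>2 - \<sigma>2)\<^sup>2 \<partial>Q) \<le> Kf 4"
  proof -
    have i4: "integrable Q (\<lambda>y. \<phi> y ^ 4)" using i[of 4] by simp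
    have "(\<integral>y. ((\<phi> y)\<^sup>2 - \<sigma>2)\<^sup>2 \<partial>Q) = (\<integral>y. \<phi> y ^ 4 - 2 * \<sigma>2 * (\<phi> y)\<^sup>2 + \<sigma>2\<^sup>2 \<partial>Q)"
      by (intro Bochner_Integration.integral_cong refl) (simp add: power2_eq_square power4_eq_xxxx algebra_simps)
    also have "... = (\<integral>y. \<phi> y ^ 4 \<partial>Q) - 2 * \<sigma>2 * \<sigma>2 + \<sigma>2\<^sup>2" using i4 i2 by (simp add: prob_space var)
    also have "... \<le> Kf 4" 
    proof -
      have "(\<integral>y. \<phi> y ^ 4 \<partial>Q) \<le> Kf 4" by (rule le) auto
      then show ?thesis using zero_le_square[of \<sigma>2] unfolding power2_eq_square mult.assoc by linarith
    qed
    finally show ?thesis .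
  qed
  have bd: "((\<phi> y)\<^sup>2 - \<sigma>2) ^ (2 * p) \<le> 4 ^ p * (\<phi> y ^ (4 * p) + \<sigma>2 ^ (2 * p))" for y
  proof -
    define u where "u = max ((\<phi> y)\<^sup>2) \<sigma>2"
    have "\<bar>(\<phi> y)\<^sup>2 - \<sigma>2\<bar> \<le> 2 * u" using \<sigma>(1) zero_le_power2[of "\<phi> y"] unfolding u_def by linarith
    then have "\<bar>(\<phi> y)\<^sup>2 - \<sigma>2\<bar> ^ (2 * p) \<le> (2 * u) ^ (2 * p)" by (intro power_mono) auto
    also have "... = 4 ^ p * u ^ (2 * p)" by (simp add: power_mult_distrib power_mult)
    also have "u ^ (2 * p) \<le> ((\<phi> y)\<^sup>2) ^ (2 * p) + \<sigma>2 ^ (2 * p)" unfolding u_def using \<sigma>(1) by (auto simp: max_def)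
    also have "((\<phi> y)\<^sup>2) ^ (2 * p) = \<phi> y ^ (4 * p)" by (simp flip: power_mult)
    finally show ?thesis unfolding power_even_abs[OF p2(2)] by simp
  qed
  have ir: "integrable Q (\<lambda>y. 4 ^ p * (\<phi> y ^ (4 * p) + \<sigma>2 ^ (2 * p)))" using i[OF p2(3,4)] by simp
  have i2p: "integrable Q (\<lambda>y. ((\<phi> y)\<^sup>2 - \<sigma>2) ^ (2 * p))"
  proof (rule Bochner_Integration.integrable_bound[OF ir])
    show "AE y in Q. norm (((\<phi> y)\<^sup>2 - \<sigma>2) ^ (2 * p)) \<le> norm (4 ^ p * (\<phi> y ^ (4 * p) + \<sigma>2 ^ (2 * p)))"
      using bd p2 by (intro AE_I2) (auto simp: abs_of_nonneg zero_le_even_power intro: order_trans[OF bd] )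
  qed measurable
  have x2p: "(\<integral>y. ((\<phi> y)\<^sup>2 - \<sigma>2) ^ (2 * p) \<partial>Q) \<le> 4 ^ p * (Kf (4 * p) + Kf 2 ^ (2 * p))"
  proof -
    have "(\<integral>y. ((\<phi> y)\<^sup>2 - \<sigma>2) ^ (2 * p) \<partial>Q) \<le> (\<integral>y. 4 ^ p * (\<phi> y ^ (4 * p) + \<sigma>2 ^ (2 * p)) \<partial>Q)"
      by (intro integral_mono i2p ir bd)
    also have "... = 4 ^ p * ((\<integral>y. \<phi> y ^ (4 * p) \<partial>Q) + \<sigma>2 ^ (2 * p))"
      using i[OF p2(3,4)] by (simp add: prob_space)
    also have "... \<le> 4 ^ p * (Kf (4 * p) + Kf 2 ^ (2 * p))"
      using le[OF p2(3,4)] \<sigma> by (intro mult_left_mono add_mono power_mono) auto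
    finally show ?thesis .
  qed
  have "(\<integral>y. ((\<phi> y)\<^sup>2 - \<sigma>2) \<partial>Q) = 0" using i2 by (simp add: var prob_space)
  then show "centred_moments Q (\<lambda>y. (\<phi> y)\<^sup>2 - \<sigma>2) p K"
    unfolding centred_moments_def
    using Q(1) i2p x4 x2p K0 by (auto simp: K_def)
qed

text \<open>
  The local law conditionally on the mixing parameter, for entries that are independent with common
  law Q. The exceptional set depends on Q, but the bound for its probability does so only through the
  moment bounds, which are uniform in the mixing parameter.
\<close>

lemma law_for_iid_entries:
  fixes Q :: "real measure" and Kf :: "nat \<Rightarrow> real" and N J :: nat and L a \<eta> \<delta> :: real
  assumes Q: "prob_space Q" "sets Q = sets borel" and p: "p \<ge> 1"
    and Kf: "\<And>q. q > 0 \<Longrightarrow> even q \<Longrightarrow> 0 \<le> Kf q"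
    and b: "\<And>q. q > 0 \<Longrightarrow> even q \<Longrightarrow> (\<integral>\<^sup>+y. ennreal (\<bar>y - moment 1 Q\<bar> ^ q) \<partial>Q) \<le> ennreal (Kf q)"
    and N: "N > 0" and J: "J > 0" and \<eta>: "0 < \<eta>" "\<eta> \<le> 1" and a: "a > 0" and L: "L \<ge> 1"
    and \<sigma>2: "\<bar>moment 2 Q - (moment 1 Q)\<^sup>2 - 1\<bar> \<le> L / sqrt N"
    and \<delta>: "0 < \<delta>" "1 / sqrt N \<le> \<delta>" "1 / (N * \<eta>) \<le> \<delta>\<^sup>2" and small: "12 * L * \<delta> \<le> 1 / 1600"
    and step: "8 / J / \<eta>\<^sup>2 + 8 / J / \<eta> \<le> sqrt (12 * L * \<delta>) / 2"
  defines "K \<equiv> Kf 2 + Kf (2 * p) + Kf 4 + 4 ^ p * (Kf (4 * p) + Kf 2 ^ (2 * p))"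
    and "P \<equiv> iid (pairs N) Q"
  obtains B where "B \<in> sets P" "emeasure P B \<le> ennreal (2 * N * (real J + 1)\<^sup>2 * (quad_const p K / L ^ (2 * p)))"
    "\<And>x E. x \<in> space P - B \<Longrightarrow> E \<in> {-a..a} \<Longrightarrow>
      density_dev N (\<lambda>i j. sym_ext x i j / sqrt N) \<eta> E
      \<le> law_error N J a \<eta> (5 * sqrt (12 * L * \<delta>))"
proof -
  define \<phi> where "\<phi> y = y - moment 1 Q" for y
  define s2 where "s2 = moment 2 Q - (moment 1 Q)\<^sup>2"
  have L0: "L > 0" using L by simp
  have cm: "centred_moments Q \<phi> p K" "centred_moments Q (\<lambda>y. (\<phi> y)\<^sup>2 - s2) p K" and K: "K \<ge> 0"
    unfolding \<phi>_def s2_def K_def by (rule centred_moments_of_moment_bounds[OF Q p Kf b]; assumption)+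
  show ?thesis
  proof (rule bad_config_prob[OF p cm K L0 J \<eta>, where N = N and a = a, folded P_def])
    fix B assume B: "B \<in> sets P" and good: "\<And>x. x \<in> space P - B \<Longrightarrow> good_on_grid \<phi> s2 N L J a \<eta> x"
      and Bp: "emeasure P B \<le> ennreal (2 * N * (real J + 1)\<^sup>2 * (quad_const p K / L ^ (2 * p)))"
    show thesis
    proof (rule that[OF B Bp])
    fix x E assume x: "x \<in> space P - B" and E: "E \<in> {-a..a}"
    have "(\<lambda>i j. scaled \<phi> N x i j + moment 1 Q / sqrt N) = (\<lambda>i j. sym_ext x i j / sqrt N)"
      by (simp add: fun_eq_iff scaled_def \<phi>_def diff_divide_distrib)
    moreover have "density_dev N (\<lambda>i j. scaled \<phi> N x i j + moment 1 Q / sqrt N) \<eta> E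
      \<le> law_error N J a \<eta> (5 * sqrt (12 * L * \<delta>))"
    proof (rule law_uniform_in_energy[OF sym_kernel_scaled N J a \<eta> _ E])
      fix i assume "i \<le> J"
      then show "cmod (avg_green N (scaled \<phi> N x) (Complex (energy_grid J a i) \<eta>) - msc (Complex (energy_grid J a i) \<eta>)) \<le> 5 * sqrt (12 * L * \<delta>)"
        using good[OF x] \<sigma>2
        by (intro law_at_energy[OF N J \<eta> L _ \<delta> small step, of s2]) (auto simp: good_on_grid_def s2_def)
    qed
    ultimately show "density_dev N (\<lambda>i j. sym_ext x i j / sqrt N) \<eta> E
      \<le> law_error N J a \<eta> (5 * sqrt (12 * L * \<delta>))"
      by simp
    qed
  qed
qed

text \<open>
  The parameters t for which the conditional variance is not close to 1 are few: if it differs from 1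
  by more than L / sqrt N, then 1 - m2 or m1^2 exceeds L / (2 sqrt N), and Markov's inequality applies
  to the moments of these quantities. On the remaining parameters f is bounded by c.
\<close>

lemma mixture_bound:
  fixes T :: "'t measure" and P :: "'t \<Rightarrow> real measure" and f :: "'t \<Rightarrow> ennreal"
  assumes T: "prob_space T"
    and m1: "(\<lambda>t. moment 1 (P t)) \<in> borel_measurable T" and m2: "(\<lambda>t. moment 2 (P t)) \<in> borel_measurable T"
    and N: "N \<ge> (1::nat)" and L: "L > 0" and p: "p \<ge> 1" and K: "K \<ge> 0" "K' \<ge> 0"
    and b1: "(\<integral>\<^sup>+t. ennreal (\<bar>moment 1 (P t)\<bar> ^ (4 * p)) \<partial>T) \<le> ennreal (K' * real N powr (- real (4 * p) / 2))"
    and b2: "(\<integral>\<^sup>+t. ennreal (\<bar>1 - moment 2 (P t)\<bar> ^ (2 * p)) \<partial>T) \<le> ennreal (K * real N powr (- real (2 * p) / 2))"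
    and c: "c \<ge> 0"
    and f: "\<And>t. t \<in> space T \<Longrightarrow> \<bar>moment 2 (P t) - (moment 1 (P t))\<^sup>2 - 1\<bar> \<le> L / sqrt N \<Longrightarrow> f t \<le> ennreal c"
    and f1: "\<And>t. t \<in> space T \<Longrightarrow> f t \<le> 1"
  shows "(\<integral>\<^sup>+t. f t \<partial>T) \<le> ennreal (c + 4 ^ p * (K + K') / L ^ (2 * p))"
proof -
  interpret prob_space T by fact
  note [measurable] = m1 m2
  define r where "r = (2 * sqrt N / L) ^ (2 * p)"
  define u where "u t = \<bar>1 - moment 2 (P t)\<bar> ^ (2 * p)" for t
  define v where "v t = \<bar>moment 1 (P t)\<bar> ^ (4 * p)" for t
  have r: "r = 4 ^ p * real N ^ p / L ^ (2 * p)"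
    by (simp add: r_def power_divide power_mult_distrib power_mult)
  have r0: "r \<ge> 0" using L by (simp add: r)
  have uv: "u t \<ge> 0" "v t \<ge> 0" for t by (auto simp: u_def v_def)
  have [measurable]: "u \<in> borel_measurable T" "v \<in> borel_measurable T" unfolding u_def v_def by measurable
  have "(\<integral>\<^sup>+t. f t \<partial>T) \<le> (\<integral>\<^sup>+t. ennreal c + ennreal r * (ennreal (u t) + ennreal (v t)) \<partial>T)"
  proof (intro nn_integral_mono)
    fix t assume t: "t \<in> space T"
    show "f t \<le> ennreal c + ennreal r * (ennreal (u t) + ennreal (v t))"
    proof (cases "\<bar>moment 2 (P t) - (moment 1 (P t))\<^sup>2 - 1\<bar> \<le> L / sqrt N")
      case True
      from f[OF t this] show ?thesis by (rule order_trans) simp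
    next
      case False
      define q where "q = 2 * sqrt N / L"
      have q: "q > 0" using N L by (simp add: q_def)
      have Lq: "L / sqrt N = 2 / q" using N L by (simp add: q_def)
      have "1 / q < \<bar>1 - moment 2 (P t)\<bar> \<or> 1 / q < (moment 1 (P t))\<^sup>2"
      proof (rule ccontr)
        assume "\<not> ?thesis"
        moreover have "2 / q = 1 / q + 1 / q" by simp
        moreover have "0 \<le> (moment 1 (P t))\<^sup>2" by simp
        ultimately show False using False unfolding Lq by linarith
      qed
      then have "1 < q * \<bar>1 - moment 2 (P t)\<bar> \<or> 1 < q * (moment 1 (P t))\<^sup>2"
        using q by (auto simp: field_simps)
      then have "1 \<le> (q * \<bar>1 - moment 2 (P t)\<bar>) ^ (2 * p) \<or> 1 \<le> (q * (moment 1 (P t))\<^sup>2) ^ (2 * p)"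
        using one_le_power[of "q * \<bar>1 - moment 2 (P t)\<bar>" "2 * p"] one_le_power[of "q * (moment 1 (P t))\<^sup>2" "2 * p"] by linarith
      moreover have "(q * \<bar>1 - moment 2 (P t)\<bar>) ^ (2 * p) = r * u t"
        unfolding q_def[symmetric] r_def u_def power_mult_distrib ..
      moreover have "(q * (moment 1 (P t))\<^sup>2) ^ (2 * p) = r * v t"
      proof -
        have "((moment 1 (P t))\<^sup>2) ^ (2 * p) = \<bar>moment 1 (P t)\<bar> ^ (4 * p)"
          by (simp add: power_even_abs flip: power_mult)
        then show ?thesis unfolding q_def[symmetric] r_def v_def power_mult_distrib by simp
      qed
      ultimately have "1 \<le> r * (u t + v t)"
        using mult_nonneg_nonneg[OF r0 uv(1)[of t]] mult_nonneg_nonneg[OF r0 uv(2)[of t]] by (auto simp: distrib_left)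
      then have "1 \<le> ennreal (r * (u t + v t))" by simp
      also have "... = ennreal r * (ennreal (u t) + ennreal (v t))" using r0 uv by (simp add: ennreal_mult ennreal_plus)
      also have "... \<le> ennreal c + ..." by simp
      finally show ?thesis using f1[OF t] by (rule order_trans[rotated])
    qed
  qed
  also have "... = ennreal c + ennreal r * ((\<integral>\<^sup>+t. ennreal (u t) \<partial>T) + (\<integral>\<^sup>+t. ennreal (v t) \<partial>T))"
    by (simp add: nn_integral_add nn_integral_cmult emeasure_space_1)
  also have "... \<le> ennreal c + ennreal r * (ennreal (K * real N powr (- real (2 * p) / 2)) + ennreal (K' * real N powr (- real (4 * p) / 2)))"
    using b1 b2 unfolding u_def v_def by (intro add_mono mult_left_mono) auto
  also have "... = ennreal (c + r * (K * real N powr (- real (2 * p) / 2) + K' * real N powr (- real (4 * p) / 2)))"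
    using c r0 K by (simp add: ennreal_mult ennreal_plus)
  also have "... \<le> ennreal (c + 4 ^ p * (K + K') / L ^ (2 * p))"
  proof (intro ennreal_leI add_left_mono)
    have e1: "real N powr (- real (2 * p) / 2) = 1 / real N ^ p"
    proof -
      have "- real (2 * p) / 2 = - real p" by simp
      then show ?thesis using N by (simp only: powr_minus_divide) (simp add: powr_realpow)
    qed
    have e2: "real N powr (- real (4 * p) / 2) \<le> 1 / real N ^ p"
    proof -
      have "real N powr (- real (4 * p) / 2) \<le> real N powr (- real (2 * p) / 2)"
        using N by (intro powr_mono) auto
      then show ?thesis using e1 by simp
    qed
    have "r * (K * real N powr (- real (2 * p) / 2) + K' * real N powr (- real (4 * p) / 2))
       \<le> r * (K * (1 / real N ^ p) + K' * (1 / real N ^ p))"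
      unfolding e1 using e2 r0 K by (intro mult_left_mono add_mono) auto
    also have "... = 4 ^ p * (K + K') / L ^ (2 * p)"
      using N L by (simp add: r field_simps)
    finally show "r * (K * real N powr (- real (2 * p) / 2) + K' * real N powr (- real (4 * p) / 2)) \<le> 4 ^ p * (K + K') / L ^ (2 * p)" .
  qed
  finally show ?thesis .
qed

section \<open>Measurability of the supremum over the energies\<close>

text \<open>
  By continuity the supremum exceeds a level if and only if the function does so at a point of a
  countable dense set.
\<close>

lemma borel_measurable_SUP_continuous:
  fixes g :: "'x \<Rightarrow> real \<Rightarrow> real"
  assumes ab: "a \<le> b"
    and cont: "\<And>x. x \<in> space M \<Longrightarrow> continuous_on {a..b} (g x)"
    and meas: "\<And>E. E \<in> {a..b} \<Longrightarrow> (\<lambda>x. g x E) \<in> borel_measurable M"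
  shows "(\<lambda>x. SUP E\<in>{a..b}. g x E) \<in> borel_measurable M"
  unfolding borel_measurable_iff_greater
proof
  fix c :: real
  obtain D :: "real set" where D: "countable D" "D \<subseteq> {a..b}" "{a..b} \<subseteq> closure D" by (rule separable)
  have bdd: "bdd_above (g x ` {a..b})" if "x \<in> space M" for x
    using compact_continuous_image[OF cont[OF that]] by (intro bounded_imp_bdd_above compact_imp_bounded) auto
  have iff: "c < (SUP E\<in>{a..b}. g x E) \<longleftrightarrow> (\<exists>q\<in>D. c < g x q)" if x: "x \<in> space M" for x
  proof
    assume "c < (SUP E\<in>{a..b}. g x E)"
    then obtain E where E: "E \<in> {a..b}" "c < g x E" using less_cSUP_iff[OF _ bdd[OF x]] ab by auto
    obtain U where U: "open U" "U \<inter> {a..b} = g x -` {c<..} \<inter> {a..b}"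
      using cont[OF x, unfolded continuous_on_open_invariant, rule_format, OF open_greaterThan, of c] by auto
    have "E \<in> g x -` {c<..} \<inter> {a..b}" using E by simp
    then have "E \<in> U" unfolding U(2)[symmetric] by simp
    moreover have "E \<in> closure D" using D E by auto
    ultimately have "U \<inter> D \<noteq> {}" using open_Int_closure_eq_empty[OF U(1), of D] by auto
    then obtain q where "q \<in> D" "q \<in> U" by auto
    then show "\<exists>q\<in>D. c < g x q" using U D by auto
  next
    assume "\<exists>q\<in>D. c < g x q"
    then show "c < (SUP E\<in>{a..b}. g x E)" using less_cSUP_iff[OF _ bdd[OF x]] ab D by auto
  qed
  have "{x \<in> space M. c < (SUP E\<in>{a..b}. g x E)} = (\<Union>q\<in>D. {x \<in> space M. c < g x q})"
    using iff by auto
  also have "... \<in> sets M"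
  proof (rule sets.countable_UN''[OF D(1)])
    fix q assume "q \<in> D"
    then have [measurable]: "(\<lambda>x. g x q) \<in> borel_measurable M" using D meas by auto
    show "{x \<in> space M. c < g x q} \<in> sets M" by measurable
  qed
  finally show "{x \<in> space M. c < (SUP E\<in>{a..b}. g x E)} \<in> sets M" .
qed

definition sup_dev :: "nat \<Rightarrow> real \<Rightarrow> real \<Rightarrow> (nat \<times> nat \<Rightarrow> real) \<Rightarrow> real" where
  "sup_dev N a \<eta> x = (SUP E\<in>{-a..a}. density_dev N (\<lambda>i j. sym_ext x i j / sqrt N) \<eta> E)"

lemma borel_measurable_sup_dev:
  assumes N: "N > 0" and \<eta>: "\<eta> > 0" and a: "a \<ge> 0"
  shows "sup_dev N a \<eta> \<in> borel_measurable (iid (pairs N) borel)"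
  unfolding sup_dev_def
proof (rule borel_measurable_SUP_continuous)
  have W: "sym_kernel (\<lambda>i j. sym_ext x i j / sqrt N)" for x :: "nat \<times> nat \<Rightarrow> real"
    by (rule sym_kernel_sym_ext)
  show "- a \<le> a" using a by simp
  fix x
  have "(1 / \<eta>\<^sup>2)-lipschitz_on {-a..a} (\<lambda>E. avg_green N (\<lambda>i j. sym_ext x i j / sqrt N) (Complex E \<eta>))"
  proof (rule lipschitz_onI)
    fix E E'
    have "cmod (avg_green N (\<lambda>i j. sym_ext x i j / sqrt N) (Complex E \<eta>) - avg_green N (\<lambda>i j. sym_ext x i j / sqrt N) (Complex E' \<eta>))
       \<le> cmod (Complex E \<eta> - Complex E' \<eta>) / (Im (Complex E \<eta>) * Im (Complex E' \<eta>))"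
      using \<eta> by (intro avg_green_lipschitz W N) auto
    then show "dist (avg_green N (\<lambda>i j. sym_ext x i j / sqrt N) (Complex E \<eta>)) (avg_green N (\<lambda>i j. sym_ext x i j / sqrt N) (Complex E' \<eta>))
      \<le> 1 / \<eta>\<^sup>2 * dist E E'"
      by (simp add: dist_norm cmod_def power2_eq_square)
  qed simp
  from lipschitz_on_continuous_on[OF this]
  show "continuous_on {-a..a} (\<lambda>E. density_dev N (\<lambda>i j. sym_ext x i j / sqrt N) \<eta> E)"
    unfolding semicircle_density_def by (intro continuous_intros)
next
  fix E
  have "(\<lambda>x. green {..<N} (scaled (\<lambda>y. y) N x) (Complex E \<eta>) i i) \<in> borel_measurable (iid (pairs N) borel)" for i
    using \<eta> by (intro measurable_green_of_entries) auto
  moreover have "scaled (\<lambda>y. y) N x = (\<lambda>i j. sym_ext x i j / sqrt N)" for x by (simp add: scaled_def fun_eq_iff)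
  ultimately have [measurable]: "(\<lambda>x. green {..<N} (\<lambda>i j. sym_ext x i j / sqrt N) (Complex E \<eta>) i i) \<in> borel_measurable (iid (pairs N) borel)" for i
    by simp
  show "(\<lambda>x. density_dev N (\<lambda>i j. sym_ext x i j / sqrt N) \<eta> E) \<in> borel_measurable (iid (pairs N) borel)"
    unfolding avg_green_def by measurable
qed

section \<open>The choice of the parameters and the local law\<close>

lemma eventually_powr_ge:
  assumes "e > 0"
  obtains N0 :: nat where "\<And>N. N \<ge> N0 \<Longrightarrow> C \<le> real N powr e"
proof -
  obtain N0 :: nat where N0: "(max C 1) powr (1 / e) \<le> real N0" using real_arch_simple by blast
  have "C \<le> real N powr e" if "N \<ge> N0" for N
  proof -
    have "C \<le> ((max C 1) powr (1 / e)) powr e" using assms by (simp add: powr_powr)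
    also have "... \<le> real N powr e" using N0 that assms by (intro powr_mono2) auto
    finally show ?thesis .
  qed
  then show ?thesis using that by blast
qed

lemma stieltjes_eq_avg_green:
  assumes A: "A \<in> carrier_mat N N" "transpose_mat A = A"
    and Ax: "\<And>i j. i \<le> j \<Longrightarrow> j < N \<Longrightarrow> A $$ (i, j) = 1 / sqrt N * x (i, j)" and z: "Im z > 0"
  shows "stieltjes A z = avg_green N (\<lambda>i j. sym_ext x i j / sqrt N) z"
  unfolding avg_green_def
proof (rule stieltjes_eq_trace_green[OF A(1) sym_kernel_sym_ext z])
  fix i j assume ij: "i < N" "j < N"
  have swap: "A $$ (i, j) = A $$ (j, i)"
    using arg_cong[OF A(2), of "\<lambda>B. B $$ (i, j)"] A(1) ij by simp
  show "sym_ext x i j / sqrt N = A $$ (i, j)"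
  proof (cases "i \<le> j")
    case True
    then show ?thesis using Ax[OF True ij(2)] by (simp add: sym_ext_def)
  next
    case False
    then show ?thesis using Ax[of j i] ij swap by (simp add: sym_ext_def)
  qed
qed

lemma basic_scales:
  fixes N :: nat and \<tau> \<eta> \<delta> :: real
  assumes N: "N \<ge> 1" and \<tau>: "0 < \<tau>" "\<tau> < 1"
  defines "\<eta> \<equiv> 1 / real N powr (1 - \<tau>)" and "\<delta> \<equiv> real N powr (- \<tau> / 2)"
  shows "0 < \<eta>" "\<eta> \<le> 1" "0 < \<delta>" "1 / sqrt N \<le> \<delta>" "1 / (N * \<eta>) \<le> \<delta>\<^sup>2"
proof -
  have N0: "real N > 0" "real N \<ge> 1" using N by auto
  have \<eta>: "\<eta> = real N powr (\<tau> - 1)" using powr_minus_divide[of "real N" "1 - \<tau>"] by (simp add: \<eta>_def)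
  show "0 < \<eta>" "0 < \<delta>" using N0 by (auto simp: \<eta> \<delta>_def)
  have "real N powr (\<tau> - 1) \<le> real N powr 0" using N0 \<tau> by (intro powr_mono) auto
  then show "\<eta> \<le> 1" using N0 by (simp add: \<eta>)
  have "1 / sqrt N = real N powr (- 1 / 2)" using N0 by (simp add: powr_half_sqrt powr_minus_divide)
  also have "... \<le> \<delta>" unfolding \<delta>_def using N0 \<tau> by (intro powr_mono) auto
  finally show "1 / sqrt N \<le> \<delta>" .
  have "N * \<eta> = real N powr 1 * real N powr (\<tau> - 1)" using N0 by (simp add: \<eta>)
  also have "... = real N powr \<tau>" unfolding powr_add[symmetric] by simp
  finally have "N * \<eta> = real N powr \<tau>" .
  then have e: "1 / (N * \<eta>) = real N powr (- \<tau>)" by (simp add: powr_minus_divide)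
  have "\<delta>\<^sup>2 = real N powr (- \<tau> / 2) * real N powr (- \<tau> / 2)" by (simp add: \<delta>_def power2_eq_square)
  also have "... = real N powr (- \<tau>)" unfolding powr_add[symmetric] by simp
  finally show "1 / (N * \<eta>) \<le> \<delta>\<^sup>2" using e by simp
qed

text \<open>
  Every error term is at most a constant times N^(e/2 - \<tau>/4); one half of the exponent e remains to
  absorb the constants. The term sqrt \<eta>, which comes from the distance between the semicircle density
  and its regularisation at scale \<eta>, is the one for which \<tau> \<le> 2/3 is needed, since
  (1 - \<tau>)/2 \<ge> \<tau>/4 means just this. The choice e \<le> \<tau>/4 makes 12 L \<delta> tend to 0.
\<close>

lemma error_terms_eventually_small:
  fixes \<tau> e a :: real
  assumes \<tau>: "0 < \<tau>" "\<tau> < 2 / 3" and e: "0 < e" "e \<le> \<tau> / 4" and a: "a > 0"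
  obtains N0 :: nat where "N0 \<ge> 1"
    "\<And>N. N \<ge> N0 \<Longrightarrow> 12 * real N powr e * real N powr (- \<tau> / 2) \<le> 1 / 1600"
    "\<And>N (\<eta>::real). N \<ge> N0 \<Longrightarrow> \<eta> = 1 / real N powr (1 - \<tau>) \<Longrightarrow>
       8 / real (N ^ 4) / \<eta>\<^sup>2 + 8 / real (N ^ 4) / \<eta> \<le> sqrt (12 * real N powr e * real N powr (- \<tau> / 2)) / 2"
    "\<And>N (\<eta>::real). N \<ge> N0 \<Longrightarrow> \<eta> = 1 / real N powr (1 - \<tau>) \<Longrightarrow>
       law_error N (N ^ 4) a \<eta> (5 * sqrt (12 * real N powr e * real N powr (- \<tau> / 2)))
       \<le> real N powr e * (1 / real N powr (\<tau> / 4))"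
proof -
  define c where "c = sqrt (2 * a + 1) + 1"
  define C where "C = 20 + 1 + 2 * a + c + 2 * a"
  have c0: "c > 0" using a by (simp add: c_def add_nonneg_pos)
  obtain N1 :: nat where N1: "\<And>N. N \<ge> N1 \<Longrightarrow> C \<le> real N powr (e / 2)"
    using eventually_powr_ge[of "e / 2" C] e by auto
  obtain N2 :: nat where N2: "\<And>N. N \<ge> N2 \<Longrightarrow> 19200 \<le> real N powr (\<tau> / 2 - e)"
    using eventually_powr_ge[of "\<tau> / 2 - e" 19200] e \<tau> by auto
  show ?thesis
  proof (rule that[of "max 32 (max N1 N2)"])
    fix N :: nat assume "N \<ge> max 32 (max N1 N2)"
    then have N: "N \<ge> 32" "N \<ge> N1" "N \<ge> N2" by auto
    define x where "x = real N"
    have x: "x \<ge> 32" "x > 0" "x \<ge> 1" using N(1) by (auto simp: x_def)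
    have x4: "real (N ^ 4) = x powr 4" using x by (simp add: x_def powr_numeral)
    define y where "y = x powr (- \<tau> / 4)"
    have y: "1 / x powr (\<tau> / 4) = y" by (simp add: y_def powr_minus_divide)
    have y0: "y > 0" using x by (simp add: y_def)
    have ley: "x powr s \<le> y" if "s \<le> - \<tau> / 4" for s unfolding y_def using x that by (intro powr_mono) auto
    define r where "r = 12 * x powr e * x powr (- \<tau> / 2)"
    have r: "r = 12 * x powr (e - \<tau> / 2)" unfolding r_def mult.assoc powr_add[symmetric] by simp
    have sr: "sqrt r = sqrt 12 * (x powr (e / 2) * y)"
    proof -
      have "r = 12 * (x powr (e / 2) * y)\<^sup>2"
        unfolding r power2_eq_square y_def by (simp add: mult_ac flip: powr_add)
      then show ?thesis using y0 by (simp add: real_sqrt_mult)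
    qed
    have "x powr (e - \<tau> / 2) = 1 / x powr (\<tau> / 2 - e)"
      using powr_minus_divide[of x "\<tau> / 2 - e"] by simp
    also have "... \<le> 1 / 19200" using N2[OF N(3)] x by (intro divide_left_mono) (auto simp: x_def)
    finally have "r \<le> 1 / 1600" unfolding r by simp
    then show "12 * real N powr e * real N powr (- \<tau> / 2) \<le> 1 / 1600" by (simp add: r_def x_def)
    fix \<eta> :: real assume "\<eta> = 1 / real N powr (1 - \<tau>)"
    then have \<eta>: "\<eta> = x powr (\<tau> - 1)" using powr_minus_divide[of x "1 - \<tau>"] by (simp add: x_def)
    have i1: "1 / real (N ^ 4) / \<eta> = x powr (- 3 - \<tau>)"
    proof -
      have "1 / real (N ^ 4) / \<eta> = x powr (- 4) * x powr (- (\<tau> - 1))"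
        unfolding x4 \<eta> powr_minus_divide by simp
      then show ?thesis unfolding powr_add[symmetric] by simp
    qed
    have i2: "1 / real (N ^ 4) / \<eta>\<^sup>2 = x powr (- 2 - 2 * \<tau>)"
    proof -
      have "1 / real (N ^ 4) / \<eta>\<^sup>2 = x powr (- 4) * (x powr (- (\<tau> - 1)) * x powr (- (\<tau> - 1)))"
        unfolding x4 \<eta> powr_minus_divide by (simp add: power2_eq_square)
      then show ?thesis unfolding powr_add[symmetric] by (simp add: algebra_simps)
    qed
    have "8 / real (N ^ 4) / \<eta>\<^sup>2 + 8 / real (N ^ 4) / \<eta> = 8 * x powr (- 2 - 2 * \<tau>) + 8 * x powr (- 3 - \<tau>)"
      unfolding i1[symmetric] i2[symmetric] by simp
    also have "... \<le> 8 * x powr (- 2) + 8 * x powr (- 2)"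
      using x \<tau> by (intro add_mono mult_left_mono powr_mono) auto
    also have "... = 16 / x * (1 / x)" using x by (simp add: powr_minus_divide powr_numeral power2_eq_square)
    also have "... \<le> 1 / 2 * (1 / x)" using x by (intro mult_right_mono) auto
    also have "1 / x \<le> sqrt r"
    proof (rule real_le_rsqrt)
      have "(1 / x)\<^sup>2 = x powr (- 2)" using x by (simp add: powr_minus_divide powr_numeral power_divide)
      also have "... \<le> x powr (e - \<tau> / 2)" using x e \<tau> by (intro powr_mono) auto
      also have "... \<le> r" unfolding r by simp
      finally show "(1 / x)\<^sup>2 \<le> r" .
    qed
    finally show "8 / real (N ^ 4) / \<eta>\<^sup>2 + 8 / real (N ^ 4) / \<eta> \<le> sqrt (12 * real N powr e * real N powr (- \<tau> / 2)) / 2"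
      by (simp add: r_def x_def)
    have t1: "5 * sqrt r \<le> 20 * (x powr (e / 2) * y)"
    proof -
      have "sqrt 12 \<le> sqrt (4\<^sup>2)" by (intro real_sqrt_le_mono) simp
      then have "sqrt 12 \<le> 4" by simp
      then have "sqrt 12 * (x powr (e / 2) * y) \<le> 4 * (x powr (e / 2) * y)" using y0 by (intro mult_right_mono) auto
      then show ?thesis unfolding sr by linarith
    qed
    have one: "1 \<le> x powr (e / 2)" using x e by (intro ge_one_powr_ge_zero) auto
    have up: "t * y \<le> t * (x powr (e / 2) * y)" if "t \<ge> 0" for t
      using mult_right_mono[OF one, of "t * y"] that y0 by (simp add: mult_ac)
    have t2: "1 / (N * \<eta>) \<le> 1 * y"
    proof -
      have "1 / (N * \<eta>) = x powr (- 1) * x powr (- (\<tau> - 1))"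
        unfolding \<eta> powr_minus_divide using x by (simp add: x_def)
      also have "... = x powr (- \<tau>)" unfolding powr_add[symmetric] by simp
      finally show ?thesis using ley[of "- \<tau>"] \<tau> by simp
    qed
    have t3: "2 * a / real (N ^ 4) / \<eta>\<^sup>2 \<le> 2 * a * y"
    proof -
      have "2 * a / real (N ^ 4) / \<eta>\<^sup>2 = 2 * a * x powr (- 2 - 2 * \<tau>)" unfolding i2[symmetric] by simp
      also have "... \<le> 2 * a * y" using a \<tau> by (intro mult_left_mono ley) auto
      finally show ?thesis .
    qed
    have t4: "c * sqrt \<eta> \<le> c * y"
    proof -
      have "sqrt \<eta> = x powr ((\<tau> - 1) / 2)"
        unfolding \<eta> using x by (simp add: powr_half_sqrt[symmetric] powr_powr)
      then show ?thesis using c0 \<tau> ley[of "(\<tau> - 1) / 2"] by (intro mult_left_mono) auto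
    qed
    have t5: "sqrt (2 * a / real (N ^ 4) * (2 * a)) \<le> 2 * a * y"
    proof -
      have "2 * a / real (N ^ 4) * (2 * a) = (2 * a / x\<^sup>2)\<^sup>2"
        by (simp add: x_def power2_eq_square power4_eq_xxxx)
      then have "sqrt (2 * a / real (N ^ 4) * (2 * a)) = 2 * a / x\<^sup>2"
        using a by (simp add: real_sqrt_abs)
      also have "... = 2 * a * x powr (- 2)" using x by (simp add: powr_minus_divide powr_numeral)
      also have "... \<le> 2 * a * y" using a \<tau> by (intro mult_left_mono ley) auto
      finally show ?thesis .
    qed
    have "5 * sqrt r + 1 / (N * \<eta>) + 2 * a / real (N ^ 4) / \<eta>\<^sup>2 + c * sqrt \<eta> + sqrt (2 * a / real (N ^ 4) * (2 * a))
       \<le> C * (x powr (e / 2) * y)"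
      using t1 t2 t3 t4 t5 up[of 1] up[of "2 * a"] up[of c] a c0 unfolding C_def distrib_right by linarith
    also have "... \<le> x powr (e / 2) * (x powr (e / 2) * y)"
      using N1[OF N(2)] y0 by (intro mult_right_mono) (auto simp: x_def)
    also have "... = x powr e * y" by (simp flip: powr_add mult.assoc)
    finally show "law_error N (N ^ 4) a \<eta> (5 * sqrt (12 * real N powr e * real N powr (- \<tau> / 2)))
       \<le> real N powr e * (1 / real N powr (\<tau> / 4))"
      unfolding r_def c_def y[symmetric] x_def .
  qed simp
qed

theorem theorem27:
  fixes M :: "'a measure"
    and H :: "nat \<Rightarrow> 'a \<Rightarrow> real mat"
    and T :: "nat \<Rightarrow> 't measure"
    and P :: "nat \<Rightarrow> 't \<Rightarrow> real measure"
    and \<tau> :: real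
    and \<eta> :: "nat \<Rightarrow> real"
  assumes "prob_space M"
    and "0 < \<tau>" and "\<tau> < 1" and "\<tau> < 2 / 3"
    and "curie_weiss_type M H T P"
    and "\<And>N. N \<ge> 1 \<Longrightarrow> \<eta> N = 1 / real N powr (1 - \<tau>)"
  shows "stochastically_dominated M
     (\<lambda>N \<omega>. complex_of_real
        (SUP E \<in> {- (1 / \<tau>)..1 / \<tau>}.
           \<bar>1 / pi * Im (stieltjes (H N \<omega>) (Complex E (\<eta> N))) - semicircle_density E\<bar>))
     (\<lambda>N \<omega>. 1 / real N powr (\<tau> / 4))"
proof -
  interpret M: prob_space M by fact
  define a where "a = 1 / \<tau>"
  have a: "a > 0" using assms(2) by (simp add: a_def)
  define S where "S N \<omega> = (SUP E \<in> {- (1 / \<tau>)..1 / \<tau>}. \<bar>1 / pi * Im (stieltjes (H N \<omega>) (Complex E (\<eta> N))) - semicircle_density E\<bar>)" for N \<omega>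
  note \<tau> = assms(2,3,4)
  note \<eta>_def = assms(6)
  note sc = basic_scales[OF _ \<tau>(1,2)]
  note cw = assms(5)[unfolded curie_weiss_type_def]
  note cw_sym = cw[THEN conjunct1, rule_format]
    and cw_law = cw[THEN conjunct2, THEN conjunct1, rule_format]
    and cw_mom = cw[THEN conjunct2, THEN conjunct2, rule_format]
  have H: "H N \<omega> \<in> carrier_mat N N" "transpose_mat (H N \<omega>) = H N \<omega>" if "N \<ge> 1" "\<omega> \<in> space M" for N \<omega>
    using cw_sym[OF that] by (rule conjunct1) (use cw_sym[OF that] in \<open>rule conjunct2\<close>)
  define entries where "entries N X \<longleftrightarrow> de_finetti_type M (pairs N) X (T N) (P N) \<and>
        (\<forall>\<omega>\<in>space M. \<forall>i j. i \<le> j \<and> j < N \<longrightarrow> H N \<omega> $$ (i, j) = 1 / sqrt (real N) * X (i, j) \<omega>)" for N X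
  define X where "X N = (SOME X. entries N X)" for N
  have X_entries: "entries N (X N)" if "N \<ge> 1" for N
  proof -
    have "\<exists>X. entries N X" using cw_law[OF that] unfolding entries_def pairs_def .
    then show ?thesis unfolding X_def by (rule someI_ex)
  qed
  have X: "de_finetti_type M (pairs N) (X N) (T N) (P N)" if "N \<ge> 1" for N
    using X_entries[OF that] by (simp add: entries_def)
  have HX: "H N \<omega> $$ (i, j) = 1 / sqrt (real N) * X N (i, j) \<omega>" if "N \<ge> 1" "\<omega> \<in> space M" "i \<le> j" "j < N" for N \<omega> i j
    using X_entries[OF that(1)] that(2-) by (simp add: entries_def)
  define bounds where "bounds p K \<longleftrightarrow> K \<ge> 0 \<and> (\<forall>N\<ge>1.
        (\<integral>\<^sup>+t. ennreal (\<bar>moment 1 (P N t)\<bar> ^ p) \<partial>T N) \<le> ennreal (K * real N powr (- real p / 2)) \<and>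
        (\<integral>\<^sup>+t. ennreal (\<bar>1 - moment 2 (P N t)\<bar> ^ p) \<partial>T N) \<le> ennreal (K * real N powr (- real p / 2)) \<and>
        (\<forall>t\<in>space (T N). (\<integral>\<^sup>+y. ennreal (\<bar>y - moment 1 (P N t)\<bar> ^ p) \<partial>P N t) \<le> ennreal K) \<and>
        (\<forall>t\<in>space (T N). (\<integral>\<^sup>+y. ennreal (\<bar>y\<^sup>2 - moment 2 (P N t)\<bar> ^ p) \<partial>P N t) \<le> ennreal K))" for p K
  define Kf where "Kf p = (SOME K. bounds p K)" for p
  have Kf_bounds: "bounds p (Kf p)" if "p > 0" "even p" for p
  proof -
    have "\<exists>K. bounds p K" using cw_mom[OF that] unfolding bounds_def by (simp only: Bex_def)
    then show ?thesis unfolding Kf_def by (rule someI_ex)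
  qed
  have Kf: "Kf p \<ge> 0" if "p > 0" "even p" for p
    using Kf_bounds[OF that] by (simp only: bounds_def)
  have b1: "(\<integral>\<^sup>+t. ennreal (\<bar>moment 1 (P N t)\<bar> ^ p) \<partial>T N) \<le> ennreal (Kf p * real N powr (- real p / 2))"
    if h: "p > 0" "even p" "N \<ge> 1" for p N
    by (rule Kf_bounds[OF h(1,2), unfolded bounds_def, THEN conjunct2, rule_format, OF h(3), THEN conjunct1])
  have b2: "(\<integral>\<^sup>+t. ennreal (\<bar>1 - moment 2 (P N t)\<bar> ^ p) \<partial>T N) \<le> ennreal (Kf p * real N powr (- real p / 2))"
    if h: "p > 0" "even p" "N \<ge> 1" for p N
    by (rule Kf_bounds[OF h(1,2), unfolded bounds_def, THEN conjunct2, rule_format, OF h(3), THEN conjunct2, THEN conjunct1])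
  have b3: "(\<integral>\<^sup>+y. ennreal (\<bar>y - moment 1 (P N t)\<bar> ^ p) \<partial>P N t) \<le> ennreal (Kf p)"
    if h: "p > 0" "even p" "N \<ge> 1" "t \<in> space (T N)" for p N t
    by (rule Kf_bounds[OF h(1,2), unfolded bounds_def, THEN conjunct2, rule_format, OF h(3), THEN conjunct2, THEN conjunct2, THEN conjunct1, rule_format, OF h(4)])
  define V where "V N \<omega> = (\<lambda>i\<in>pairs N. X N i \<omega>)" for N \<omega>
  have V: "V N \<in> M \<rightarrow>\<^sub>M iid (pairs N) borel" if "N \<ge> 1" for N
    using X[OF that] unfolding V_def de_finetti_type_def by (intro measurable_restrict) auto
  have \<eta>: "0 < \<eta> N" "\<eta> N \<le> 1" if "N \<ge> 1" for N
    using sc(1,2)[OF that] \<eta>_def[OF that] by auto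
  have SV: "S N \<omega> = sup_dev N a (\<eta> N) (V N \<omega>)" if N: "N \<ge> 1" and \<omega>: "\<omega> \<in> space M" for N \<omega>
  proof -
    have "stieltjes (H N \<omega>) (Complex E (\<eta> N)) = avg_green N (\<lambda>i j. sym_ext (V N \<omega>) i j / sqrt N) (Complex E (\<eta> N))" for E
    proof (rule stieltjes_eq_avg_green[OF H[OF N \<omega>]])
      fix i j :: nat assume ij: "i \<le> j" "j < N"
      then have "(i, j) \<in> pairs N" by (simp add: pairs_def)
      then show "H N \<omega> $$ (i, j) = 1 / sqrt N * V N \<omega> (i, j)" using HX[OF N \<omega> ij] by (simp add: V_def)
    qed (use \<eta>[OF N] in simp)
    then show ?thesis unfolding S_def sup_dev_def a_def by simp
  qed
  have sup_meas: "sup_dev N a (\<eta> N) \<in> borel_measurable (iid (pairs N) borel)" if "N \<ge> 1" for N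
    using that \<eta>[OF that] a by (intro borel_measurable_sup_dev) auto
  have S_meas: "S N \<in> borel_measurable M" if N: "N \<ge> 1" for N
  proof -
    have "(\<lambda>\<omega>. sup_dev N a (\<eta> N) (V N \<omega>)) \<in> borel_measurable M"
      by (rule measurable_compose[OF V[OF N] sup_meas[OF N]])
    then show ?thesis using SV[OF N] by (simp cong: measurable_cong)
  qed
  have tail: "\<exists>C\<ge>0. \<forall>N\<ge>1. measure M {\<omega> \<in> space M. cmod (complex_of_real (S N \<omega>)) > real N powr \<epsilon> * (1 / real N powr (\<tau> / 4))} \<le> C * real N powr (- D)"
    if \<epsilon>: "\<epsilon> > 0" and D: "D > 0" for \<epsilon> D :: real
  proof -
    define e where "e = min \<epsilon> (\<tau> / 4)"
    have e: "0 < e" "e \<le> \<tau> / 4" "e \<le> \<epsilon>" using \<epsilon> \<tau> by (auto simp: e_def)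
    obtain N0 :: nat where N0: "N0 \<ge> 1"
      and small: "\<And>N. N \<ge> N0 \<Longrightarrow> 12 * real N powr e * real N powr (- \<tau> / 2) \<le> 1 / 1600"
      and step: "\<And>N (\<eta>::real). N \<ge> N0 \<Longrightarrow> \<eta> = 1 / real N powr (1 - \<tau>) \<Longrightarrow>
         8 / real (N ^ 4) / \<eta>\<^sup>2 + 8 / real (N ^ 4) / \<eta> \<le> sqrt (12 * real N powr e * real N powr (- \<tau> / 2)) / 2"
      and total: "\<And>N (\<eta>::real). N \<ge> N0 \<Longrightarrow> \<eta> = 1 / real N powr (1 - \<tau>) \<Longrightarrow>
         law_error N (N ^ 4) a \<eta> (5 * sqrt (12 * real N powr e * real N powr (- \<tau> / 2)))
         \<le> real N powr e * (1 / real N powr (\<tau> / 4))"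
      using error_terms_eventually_small[OF \<tau>(1,3) e(1,2) a] by blast
    \<comment> \<open>The union bound runs over 2 N (N^4 + 1)^2 events, hence the 9 in the exponent.\<close>
    define p where "p = nat \<lceil>(9 + D) / (2 * e)\<rceil> + 1"
    have p: "p \<ge> 1" by (simp add: p_def)
    have pe: "9 + D \<le> 2 * real p * e"
    proof -
      have "(9 + D) / (2 * e) \<le> real p" unfolding p_def by linarith
      then show ?thesis using e by (simp add: field_simps)
    qed
    define K where "K = Kf 2 + Kf (2 * p) + Kf 4 + 4 ^ p * (Kf (4 * p) + Kf 2 ^ (2 * p))"
    define h where "h = quad_const p K"
    define k where "k = 4 ^ p * (Kf (2 * p) + Kf (4 * p))"
    have K0: "K \<ge> 0" using Kf p by (auto simp: K_def intro!: add_nonneg_nonneg mult_nonneg_nonneg)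
    have h0: "h \<ge> 0" using K0 by (auto simp: h_def quad_const_def intro!: add_nonneg_nonneg mult_nonneg_nonneg)
    have k0: "k \<ge> 0" using Kf p by (auto simp: k_def intro!: add_nonneg_nonneg mult_nonneg_nonneg)
    have main: "measure M {\<omega> \<in> space M. cmod (complex_of_real (S N \<omega>)) > real N powr \<epsilon> * (1 / real N powr (\<tau> / 4))}
        \<le> (8 * h + k) * real N powr (- D)" if N: "N \<ge> N0" for N
    proof -
      have N1: "N \<ge> 1" using N N0 by simp
      then have x: "real N \<ge> 1" "real N > 0" by auto
      define thr where "thr = real N powr \<epsilon> * (1 / real N powr (\<tau> / 4))"
      define L where "L = real N powr e"
      \<comment> \<open>The grids have N^4 steps, because s moves by at most \<eta>^(-2) \<le> N^2 times the step.\<close>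
      define J where "J = N ^ 4"
      define \<delta> where "\<delta> = real N powr (- \<tau> / 2)"
      have L: "L \<ge> 1" unfolding L_def using x e by (intro ge_one_powr_ge_zero) auto
      have J: "J > 0" using N1 by (simp add: J_def)
      have thr: "real N powr e * (1 / real N powr (\<tau> / 4)) \<le> thr"
        unfolding thr_def using e x by (intro mult_right_mono powr_mono) auto
      let ?PB = "iid (pairs N) (borel :: real measure)"
      define B where "B = {x \<in> space ?PB. \<bar>sup_dev N a (\<eta> N) x\<bar> > thr}"
      have B: "B \<in> sets ?PB" unfolding B_def using sup_meas[OF N1] by measurable
      have dF: "mixing_space (T N) (P N)"
        and law: "\<And>B. B \<in> sets ?PB \<Longrightarrow> emeasure M {\<omega> \<in> space M. V N \<omega> \<in> B} = (\<integral>\<^sup>+t. emeasure (iid (pairs N) (P N t)) B \<partial>T N)"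
        using X[OF N1] unfolding de_finetti_type_def V_def by auto
      have TN: "prob_space (T N)" and PN: "P N \<in> T N \<rightarrow>\<^sub>M weak_borel" using dF by (auto simp: mixing_space_def)
      have Pt: "prob_space (P N t)" "sets (P N t) = sets borel" if "t \<in> space (T N)" for t
        using measurable_space[OF PN that] by (auto simp: space_weak_borel)
      have int: "integrable (P N t) (\<lambda>y. y ^ 1)" "integrable (P N t) (\<lambda>y. y ^ 2)" if t: "t \<in> space (T N)" for t
        using centred_moments_of_moment_bounds(4,5)[OF Pt[OF t] order_refl Kf b3[OF _ _ N1 t]] by blast+
      define c where "c = 2 * N * (real J + 1)\<^sup>2 * (h / L ^ (2 * p))"
      have c0: "c \<ge> 0" using h0 L by (simp add: c_def)
      have "(\<integral>\<^sup>+t. emeasure (iid (pairs N) (P N t)) B \<partial>T N) \<le> ennreal (c + 4 ^ p * (Kf (2 * p) + Kf (4 * p)) / L ^ (2 * p))"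
      proof (rule mixture_bound[OF TN measurable_moment[OF PN int(1)] measurable_moment[OF PN int(2)] N1 _ p])
        show "L > 0" using L by simp
        show "0 \<le> Kf (2 * p)" "0 \<le> Kf (4 * p)" using Kf p by auto
        show "(\<integral>\<^sup>+t. ennreal (\<bar>moment 1 (P N t)\<bar> ^ (4 * p)) \<partial>T N) \<le> ennreal (Kf (4 * p) * real N powr (- real (4 * p) / 2))"
          using p by (intro b1 N1) auto
        show "(\<integral>\<^sup>+t. ennreal (\<bar>1 - moment 2 (P N t)\<bar> ^ (2 * p)) \<partial>T N) \<le> ennreal (Kf (2 * p) * real N powr (- real (2 * p) / 2))"
          using p by (intro b2 N1) auto
        show "c \<ge> 0" by (rule c0)
      next
        fix t assume t: "t \<in> space (T N)"
        interpret Pt: prob_space "P N t" by (rule Pt(1)[OF t])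
        interpret PP: prob_space "iid (pairs N) (P N t)" by (intro prob_space_PiM) unfold_locales
        show "emeasure (iid (pairs N) (P N t)) B \<le> 1" by (rule PP.emeasure_le_1)
      next
        fix t assume t: "t \<in> space (T N)" and good: "\<bar>moment 2 (P N t) - (moment 1 (P N t))\<^sup>2 - 1\<bar> \<le> L / sqrt N"
        let ?PP = "iid (pairs N) (P N t)"
        have seq: "sets ?PP = sets ?PB" by (intro sets_PiM_cong refl Pt(2)[OF t])
        show "emeasure ?PP B \<le> ennreal c"
        proof (rule law_for_iid_entries[OF Pt[OF t] p Kf b3[OF _ _ N1 t], where N = N and J = J and \<eta> = "\<eta> N" and a = a and L = L and \<delta> = \<delta>])
          show "0 < N" using N1 by simp
          show "1 / sqrt N \<le> \<delta>" "0 < \<delta>" unfolding \<delta>_def using sc[OF N1] by auto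
          show "1 / (N * \<eta> N) \<le> \<delta>\<^sup>2" unfolding \<delta>_def \<eta>_def[OF N1] using sc(5)[OF N1] by simp
          show "12 * L * \<delta> \<le> 1 / 1600" using small[OF N] by (simp add: L_def \<delta>_def)
          show "8 / J / (\<eta> N)\<^sup>2 + 8 / J / \<eta> N \<le> sqrt (12 * L * \<delta>) / 2"
            using step[OF N \<eta>_def[OF N1]] by (simp add: L_def \<delta>_def J_def)
        next
          fix B' assume B': "B' \<in> sets ?PP"
            "emeasure ?PP B' \<le> ennreal (2 * N * (real J + 1)\<^sup>2 * (quad_const p (Kf 2 + Kf (2 * p) + Kf 4 + 4 ^ p * (Kf (4 * p) + Kf 2 ^ (2 * p))) / L ^ (2 * p)))"
            and dev: "\<And>x E. x \<in> space ?PP - B' \<Longrightarrow> E \<in> {-a..a} \<Longrightarrow>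
              density_dev N (\<lambda>i j. sym_ext x i j / sqrt N) (\<eta> N) E
              \<le> law_error N J a (\<eta> N) (5 * sqrt (12 * L * \<delta>))"
          \<comment> \<open>Off the exceptional set the deviation is below the threshold at every energy.\<close>
          have "B \<subseteq> B'"
          proof
            fix x assume x: "x \<in> B"
            show "x \<in> B'"
            proof (rule ccontr)
              assume "x \<notin> B'"
              then have "x \<in> space ?PP - B'" using x sets_eq_imp_space_eq[OF seq] by (auto simp: B_def)
              note d = dev[OF this]
              let ?g = "\<lambda>E. density_dev N (\<lambda>i j. sym_ext x i j / sqrt N) (\<eta> N) E"
              have bd: "?g E \<le> thr" if "E \<in> {-a..a}" for E
                using d[OF that] total[OF N \<eta>_def[OF N1]] thr by (simp add: L_def \<delta>_def J_def)
              have "sup_dev N a (\<eta> N) x \<le> thr"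
                unfolding sup_dev_def using a bd by (intro cSUP_least) auto
              moreover have "0 \<le> sup_dev N a (\<eta> N) x"
                unfolding sup_dev_def
              proof (rule cSUP_upper2[where x = 0])
                show "bdd_above (?g ` {-a..a})" by (rule bdd_aboveI2[where M = thr]) (rule bd)
              qed (use a in auto)
              ultimately show False using x by (simp add: B_def)
            qed
          qed
          then have "emeasure ?PP B \<le> emeasure ?PP B'" using B'(1) by (rule emeasure_mono)
          also have "... \<le> ennreal c" using B'(2) by (simp add: c_def h_def K_def)
          finally show ?thesis .
        qed (use \<eta>[OF N1] a L J good in auto)
      qed
      also have "c + 4 ^ p * (Kf (2 * p) + Kf (4 * p)) / L ^ (2 * p) \<le> (8 * h + k) * real N powr (- D)"
      proof -
        have Lp: "1 / L ^ (2 * p) = real N powr (- (2 * real p * e))"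
        proof -
          have "L ^ (2 * p) = real N powr (2 * real p * e)"
            using x by (simp add: L_def powr_powr mult_ac flip: powr_realpow)
          then show ?thesis by (simp add: powr_minus_divide)
        qed
        have k1: "4 ^ p * (Kf (2 * p) + Kf (4 * p)) / L ^ (2 * p) \<le> k * real N powr (- D)"
        proof -
          have "4 ^ p * (Kf (2 * p) + Kf (4 * p)) / L ^ (2 * p) = k * (1 / L ^ (2 * p))" by (simp add: k_def)
          also have "... \<le> k * real N powr (- D)"
            unfolding Lp using k0 x pe by (intro mult_left_mono powr_mono) auto
          finally show ?thesis .
        qed
        have "(real J + 1)\<^sup>2 \<le> (2 * real N ^ 4)\<^sup>2" using x by (intro power_mono) (auto simp: J_def)
        also have "... = 4 * real N ^ 8" by (simp add: power_mult_distrib flip: power_mult)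
        finally have "c \<le> 2 * N * (4 * real N ^ 8) * (h / L ^ (2 * p))"
          unfolding c_def using h0 L by (intro mult_right_mono mult_left_mono) auto
        also have "... = 8 * h * (real N ^ 9 * (1 / L ^ (2 * p)))" by (simp add: eval_nat_numeral)
        also have "real N ^ 9 * (1 / L ^ (2 * p)) = real N powr (9 - 2 * real p * e)"
        proof -
          have n9: "real N ^ 9 = real N powr 9" using x by (simp add: powr_numeral)
          show ?thesis unfolding n9 Lp powr_add[symmetric] by simp
        qed
        also have "8 * h * real N powr (9 - 2 * real p * e) \<le> 8 * h * real N powr (- D)"
          using h0 x pe by (intro mult_left_mono powr_mono) auto
        finally show ?thesis using k1 by (simp add: distrib_right)
      qed
      finally have "(\<integral>\<^sup>+t. emeasure (iid (pairs N) (P N t)) B \<partial>T N) \<le> ennreal ((8 * h + k) * real N powr (- D))"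
        by (simp add: ennreal_leI)
      moreover have "{\<omega> \<in> space M. cmod (complex_of_real (S N \<omega>)) > thr} = {\<omega> \<in> space M. V N \<omega> \<in> B}"
        using SV[OF N1] measurable_space[OF V[OF N1]] by (auto simp: B_def)
      ultimately have "emeasure M {\<omega> \<in> space M. cmod (complex_of_real (S N \<omega>)) > thr} \<le> ennreal ((8 * h + k) * real N powr (- D))"
        using law[OF B] by simp
      then show ?thesis unfolding thr_def M.emeasure_eq_measure using h0 k0 by simp
    qed
    \<comment> \<open>The last summand makes the bound trivial for the finitely many N below N0.\<close>
    define C where "C = 8 * h + k + real N0 powr D"
    show ?thesis
    proof (intro exI[of _ C] conjI allI impI)
      show "0 \<le> C" using h0 k0 by (simp add: C_def)
      fix N :: nat assume N: "N \<ge> 1"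
      show "measure M {\<omega> \<in> space M. cmod (complex_of_real (S N \<omega>)) > real N powr \<epsilon> * (1 / real N powr (\<tau> / 4))} \<le> C * real N powr (- D)"
      proof (cases "N \<ge> N0")
        case True
        from main[OF this] show ?thesis by (rule order_trans) (simp add: C_def mult_right_mono)
      next
        case False
        have "measure M {\<omega> \<in> space M. cmod (complex_of_real (S N \<omega>)) > real N powr \<epsilon> * (1 / real N powr (\<tau> / 4))} \<le> 1"
          by (rule M.prob_le_1)
        also have "1 = real N powr D * real N powr (- D)" using N by (simp flip: powr_add)
        also have "... \<le> C * real N powr (- D)"
        proof (intro mult_right_mono)
          have "real N powr D \<le> real N0 powr D" using False D by (intro powr_mono2) auto
          then show "real N powr D \<le> C" using h0 k0 by (simp add: C_def)
        qed simp
        finally show ?thesis .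
      qed
    qed
  qed
  show ?thesis
    unfolding stochastically_dominated_def S_def[symmetric]
    using S_meas tail by auto
qed

end
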